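(* Let $(H,G)$ be a crossed module of topological groups, and let $E\to B$ be an $(H,G)$ bibundle over a space $B$ such that $E$ is contractible when viewed as a space over $H$. Then $E\to B$ is a universal bibundle in the sense that, for any paracompact space $M$, pullback of bibundles $[f]\mapsto[f^*E]$ induces a (well-defined) bijection $$[M,B]_{H/t(G)}\;\cong\;\pi_0\mathbf{Bibun}_{(H,G)}(M).$$
   Context: A crossed module $(H,G)$ consists of topological groups $G,H$ and homomorphisms $t\colon G\to H$ (continuous) and $\alpha\colon H\to\operatorname{Aut}(G)$ (giving a continuous action of $H$ on $G$) with $t(\alpha(h)(g))=h\,t(g)\,h^{-1}$ and $\alpha(t(g))(g')=gg'g^{-1}$. Then $G_1=\ker t$ is central in $G$ and $t(G)$ is normal in $H$. Standing assumptions: the projections $G\to G/G_1$ and $H\to H/t(G)$ admit local sections, and $t(G)$ is identified with $G/G_1$ as a topological group. Paracompact spaces are understood to be Hausdorff. An $(H,G)$ bibundle on $M$ is a (locally trivial, right) principal $G$-bundle $P\to M$ with a continuous structure map $\psi\colon P\to H$ satisfying $\psi(pg)=\psi(p)t(g)$. An isomorphism of bibundles on $M$ is an isomorphism of principal $G$-bundles over the identity of $M$ commuting with structure maps; $\pi_0\mathbf{Bibun}_{(H,G)}(M)$ is the set of isomorphism classes. For $f\colon N\to M$, $f^*P=N\times_MP$ with structure map the composite $f^*P\to P\to H$. The type map of $P$ is $M\to H/t(G)$, $m\mapsto[\psi(p)]$ for any $p\in P_m$. $E$ is contractible as a space over $H$ if its structure map $\psi\colon E\to H$ is a homotopy equivalence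 in the category of spaces over $H$ (fibre homotopy equivalence over $H$, where $H$ is a space over itself by the identity). Let $\Phi\colon B\to H/t(G)$ be the type map of $E$. $[M,B]_{H/t(G)}$ denotes the set of continuous maps $f\colon M\to B$ modulo homotopy over $H/t(G)$: $f_0\sim f_1$ if there is a homotopy $h\colon M\times I\to B$ from $f_0$ to $f_1$ such that $\Phi\circ h(m,s)$ is independent of $s\in I$ for each $m\in M$. (Equivalently, it is the disjoint union over all continuous $\phi\colon M\to H/t(G)$ of the sets of homotopy classes, over $H/t(G)$, of maps $(M,\phi)\to(B,\Phi)$ over $H/t(G)$.) *)

theory Defs
  imports "HOL-Analysis.Analysis" "HOL-Algebra.Coset" "HOL-Algebra.Bij"
begin

section \<open>Topological preliminaries\<close>

definition paracompact_space :: "'a topology \<Rightarrow> bool" where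
  "paracompact_space X \<longleftrightarrow>
     Hausdorff_space X \<and>
     (\<forall>\<U>. (\<forall>U\<in>\<U>. openin X U) \<and> \<Union>\<U> = topspace X \<longrightarrow>
       (\<exists>\<V>. (\<forall>V\<in>\<V>. openin X V) \<and> \<Union>\<V> = topspace X \<and>
            (\<forall>V\<in>\<V>. \<exists>U\<in>\<U>. V \<subseteq> U) \<and> locally_finite_in X \<V>))"

definition quotient_topology :: "'a topology \<Rightarrow> ('a \<Rightarrow> 'b) \<Rightarrow> 'b topology" where
  "quotient_topology X q =
     topology (\<lambda>U. U \<subseteq> q ` topspace X \<and> openin X {x \<in> topspace X. q x \<in> U})"

lemma openin_quotient_topology:
  "openin (quotient_topology X q) U \<longleftrightarrow>
     U \<subseteq> q ` topspace X \<and> openin X {x \<in> topspace X. q x \<in> U}"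
proof -
  have "istopology (\<lambda>U. U \<subseteq> q ` topspace X \<and> openin X {x \<in> topspace X. q x \<in> U})"
    unfolding istopology_def
  proof (intro conjI allI impI)
    fix S T
    assume "S \<subseteq> q ` topspace X \<and> openin X {x \<in> topspace X. q x \<in> S}"
      and "T \<subseteq> q ` topspace X \<and> openin X {x \<in> topspace X. q x \<in> T}"
    moreover have "{x \<in> topspace X. q x \<in> S \<inter> T} =
        {x \<in> topspace X. q x \<in> S} \<inter> {x \<in> topspace X. q x \<in> T}" by auto
    ultimately show "S \<inter> T \<subseteq> q ` topspace X" "openin X {x \<in> topspace X. q x \<in> S \<inter> T}"
      by auto
  next
    fix \<K>
    assume K: "\<forall>K\<in>\<K>. K \<subseteq> q ` topspace X \<and> openin X {x \<in> topspace X. q x \<in> K}"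
    have "{x \<in> topspace X. q x \<in> \<Union>\<K>} = (\<Union>K\<in>\<K>. {x \<in> topspace X. q x \<in> K})" by auto
    then show "openin X {x \<in> topspace X. q x \<in> \<Union>\<K>}" using K by auto
    show "\<Union>\<K> \<subseteq> q ` topspace X" using K by auto
  qed
  then show ?thesis unfolding quotient_topology_def by (simp add: topology_inverse')
qed

lemma topspace_quotient_topology: "topspace (quotient_topology X q) = q ` topspace X"
proof
  show "topspace (quotient_topology X q) \<subseteq> q ` topspace X"
    using openin_quotient_topology[of X q "topspace (quotient_topology X q)"] by auto
  have "{x \<in> topspace X. q x \<in> q ` topspace X} = topspace X" by auto
  then have "openin (quotient_topology X q) (q ` topspace X)"
    by (simp add: openin_quotient_topology)
  then show "q ` topspace X \<subseteq> topspace (quotient_topology X q)" by (rule openin_subset)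
qed

lemma quotient_map_quotient_topology: "quotient_map X (quotient_topology X q) q"
  by (auto simp: quotient_map_def topspace_quotient_topology openin_quotient_topology)

definition admits_local_sections :: "'a topology \<Rightarrow> 'b topology \<Rightarrow> ('a \<Rightarrow> 'b) \<Rightarrow> bool" where
  "admits_local_sections X Y q \<longleftrightarrow>
     (\<forall>y \<in> topspace Y. \<exists>U s. openin Y U \<and> y \<in> U \<and>
        continuous_map (subtopology Y U) X s \<and> (\<forall>u\<in>U. q (s u) = u))"

text \<open>Spaces over a fixed space are given by a topology together with a structure map; two maps
  \<open>(X, p) \<rightarrow> (Y, q)\<close> over the base are homotopic over the base if they are homotopic through
  such maps.\<close>

definition map_over :: "'a topology \<Rightarrow> ('a \<Rightarrow> 'c) \<Rightarrow> ('b \<Rightarrow> 'c) \<Rightarrow> ('a \<Rightarrow> 'b) \<Rightarrow> bool" where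
  "map_over X p q f \<longleftrightarrow> (\<forall>x \<in> topspace X. q (f x) = p x)"

definition homotopy_equivalence_over ::
  "'a topology \<Rightarrow> ('a \<Rightarrow> 'c) \<Rightarrow> 'b topology \<Rightarrow> ('b \<Rightarrow> 'c) \<Rightarrow> ('a \<Rightarrow> 'b) \<Rightarrow> bool" where
  "homotopy_equivalence_over X p Y q f \<longleftrightarrow>
     continuous_map X Y f \<and> map_over X p q f \<and>
     (\<exists>g. continuous_map Y X g \<and> map_over Y q p g \<and>
          homotopic_with (map_over X p p) X X (g \<circ> f) id \<and>
          homotopic_with (map_over Y q q) Y Y (f \<circ> g) id)"

section \<open>Crossed modules of topological groups\<close>

locale topological_group = group G for G (structure) and T +
  assumes topspace_eq_carrier: "topspace T = carrier G"
    and continuous_mult: "continuous_map (prod_topology T T) T (\<lambda>(x, y). x \<otimes> y)"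
    and continuous_inv: "continuous_map T T (\<lambda>x. inv x)"

record ('g, 'h) crossed_data =
  grpG :: "'g monoid"
  topG :: "'g topology"
  grpH :: "'h monoid"
  topH :: "'h topology"
  bdry :: "'g \<Rightarrow> 'h"
  actn :: "'h \<Rightarrow> 'g \<Rightarrow> 'g"

text \<open>Joint continuity of \<open>actn\<close> makes each \<open>actn C h\<close>, and its inverse \<open>actn C (h\<inverse>)\<close>,
  continuous, so membership in the abstract automorphism group already yields automorphisms of the
  topological group.\<close>

definition crossed_module :: "('g, 'h) crossed_data \<Rightarrow> bool" where
  "crossed_module C \<longleftrightarrow>
     topological_group (grpG C) (topG C) \<and>
     topological_group (grpH C) (topH C) \<and>
     bdry C \<in> hom (grpG C) (grpH C) \<and>
     continuous_map (topG C) (topH C) (bdry C) \<and>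
     actn C \<in> hom (grpH C) (AutoGroup (grpG C)) \<and>
     continuous_map (prod_topology (topH C) (topG C)) (topG C) (\<lambda>(h, g). actn C h g) \<and>
     (\<forall>h \<in> carrier (grpH C). \<forall>g \<in> carrier (grpG C).
        bdry C (actn C h g) = h \<otimes>\<^bsub>grpH C\<^esub> bdry C g \<otimes>\<^bsub>grpH C\<^esub> inv\<^bsub>grpH C\<^esub> h) \<and>
     (\<forall>g \<in> carrier (grpG C). \<forall>g' \<in> carrier (grpG C).
        actn C (bdry C g) g' = g \<otimes>\<^bsub>grpG C\<^esub> g' \<otimes>\<^bsub>grpG C\<^esub> inv\<^bsub>grpG C\<^esub> g)"

definition bdry_kernel :: "('g, 'h) crossed_data \<Rightarrow> 'g set" where
  "bdry_kernel C = kernel (grpG C) (grpH C) (bdry C)"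

definition bdry_image :: "('g, 'h) crossed_data \<Rightarrow> 'h set" where
  "bdry_image C = bdry C ` carrier (grpG C)"

text \<open>The quotient groups \<open>G/G\<^sub>1\<close> and \<open>H/t(G)\<close> are \<open>grpG C Mod bdry_kernel C\<close> and
  \<open>grpH C Mod bdry_image C\<close>. Their elements are right cosets; both subgroups being normal, these
  agree with the left cosets.\<close>

definition projG :: "('g, 'h) crossed_data \<Rightarrow> 'g \<Rightarrow> 'g set" where
  "projG C g = bdry_kernel C #>\<^bsub>grpG C\<^esub> g"

definition projH :: "('g, 'h) crossed_data \<Rightarrow> 'h \<Rightarrow> 'h set" where
  "projH C h = bdry_image C #>\<^bsub>grpH C\<^esub> h"

text \<open>In the last condition, \<open>\<lambda>X. the_elem (bdry C ` X)\<close> is the isomorphism of groups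
  \<open>G/G\<^sub>1 \<cong> t(G)\<close> induced by \<open>t\<close>; the condition says that it is an isomorphism of topological
  groups, where \<open>t(G)\<close> carries the subspace topology from \<open>H\<close>.\<close>

definition standing_assumptions :: "('g, 'h) crossed_data \<Rightarrow> bool" where
  "standing_assumptions C \<longleftrightarrow>
     admits_local_sections (topG C) (quotient_topology (topG C) (projG C)) (projG C) \<and>
     admits_local_sections (topH C) (quotient_topology (topH C) (projH C)) (projH C) \<and>
     homeomorphic_map (quotient_topology (topG C) (projG C))
       (subtopology (topH C) (bdry_image C)) (\<lambda>X. the_elem (bdry C ` X))"

section \<open>Bibundles\<close>

record ('p, 'm, 'g, 'h) bibundle_data =
  tot :: "'p topology"
  prj :: "'p \<Rightarrow> 'm"
  ract :: "'p \<Rightarrow> 'g \<Rightarrow> 'p"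
  str :: "'p \<Rightarrow> 'h"

definition principal_bundle ::
  "('g, 'h) crossed_data \<Rightarrow> 'm topology \<Rightarrow> ('p, 'm, 'g, 'h) bibundle_data \<Rightarrow> bool" where
  "principal_bundle C M P \<longleftrightarrow>
     continuous_map (tot P) M (prj P) \<and>
     continuous_map (prod_topology (tot P) (topG C)) (tot P) (\<lambda>(p, g). ract P p g) \<and>
     (\<forall>p \<in> topspace (tot P). ract P p \<one>\<^bsub>grpG C\<^esub> = p) \<and>
     (\<forall>p \<in> topspace (tot P). \<forall>g \<in> carrier (grpG C). \<forall>g' \<in> carrier (grpG C).
        ract P p (g \<otimes>\<^bsub>grpG C\<^esub> g') = ract P (ract P p g) g') \<and>
     (\<forall>p \<in> topspace (tot P). \<forall>g \<in> carrier (grpG C). prj P (ract P p g) = prj P p) \<and>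
     (\<forall>m \<in> topspace M. \<exists>U \<tau>. openin M U \<and> m \<in> U \<and>
        homeomorphic_map (prod_topology (subtopology M U) (topG C))
          (subtopology (tot P) {p \<in> topspace (tot P). prj P p \<in> U}) \<tau> \<and>
        (\<forall>x \<in> U. \<forall>g \<in> carrier (grpG C). prj P (\<tau> (x, g)) = x) \<and>
        (\<forall>x \<in> U. \<forall>g \<in> carrier (grpG C). \<forall>g' \<in> carrier (grpG C).
           \<tau> (x, g \<otimes>\<^bsub>grpG C\<^esub> g') = ract P (\<tau> (x, g)) g'))"

definition bibundle ::
  "('g, 'h) crossed_data \<Rightarrow> 'm topology \<Rightarrow> ('p, 'm, 'g, 'h) bibundle_data \<Rightarrow> bool" where
  "bibundle C M P \<longleftrightarrow>
     principal_bundle C M P \<and>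
     continuous_map (tot P) (topH C) (str P) \<and>
     (\<forall>p \<in> topspace (tot P). \<forall>g \<in> carrier (grpG C).
        str P (ract P p g) = str P p \<otimes>\<^bsub>grpH C\<^esub> bdry C g)"

definition isomorphic_bibundles ::
  "('g, 'h) crossed_data \<Rightarrow> ('p, 'm, 'g, 'h) bibundle_data \<Rightarrow> ('q, 'm, 'g, 'h) bibundle_data \<Rightarrow> bool"
  where
  "isomorphic_bibundles C P Q \<longleftrightarrow>
     (\<exists>F. homeomorphic_map (tot P) (tot Q) F \<and>
        (\<forall>p \<in> topspace (tot P). prj Q (F p) = prj P p) \<and>
        (\<forall>p \<in> topspace (tot P). \<forall>g \<in> carrier (grpG C). F (ract P p g) = ract Q (F p) g) \<and>
        (\<forall>p \<in> topspace (tot P). str Q (F p) = str P p))"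

definition bibundle_iso_rel ::
  "('g, 'h) crossed_data \<Rightarrow> 'm topology \<Rightarrow>
    (('p, 'm, 'g, 'h) bibundle_data \<times> ('p, 'm, 'g, 'h) bibundle_data) set" where
  "bibundle_iso_rel C M = {(P, Q). bibundle C M P \<and> bibundle C M Q \<and> isomorphic_bibundles C P Q}"

text \<open>The isomorphism classes of those bibundles on \<open>M\<close> whose total space has points in the
  type \<open>'p\<close>.\<close>

definition pi0_Bibun ::
  "('g, 'h) crossed_data \<Rightarrow> 'm topology \<Rightarrow> ('p, 'm, 'g, 'h) bibundle_data set set" where
  "pi0_Bibun C M = {P. bibundle C M P} // bibundle_iso_rel C M"

definition pullback_bibundle ::
  "'n topology \<Rightarrow> ('n \<Rightarrow> 'm) \<Rightarrow> ('p, 'm, 'g, 'h) bibundle_data \<Rightarrow>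
    ('n \<times> 'p, 'n, 'g, 'h) bibundle_data" where
  "pullback_bibundle N f P =
     \<lparr> tot = subtopology (prod_topology N (tot P)) {(n, p). f n = prj P p},
       prj = fst,
       ract = (\<lambda>(n, p) g. (n, ract P p g)),
       str = (\<lambda>(n, p). str P p) \<rparr>"

definition type_map ::
  "('g, 'h) crossed_data \<Rightarrow> ('p, 'm, 'g, 'h) bibundle_data \<Rightarrow> 'm \<Rightarrow> 'h set" where
  "type_map C P m = projH C (str P (SOME p. p \<in> topspace (tot P) \<and> prj P p = m))"

text \<open>Homotopy of maps \<open>M \<rightarrow> B\<close> along which the composite with \<open>\<Phi>\<close> stays constant, where \<open>\<Phi>\<close>
  is the type map of a bibundle on \<open>B\<close>, and the corresponding set \<open>[M, B]\<close> of classes over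
  \<open>H/t(G)\<close>.\<close>

definition homotopy_rel_over ::
  "'m topology \<Rightarrow> 'b topology \<Rightarrow> ('b \<Rightarrow> 'c) \<Rightarrow> (('m \<Rightarrow> 'b) \<times> ('m \<Rightarrow> 'b)) set" where
  "homotopy_rel_over M B \<Phi> =
     {(f0, f1). homotopic_with (map_over M (\<Phi> \<circ> f0) \<Phi>) M B f0 f1}"

definition homotopy_classes_over ::
  "'m topology \<Rightarrow> 'b topology \<Rightarrow> ('b \<Rightarrow> 'c) \<Rightarrow> ('m \<Rightarrow> 'b) set set" where
  "homotopy_classes_over M B \<Phi> = {f. continuous_map M B f} // homotopy_rel_over M B \<Phi>"

section \<open>Well-definedness of the above\<close>

lemma equiv_homotopy_rel_over:
  "equiv {f. continuous_map M B f} (homotopy_rel_over M B \<Phi>)"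
proof (rule equivI)
  show "homotopy_rel_over M B \<Phi> \<subseteq> {f. continuous_map M B f} \<times> {f. continuous_map M B f}"
    by (auto simp: homotopy_rel_over_def dest: homotopic_with_imp_continuous_maps)
  show "refl_on {f. continuous_map M B f} (homotopy_rel_over M B \<Phi>)"
    by (auto simp: refl_on_def homotopy_rel_over_def map_over_def)
  have eq: "map_over M (\<Phi> \<circ> f0) \<Phi> = map_over M (\<Phi> \<circ> f1) \<Phi>"
    if "homotopic_with (map_over M (\<Phi> \<circ> f0) \<Phi>) M B f0 f1" for f0 f1
    using homotopic_with_imp_property[OF that] by (auto simp: map_over_def fun_eq_iff)
  show "sym (homotopy_rel_over M B \<Phi>)"
  proof (rule symI)
    fix f0 f1 assume "(f0, f1) \<in> homotopy_rel_over M B \<Phi>"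
    then have hom: "homotopic_with (map_over M (\<Phi> \<circ> f0) \<Phi>) M B f0 f1"
      by (simp add: homotopy_rel_over_def)
    then have "homotopic_with (map_over M (\<Phi> \<circ> f0) \<Phi>) M B f1 f0"
      by (rule homotopic_with_symD)
    then show "(f1, f0) \<in> homotopy_rel_over M B \<Phi>"
      by (simp add: homotopy_rel_over_def eq[OF hom])
  qed
  show "trans (homotopy_rel_over M B \<Phi>)"
  proof (rule transI)
    fix f0 f1 f2
    assume "(f0, f1) \<in> homotopy_rel_over M B \<Phi>" "(f1, f2) \<in> homotopy_rel_over M B \<Phi>"
    then have hom: "homotopic_with (map_over M (\<Phi> \<circ> f0) \<Phi>) M B f0 f1"
      and hom': "homotopic_with (map_over M (\<Phi> \<circ> f1) \<Phi>) M B f1 f2"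
      by (simp_all add: homotopy_rel_over_def)
    show "(f0, f2) \<in> homotopy_rel_over M B \<Phi>"
      using homotopic_with_trans[OF hom hom'[folded eq[OF hom]]]
      by (simp add: homotopy_rel_over_def)
  qed
qed

lemma isomorphic_bibundles_refl: "isomorphic_bibundles C P P"
  unfolding isomorphic_bibundles_def by (rule exI[of _ id]) auto

lemma isomorphic_bibundles_sym:
  assumes P: "bibundle C M P" and C: "crossed_module C" and iso: "isomorphic_bibundles C P Q"
  shows "isomorphic_bibundles C Q P"
proof -
  obtain F where F: "homeomorphic_map (tot P) (tot Q) F"
    and pr: "\<And>p. p \<in> topspace (tot P) \<Longrightarrow> prj Q (F p) = prj P p"
    and eq: "\<And>p g. p \<in> topspace (tot P) \<Longrightarrow> g \<in> carrier (grpG C) \<Longrightarrow>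
        F (ract P p g) = ract Q (F p) g"
    and st: "\<And>p. p \<in> topspace (tot P) \<Longrightarrow> str Q (F p) = str P p"
    using iso unfolding isomorphic_bibundles_def by blast
  obtain F' where F': "homeomorphic_maps (tot P) (tot Q) F F'"
    using F homeomorphic_map_maps by blast
  then have F'_homeo: "homeomorphic_map (tot Q) (tot P) F'"
    using homeomorphic_maps_map by blast
  have in': "F' q \<in> topspace (tot P)" and FF': "F (F' q) = q" if "q \<in> topspace (tot Q)" for q
    using F' that by (auto simp: homeomorphic_maps_def continuous_map_def)
  have F'F: "F' (F p) = p" if "p \<in> topspace (tot P)" for p
    using F' that by (auto simp: homeomorphic_maps_def)
  have tG: "topspace (topG C) = carrier (grpG C)"
    using C by (simp add: crossed_module_def topological_group.topspace_eq_carrier)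
  have cl: "ract P p g \<in> topspace (tot P)"
    if "p \<in> topspace (tot P)" "g \<in> carrier (grpG C)" for p g
  proof -
    have "continuous_map (prod_topology (tot P) (topG C)) (tot P) (\<lambda>(p, g). ract P p g)"
      using P by (simp add: bibundle_def principal_bundle_def)
    then have "(\<lambda>(p, g). ract P p g) (p, g) \<in> topspace (tot P)"
      using that tG by (metis (no_types, lifting) SigmaI continuous_map_image_subset_topspace
          image_subset_iff topspace_prod_topology)
    then show ?thesis by simp
  qed
  have eq': "F' (ract Q q g) = ract P (F' q) g"
    if "q \<in> topspace (tot Q)" "g \<in> carrier (grpG C)" for q g
    using eq[OF in'[OF that(1)] that(2)] FF'[OF that(1)] F'F[OF cl[OF in'[OF that(1)] that(2)]]
    by simp
  show ?thesis unfolding isomorphic_bibundles_def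
    using F'_homeo eq' pr[OF in'] st[OF in'] FF' by (intro exI[of _ F']) auto
qed

lemma isomorphic_bibundles_trans:
  assumes "isomorphic_bibundles C P Q" "isomorphic_bibundles C Q R"
  shows "isomorphic_bibundles C P R"
proof -
  obtain F where F: "homeomorphic_map (tot P) (tot Q) F"
    "\<And>p. p \<in> topspace (tot P) \<Longrightarrow> prj Q (F p) = prj P p"
    "\<And>p g. p \<in> topspace (tot P) \<Longrightarrow> g \<in> carrier (grpG C) \<Longrightarrow> F (ract P p g) = ract Q (F p) g"
    "\<And>p. p \<in> topspace (tot P) \<Longrightarrow> str Q (F p) = str P p"
    using assms(1) unfolding isomorphic_bibundles_def by blast
  obtain K where K: "homeomorphic_map (tot Q) (tot R) K"
    "\<And>p. p \<in> topspace (tot Q) \<Longrightarrow> prj R (K p) = prj Q p"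
    "\<And>p g. p \<in> topspace (tot Q) \<Longrightarrow> g \<in> carrier (grpG C) \<Longrightarrow> K (ract Q p g) = ract R (K p) g"
    "\<And>p. p \<in> topspace (tot Q) \<Longrightarrow> str R (K p) = str Q p"
    using assms(2) unfolding isomorphic_bibundles_def by blast
  have cl: "F p \<in> topspace (tot Q)" if "p \<in> topspace (tot P)" for p
    using F(1) that by (metis homeomorphic_imp_surjective_map imageI)
  show ?thesis unfolding isomorphic_bibundles_def
    using homeomorphic_map_compose[OF F(1) K(1)] F K cl by (intro exI[of _ "K \<circ> F"]) auto
qed

lemma equiv_bibundle_iso_rel:
  assumes "crossed_module C"
  shows "equiv {P. bibundle C M P} (bibundle_iso_rel C M)"
proof (rule equivI)
  show "bibundle_iso_rel C M \<subseteq> {P. bibundle C M P} \<times> {P. bibundle C M P}"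
    by (auto simp: bibundle_iso_rel_def)
  show "refl_on {P. bibundle C M P} (bibundle_iso_rel C M)"
    by (auto simp: refl_on_def bibundle_iso_rel_def isomorphic_bibundles_refl)
  show "sym (bibundle_iso_rel C M)"
    unfolding sym_def bibundle_iso_rel_def using assms isomorphic_bibundles_sym by fastforce
  show "trans (bibundle_iso_rel C M)"
    unfolding trans_def bibundle_iso_rel_def using isomorphic_bibundles_trans by fastforce
qed

lemma bdry_image_normal:
  assumes "crossed_module C"
  shows "bdry_image C \<lhd> grpH C"
proof -
  have G: "group (grpG C)" and H: "group (grpH C)" and hom: "bdry C \<in> hom (grpG C) (grpH C)"
    and a: "actn C \<in> hom (grpH C) (AutoGroup (grpG C))"
    and eq: "\<And>h g. h \<in> carrier (grpH C) \<Longrightarrow> g \<in> carrier (grpG C) \<Longrightarrow>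
        bdry C (actn C h g) = h \<otimes>\<^bsub>grpH C\<^esub> bdry C g \<otimes>\<^bsub>grpH C\<^esub> inv\<^bsub>grpH C\<^esub> h"
    using assms by (auto simp: crossed_module_def topological_group_def)
  interpret group_hom "grpG C" "grpH C" "bdry C"
    using G H hom by (simp add: group_hom_def group_hom_axioms_def)
  have act: "actn C h g \<in> carrier (grpG C)"
    if "h \<in> carrier (grpH C)" "g \<in> carrier (grpG C)" for h g
  proof -
    have "actn C h \<in> hom (grpG C) (grpG C)"
      using a that(1) by (auto simp: AutoGroup_def auto_def hom_def)
    then show ?thesis using that(2) by (auto simp: hom_def)
  qed
  have "h \<otimes>\<^bsub>grpH C\<^esub> n \<otimes>\<^bsub>grpH C\<^esub> inv\<^bsub>grpH C\<^esub> h \<in> bdry_image C"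
    if h: "h \<in> carrier (grpH C)" and n: "n \<in> bdry_image C" for h n
  proof -
    obtain g where g: "g \<in> carrier (grpG C)" "n = bdry C g"
      using n by (auto simp: bdry_image_def)
    then show ?thesis using eq[OF h g(1)] act[OF h g(1)] by (metis bdry_image_def imageI)
  qed
  moreover have "subgroup (bdry_image C) (grpH C)"
    unfolding bdry_image_def by (rule img_is_subgroup)
  ultimately show ?thesis by (simp add: group.normal_inv_iff[OF H])
qed

text \<open>The type map may be computed at any point of the fibre.\<close>

lemma type_map_eq:
  assumes C: "crossed_module C" and P: "bibundle C M P" and p: "p \<in> topspace (tot P)"
  shows "type_map C P (prj P p) = projH C (str P p)"
proof -
  have G: "group (grpG C)" and H: "group (grpH C)" and hom: "bdry C \<in> hom (grpG C) (grpH C)"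
    and tG: "topspace (topG C) = carrier (grpG C)" and tH: "topspace (topH C) = carrier (grpH C)"
    using C by (auto simp: crossed_module_def topological_group_def
        topological_group.topspace_eq_carrier)
  define q where "q = (SOME q. q \<in> topspace (tot P) \<and> prj P q = prj P p)"
  have q: "q \<in> topspace (tot P)" "prj P q = prj P p"
    using someI[of "\<lambda>q. q \<in> topspace (tot P) \<and> prj P q = prj P p" p] p by (auto simp: q_def)
  have pb: "principal_bundle C M P" and st: "continuous_map (tot P) (topH C) (str P)"
    and se: "\<And>p g. p \<in> topspace (tot P) \<Longrightarrow> g \<in> carrier (grpG C) \<Longrightarrow>
      str P (ract P p g) = str P p \<otimes>\<^bsub>grpH C\<^esub> bdry C g"
    using P by (auto simp: bibundle_def)
  have m: "prj P p \<in> topspace M"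
    using pb p by (auto simp: principal_bundle_def continuous_map_def)
  obtain U \<tau> where U: "openin M U" "prj P p \<in> U"
    and tau: "homeomorphic_map (prod_topology (subtopology M U) (topG C))
          (subtopology (tot P) {p \<in> topspace (tot P). prj P p \<in> U}) \<tau>"
    and pt: "\<And>x g. x \<in> U \<Longrightarrow> g \<in> carrier (grpG C) \<Longrightarrow> prj P (\<tau> (x, g)) = x"
    and et: "\<And>x g g'. x \<in> U \<Longrightarrow> g \<in> carrier (grpG C) \<Longrightarrow> g' \<in> carrier (grpG C) \<Longrightarrow>
           \<tau> (x, g \<otimes>\<^bsub>grpG C\<^esub> g') = ract P (\<tau> (x, g)) g'"
  proof -
    have "\<exists>U \<tau>. openin M U \<and> prj P p \<in> U \<and>
        homeomorphic_map (prod_topology (subtopology M U) (topG C))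
          (subtopology (tot P) {p \<in> topspace (tot P). prj P p \<in> U}) \<tau> \<and>
        (\<forall>x \<in> U. \<forall>g \<in> carrier (grpG C). prj P (\<tau> (x, g)) = x) \<and>
        (\<forall>x \<in> U. \<forall>g \<in> carrier (grpG C). \<forall>g' \<in> carrier (grpG C).
           \<tau> (x, g \<otimes>\<^bsub>grpG C\<^esub> g') = ract P (\<tau> (x, g)) g')"
      using pb m unfolding principal_bundle_def by (elim conjE) (erule (1) bspec)
    then show ?thesis using that by blast
  qed
  have im: "\<exists>g \<in> carrier (grpG C). r = \<tau> (prj P p, g)"
    if r: "r \<in> topspace (tot P)" "prj P r = prj P p" for r
  proof -
    have "r \<in> \<tau> ` (topspace (prod_topology (subtopology M U) (topG C)))"
      using homeomorphic_imp_surjective_map[OF tau] r U by auto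
    then obtain x g where "x \<in> U" "g \<in> carrier (grpG C)" "r = \<tau> (x, g)"
      by (auto simp: tG)
    then show ?thesis using pt r by metis
  qed
  obtain a b where a: "a \<in> carrier (grpG C)" "p = \<tau> (prj P p, a)"
    and b: "b \<in> carrier (grpG C)" "q = \<tau> (prj P p, b)"
    using im[OF p] im[OF q] by metis
  define g where "g = inv\<^bsub>grpG C\<^esub> a \<otimes>\<^bsub>grpG C\<^esub> b"
  interpret G: group "grpG C" by (rule G)
  have g: "g \<in> carrier (grpG C)" using a(1) b(1) by (simp add: g_def)
  have "a \<otimes>\<^bsub>grpG C\<^esub> g = b"
    using a(1) b(1) by (simp add: g_def G.m_assoc[symmetric])
  then have "q = ract P p g" using et[OF U(2) a(1) g] a(2) b(2) by simp
  then have sq: "str P q = str P p \<otimes>\<^bsub>grpH C\<^esub> bdry C g" using se[OF p g] by simp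
  have sp: "str P p \<in> carrier (grpH C)" using st p tH by (auto simp: continuous_map_def)
  have tg: "bdry C g \<in> bdry_image C" using g by (simp add: bdry_image_def)
  interpret N: normal "bdry_image C" "grpH C" by (rule bdry_image_normal[OF C])
  have "str P q \<in> str P p <#\<^bsub>grpH C\<^esub> bdry_image C"
    using sq tg by (auto simp: l_coset_def)
  then have "str P q \<in> bdry_image C #>\<^bsub>grpH C\<^esub> str P p"
    using N.coset_eq sp by auto
  then have "bdry_image C #>\<^bsub>grpH C\<^esub> str P q = bdry_image C #>\<^bsub>grpH C\<^esub> str P p"
    using N.repr_independence[OF _ sp N.subgroup_axioms] by simp
  then show ?thesis by (simp add: type_map_def projH_def q_def)
qed

end

theory Submission
  imports Defs
begin

text \<open>
  A map \<open>P \<rightarrow> E\<close> of principal bundles over \<open>H\<close> is the same as a map \<open>f\<close> into \<open>B\<close> together with an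
  isomorphism of \<open>P\<close> with \<open>f\<^sup>*E\<close>. Over an open set on which \<open>P\<close> is trivial, such maps can be
  contracted to one another, since \<open>E\<close> is contractible over \<open>H\<close>. To pass from local to global,
  choose locally finite bump functions each point of which sees the value 1, let each local
  contraction act with the strength given by its bump function, and compose all of them in some
  linear order. At every point one of the factors is a constant map, so the composite does not
  depend on the map it is applied to: this gives existence of equivariant maps over \<open>H\<close>, and
  running the strengths from 0 to 1 gives their uniqueness up to homotopy.

  Conversely, let \<open>h\<close> be a homotopy along which the type is constant. Because \<open>t(G) \<cong> G/G\<^sub>1\<close> and
  \<open>G \<rightarrow> G/G\<^sub>1\<close> has local sections, \<open>h\<close> lifts locally in \<open>M\<close> to \<open>E\<close> along all of \<open>[0, 1]\<close> with
  constant structure map. Such a lift transports fibres of \<open>h\<^sup>*E\<close> along \<open>h\<close> compatibly with the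
  structure maps. Composing, again in a linear order, the transports up to the time given by each
  bump function yields an isomorphism from the start to the end of \<open>h\<close>.
\<close>

section \<open>Paracompact spaces\<close>

text \<open>Points of \<open>E\<close> cannot be averaged, so local contractions and local
  transports cannot be combined by a partition of unity in the usual way; composition takes the
  place of addition. Operators need not commute, so neighbouring points must use finite composites
  in one common order. The index sets are therefore listed along a fixed well-order: two such lists
  differ only by factors that act as the identity where they are omitted. Bump functions that merely
  add up to 1 need not reach full strength anywhere, hence the normalisation by the supremum.

  In both directions the operators act on a space larger than the bundle. For classifying maps it
  consists of a point of \<open>P\<close>, an arbitrary point of \<open>E\<close> with the same
  value in \<open>H\<close>, and a global strength. One continuous operator on it then contains the
  map to be constructed and, at once, the homotopies to it from all other maps. For transport the
  space records the current time, so that each transport starts where the previous one stopped. All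
  bump functions live on \<open>M\<close>; its product with the interval is never covered.\<close>

lemma paracompact_space_refine:
  assumes "paracompact_space X" and "\<And>U. U \<in> \<U> \<Longrightarrow> openin X U" and "\<Union>\<U> = topspace X"
  obtains \<V> where "\<forall>V\<in>\<V>. openin X V" "\<Union>\<V> = topspace X"
    "\<forall>V\<in>\<V>. \<exists>U\<in>\<U>. V \<subseteq> U" "locally_finite_in X \<V>"
proof -
  have "\<exists>\<V>. (\<forall>V\<in>\<V>. openin X V) \<and> \<Union>\<V> = topspace X \<and>
      (\<forall>V\<in>\<V>. \<exists>U\<in>\<U>. V \<subseteq> U) \<and> locally_finite_in X \<V>"
    using assms(1) unfolding paracompact_space_def
    by (elim conjE allE[of _ \<U>] impE) (use assms(2,3) in auto)
  then obtain \<V> where "\<forall>V\<in>\<V>. openin X V" "\<Union>\<V> = topspace X"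
      "\<forall>V\<in>\<V>. \<exists>U\<in>\<U>. V \<subseteq> U" "locally_finite_in X \<V>" by blast
  then show thesis by (intro that[of \<V>]) simp_all
qed

text \<open>Refine the cover by the complement of \<open>A\<close> and the sets \<open>U\<close> of
  the hypothesis, and let \<open>W\<close> be the union of the members that meet \<open>A\<close>.
  Local finiteness makes its closure the union of their closures, each of which misses
  \<open>B\<close>. With \<open>B\<close> a point this gives regularity, with \<open>B\<close>
  closed it gives normality.\<close>

lemma paracompact_space_separate:
  assumes X: "paracompact_space X" and A: "closedin X A"
    and loc: "\<And>x. x \<in> A \<Longrightarrow> \<exists>U. openin X U \<and> x \<in> U \<and> X closure_of U \<inter> B = {}"
  shows "\<exists>W. openin X W \<and> A \<subseteq> W \<and> X closure_of W \<inter> B = {}"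
proof -
  define \<U> where "\<U> = insert (topspace X - A) {U. openin X U \<and> X closure_of U \<inter> B = {}}"
  have op: "openin X U" if "U \<in> \<U>" for U
    using A that by (auto simp: \<U>_def)
  have cov: "\<Union>\<U> = topspace X"
  proof
    show "\<Union>\<U> \<subseteq> topspace X" unfolding \<U>_def using openin_subset by blast
    show "topspace X \<subseteq> \<Union>\<U>" unfolding \<U>_def using loc by blast
  qed
  obtain \<V> where "\<forall>V\<in>\<V>. openin X V" "\<Union>\<V> = topspace X"
    "\<forall>V\<in>\<V>. \<exists>U\<in>\<U>. V \<subseteq> U" "locally_finite_in X \<V>"
    by (rule paracompact_space_refine[OF X op cov])
  note V = this[rule_format]
  define \<W> where "\<W> = {V \<in> \<V>. V \<inter> A \<noteq> {}}"
  have lf: "locally_finite_in X \<W>"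
    using V(4) by (rule locally_finite_in_subset) (auto simp: \<W>_def)
  have "X closure_of V \<inter> B = {}" if "V \<in> \<W>" for V
  proof -
    obtain U where U: "U \<in> \<U>" "V \<subseteq> U" using V(3) \<open>V \<in> \<W>\<close> by (auto simp: \<W>_def)
    then have "X closure_of U \<inter> B = {}"
      using that by (auto simp: \<W>_def \<U>_def)
    then show ?thesis using closure_of_mono[OF U(2)] by blast
  qed
  then have "X closure_of (\<Union>\<W>) \<inter> B = {}"
    by (auto simp: closure_of_locally_finite_Union[OF lf])
  moreover have "openin X (\<Union>\<W>)" using V(1) by (auto simp: \<W>_def)
  moreover have "A \<subseteq> \<Union>\<W>" using V(2) closedin_subset[OF A] unfolding \<W>_def by blast
  ultimately show ?thesis by blast
qed

text \<open>Two passes of the separation argument: the Hausdorff property feeds the separation of a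
  closed set from a point, and that in turn feeds the separation of two closed sets.\<close>

lemma paracompact_imp_normal_space:
  assumes X: "paracompact_space X"
  shows "normal_space X"
proof -
  have reg: "\<exists>W. openin X W \<and> A \<subseteq> W \<and> X closure_of W \<inter> {y} = {}"
    if A: "closedin X A" and y: "y \<in> topspace X" "y \<notin> A" for A y
  proof (rule paracompact_space_separate[OF X A])
    fix x assume x: "x \<in> A"
    then have "x \<in> topspace X" "x \<noteq> y" using A y closedin_subset by auto
    then obtain U V where UV: "openin X U" "openin X V" "x \<in> U" "y \<in> V" "disjnt U V"
      using X y unfolding paracompact_space_def Hausdorff_space_def by metis
    have "X closure_of U \<subseteq> topspace X - V"
      using UV openin_subset by (intro closure_of_minimal) (auto simp: disjnt_iff)
    then show "\<exists>U. openin X U \<and> x \<in> U \<and> X closure_of U \<inter> {y} = {}"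
      using UV by blast
  qed
  show ?thesis unfolding normal_space_alt
  proof (intro allI impI)
    fix S U assume SU: "closedin X S \<and> openin X U \<and> S \<subseteq> U"
    have "\<exists>W. openin X W \<and> S \<subseteq> W \<and> X closure_of W \<inter> (topspace X - U) = {}"
    proof (rule paracompact_space_separate[OF X])
      fix x assume x: "x \<in> S"
      obtain W where W: "openin X W" "topspace X - U \<subseteq> W" "X closure_of W \<inter> {x} = {}"
        using reg[of "topspace X - U" x] SU x openin_subset by fastforce
      \<comment> \<open>The neighbourhood of \<open>x\<close> is the complement of the closure of
        \<open>W\<close>. It cannot accumulate on the open set \<open>W\<close>, which contains
        everything outside \<open>U\<close>.\<close>
      have "X closure_of (topspace X - X closure_of W) \<subseteq> topspace X - W"
        using W closure_of_subset[OF openin_subset[OF W(1)]] by (intro closure_of_minimal) auto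
      moreover have "x \<in> topspace X - X closure_of W"
        using W(3) x SU openin_subset by fastforce
      moreover have "openin X (topspace X - X closure_of W)" by auto
      ultimately show "\<exists>V. openin X V \<and> x \<in> V \<and> X closure_of V \<inter> (topspace X - U) = {}"
        using W(2) by blast
    qed (use SU in auto)
    then obtain W where "openin X W" "S \<subseteq> W" "X closure_of W \<inter> (topspace X - U) = {}" by blast
    then show "\<exists>V. openin X V \<and> S \<subseteq> V \<and> X closure_of V \<subseteq> U"
      using closure_of_subset_topspace[of X W] by blast
  qed
qed

text \<open>By normality the open sets whose closure fits into some member of \<open>\<U>\<close>
  still cover. \<open>K U\<close> gathers all members of a refinement of that cover whose closure
  lies in \<open>U\<close>; closing the union adds nothing outside \<open>U\<close>, since closure
  commutes with locally finite unions.\<close>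

lemma paracompact_space_shrinking:
  assumes X: "paracompact_space X"
    and \<U>: "\<And>U. U \<in> \<U> \<Longrightarrow> openin X U" "\<Union>\<U> = topspace X" "locally_finite_in X \<U>"
  obtains K where "\<forall>U\<in>\<U>. closedin X (K U)" "\<forall>U\<in>\<U>. K U \<subseteq> U"
    "\<forall>x\<in>topspace X. \<exists>U\<in>\<U>. x \<in> K U"
proof -
  have norm: "normal_space X" by (rule paracompact_imp_normal_space[OF X])
  define \<W> where "\<W> = {W. openin X W \<and> (\<exists>U\<in>\<U>. X closure_of W \<subseteq> U)}"
  have "x \<in> \<Union>\<W>" if x: "x \<in> topspace X" for x
  proof -
    obtain U where U: "U \<in> \<U>" "x \<in> U" using \<U>(2) x by blast
    have "closedin X {x}"
      using X x by (simp add: closedin_Hausdorff_singleton paracompact_space_def)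
    then obtain W where "openin X W" "{x} \<subseteq> W" "X closure_of W \<subseteq> U"
      using norm U \<U>(1)[OF U(1)] unfolding normal_space_alt by (metis empty_subsetI insert_subset)
    then show ?thesis using U by (auto simp: \<W>_def)
  qed
  moreover have "\<Union>\<W> \<subseteq> topspace X" unfolding \<W>_def using openin_subset by blast
  ultimately have cov: "\<Union>\<W> = topspace X" by blast
  have op: "openin X W" if "W \<in> \<W>" for W using that by (simp add: \<W>_def)
  obtain \<V> where "\<forall>V\<in>\<V>. openin X V" "\<Union>\<V> = topspace X"
    "\<forall>V\<in>\<V>. \<exists>W\<in>\<W>. V \<subseteq> W" "locally_finite_in X \<V>"
    by (rule paracompact_space_refine[OF X op cov])
  note V = this[rule_format]
  define K where "K U = X closure_of (\<Union>{V \<in> \<V>. X closure_of V \<subseteq> U})" for U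
  show thesis
  proof (rule that)
    show "\<forall>U\<in>\<U>. closedin X (K U)" by (simp add: K_def)
    show "\<forall>U\<in>\<U>. K U \<subseteq> U"
    proof
      fix U
      have "locally_finite_in X {V \<in> \<V>. X closure_of V \<subseteq> U}"
        using V(4) by (rule locally_finite_in_subset) auto
      then show "K U \<subseteq> U" by (auto simp: K_def closure_of_locally_finite_Union)
    qed
    show "\<forall>x\<in>topspace X. \<exists>U\<in>\<U>. x \<in> K U"
    proof
      fix x assume x: "x \<in> topspace X"
      obtain S W U where S: "S \<in> \<V>" "x \<in> S" "S \<subseteq> W" "U \<in> \<U>" "X closure_of W \<subseteq> U"
        using V(2,3) x unfolding \<W>_def by blast
      then have "X closure_of S \<subseteq> U" using closure_of_mono by blast
      moreover have "\<Union>{V \<in> \<V>. X closure_of V \<subseteq> U} \<subseteq> K U"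
        unfolding K_def using V(2) by (intro closure_of_subset) auto
      ultimately show "\<exists>U\<in>\<U>. x \<in> K U" using S by blast
    qed
  qed
qed

text \<open>A variant of a partition of unity that is normalised by its supremum instead of its sum:
  at every point some function attains the value 1.\<close>

lemma paracompact_space_bump_functions:
  assumes X: "paracompact_space X"
    and ex: "\<And>x. x \<in> topspace X \<Longrightarrow> \<exists>U. openin X U \<and> x \<in> U \<and> good U"
    and mono: "\<And>U V. good U \<Longrightarrow> V \<subseteq> U \<Longrightarrow> good V"
  obtains \<V> D and \<mu> :: "'a set \<Rightarrow> 'a \<Rightarrow> real" where
    "locally_finite_in X \<V>"
    "\<forall>V\<in>\<V>. openin X V \<and> good V"
    "\<forall>V\<in>\<V>. closedin X (D V) \<and> D V \<subseteq> V"
    "\<forall>V\<in>\<V>. continuous_map X (top_of_set {0..1}) (\<mu> V)"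
    "\<forall>V\<in>\<V>. \<forall>x\<in>topspace X. x \<notin> D V \<longrightarrow> \<mu> V x = 0"
    "\<forall>x\<in>topspace X. \<exists>V\<in>\<V>. \<mu> V x = 1"
proof -
  have norm: "normal_space X" by (rule paracompact_imp_normal_space[OF X])
  have cov: "\<Union>{U. openin X U \<and> good U} = topspace X"
  proof
    show "\<Union>{U. openin X U \<and> good U} \<subseteq> topspace X" using openin_subset by blast
    show "topspace X \<subseteq> \<Union>{U. openin X U \<and> good U}" using ex by blast
  qed
  have op: "openin X U" if "U \<in> {U. openin X U \<and> good U}" for U using that by simp
  obtain \<V> where "\<forall>V\<in>\<V>. openin X V" "\<Union>\<V> = topspace X"
    "\<forall>V\<in>\<V>. \<exists>U\<in>{U. openin X U \<and> good U}. V \<subseteq> U" "locally_finite_in X \<V>"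
    by (rule paracompact_space_refine[OF X op cov])
  note V = this[rule_format]
  obtain K where "\<forall>V\<in>\<V>. closedin X (K V)" "\<forall>V\<in>\<V>. K V \<subseteq> V"
    "\<forall>x\<in>topspace X. \<exists>V\<in>\<V>. x \<in> K V"
    by (rule paracompact_space_shrinking[OF X V(1,2,4)])
  note K = this[rule_format]
  have "\<exists>D f. closedin X D \<and> D \<subseteq> V \<and> continuous_map X (top_of_set {0..1::real}) f \<and>
      (\<forall>x\<in>topspace X. x \<notin> D \<longrightarrow> f x = 0) \<and> (\<forall>x\<in>K V. f x = 1)" if VV: "V \<in> \<V>" for V
  proof -
    \<comment> \<open>\<open>W\<close> is inserted between \<open>K V\<close> and \<open>V\<close>
      so that the bump function vanishes off a closed subset of \<open>V\<close>, the closure of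
      \<open>W\<close>. Vanishing off \<open>V\<close> alone would not do: an operator over
      \<open>V\<close> is glued to the identity on an open set, so the two open sets must
      overlap.\<close>
    obtain W where W: "openin X W" "K V \<subseteq> W" "X closure_of W \<subseteq> V"
      using norm K(1,2)[OF VV] V(1)[OF VV] unfolding normal_space_alt by metis
    have "disjnt (topspace X - W) (K V)" using W(2) by (auto simp: disjnt_iff)
    then obtain f where f: "continuous_map X (top_of_set {0..1::real}) f"
      "f ` (topspace X - W) \<subseteq> {0}" "f ` K V \<subseteq> {1}"
      using Urysohn_lemma[OF norm, of "topspace X - W" "K V" 0 1] K(1)[OF VV] W(1) by auto
    have "f x = 0" if "x \<in> topspace X" "x \<notin> X closure_of W" for x
      using f(2) that closure_of_subset[OF openin_subset[OF W(1)]] by blast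
    then show ?thesis
      using W f(1,3) by (intro exI[of _ "X closure_of W"] exI[of _ f]) auto
  qed
  then obtain D \<mu> where D: "\<And>V. V \<in> \<V> \<Longrightarrow> closedin X (D V) \<and> D V \<subseteq> V \<and>
      continuous_map X (top_of_set {0..1::real}) (\<mu> V) \<and>
      (\<forall>x\<in>topspace X. x \<notin> D V \<longrightarrow> \<mu> V x = 0) \<and> (\<forall>x\<in>K V. \<mu> V x = 1)"
    by metis
  show thesis
  proof (rule that[of \<V> D \<mu>])
    show "\<forall>V\<in>\<V>. openin X V \<and> good V"
    proof
      fix V assume "V \<in> \<V>"
      moreover from V(3)[OF this] obtain U where "good U" "V \<subseteq> U" by auto
      ultimately show "openin X V \<and> good V" using V(1) mono by simp
    qed
    show "\<forall>x\<in>topspace X. \<exists>V\<in>\<V>. \<mu> V x = 1"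
    proof
      fix x assume "x \<in> topspace X"
      then obtain V where "V \<in> \<V>" "x \<in> K V" using K(3) by auto
      then show "\<exists>V\<in>\<V>. \<mu> V x = 1" using D by (intro bexI[of _ V]) auto
    qed
  qed (use V(4) D in auto)
qed

text \<open>All finite sets are sorted by one well-order of the whole type. The second property is
  the point: the list of a subset arises by deletion, so composites over different index sets differ
  only by omitted factors.\<close>

lemma ex_linear_order_lists:
  obtains L :: "'a set \<Rightarrow> 'a list" where
    "\<And>J. finite J \<Longrightarrow> set (L J) = J"
    "\<And>J J'. finite J \<Longrightarrow> J' \<subseteq> J \<Longrightarrow> L J' = filter (\<lambda>i. i \<in> J') (L J)"
proof -
  obtain r :: "'a rel" where r: "well_order_on UNIV r" using well_order_on by blast
  then have lin: "linear_order_on UNIV r" by (simp add: well_order_on_def)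
  define le lt where "le x y \<longleftrightarrow> (x, y) \<in> r" and "lt x y \<longleftrightarrow> (x, y) \<in> r \<and> x \<noteq> y" for x y
  interpret o: linorder le lt
    using lin unfolding linear_order_on_def partial_order_on_def preorder_on_def
    by unfold_locales
      (auto simp: le_def lt_def refl_on_def total_on_def dest: antisymD transD, metis)
  show thesis
  proof (rule that)
    show "set (o.sorted_list_of_set J) = J" if "finite J" for J
      using that by simp
    show "o.sorted_list_of_set J' = filter (\<lambda>i. i \<in> J') (o.sorted_list_of_set J)"
      if J: "finite J" "J' \<subseteq> J" for J J'
    proof (rule o.sorted_distinct_set_unique)
      show "o.sorted (filter (\<lambda>i. i \<in> J') (o.sorted_list_of_set J))"
        by (intro sorted_wrt_filter o.sorted_sorted_list_of_set)
    qed (use J finite_subset[OF J(2,1)] in auto)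
  qed
qed

section \<open>Locally finite compositions\<close>

lemma continuous_map_locally:
  assumes "\<And>x. x \<in> topspace X \<Longrightarrow>
    \<exists>U f'. openin X U \<and> x \<in> U \<and> continuous_map (subtopology X U) Y f' \<and> (\<forall>u\<in>U. f' u = f u)"
  shows "continuous_map X Y f"
proof -
  obtain U f' where U: "\<And>x. x \<in> topspace X \<Longrightarrow>
    openin X (U x) \<and> x \<in> U x \<and> continuous_map (subtopology X (U x)) Y (f' x) \<and> (\<forall>u\<in>U x. f' x u = f u)"
    using assms by metis
  show ?thesis
  proof (rule pasting_lemma[where I = "topspace X"])
    show "openin X (U i)" "continuous_map (subtopology X (U i)) Y (f' i)" if "i \<in> topspace X" for i
      using U that by auto
    show "f' i x = f' j x" if "i \<in> topspace X" "j \<in> topspace X" "x \<in> topspace X \<inter> U i \<inter> U j" for i j x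
      using U that by auto
    show "\<exists>j. j \<in> topspace X \<and> x \<in> U j \<and> f x = f' j x" if "x \<in> topspace X" for x
      using U that by metis
  qed
qed

lemma continuous_map_fold:
  assumes "\<And>i. i \<in> set xs \<Longrightarrow> continuous_map Y Y (T i)"
  shows "continuous_map Y Y (fold T xs)"
  using assms
proof (induction xs)
  case (Cons i xs)
  then have "continuous_map Y Y (fold T xs \<circ> T i)" by (intro continuous_map_compose[of Y Y]) auto
  then show ?case by (simp add: comp_def)
qed auto

text \<open>\<open>A\<close> will be one fibre over the base: to be dropped from a composite, a
  factor has to be the identity only there, provided all factors preserve the fibre.\<close>

lemma fold_filter_neutral:
  assumes "\<And>i y. i \<in> set xs \<Longrightarrow> y \<in> A \<Longrightarrow> T i y \<in> A"
    and "\<And>i y. i \<in> set xs \<Longrightarrow> \<not> P i \<Longrightarrow> y \<in> A \<Longrightarrow> T i y = y" and "y \<in> A"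
  shows "fold T (filter P xs) y = fold T xs y"
  using assms by (induction xs arbitrary: y) auto

text \<open>Stands for the composite of all \<open>T i\<close> in the order of \<open>L\<close>,
  although \<open>I\<close> may be infinite: the factors left out at \<open>y\<close> are meant to
  fix the fibre of \<open>y\<close>, and local finiteness of the \<open>D i\<close> leaves a finite
  list.\<close>

definition locally_finite_fold ::
  "('i set \<Rightarrow> 'i list) \<Rightarrow> 'i set \<Rightarrow> ('i \<Rightarrow> 'm set) \<Rightarrow> ('y \<Rightarrow> 'm) \<Rightarrow> ('i \<Rightarrow> 'y \<Rightarrow> 'y) \<Rightarrow> 'y \<Rightarrow> 'y" where
  "locally_finite_fold L I D b T y = fold T (L {i \<in> I. b y \<in> D i}) y"

text \<open>Each \<open>T i\<close> is continuous on all of \<open>Y\<close>, because it is so over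
  \<open>V i\<close> and is the identity over the complement of \<open>D i\<close>, and these two
  open sets cover \<open>M\<close>. The listed indices vary with the point, but near a given point
  the list can be enlarged to a fixed finite one.\<close>

lemma continuous_map_locally_finite_fold:
  fixes L :: "'i set \<Rightarrow> 'i list"
  assumes L: "\<And>J. finite J \<Longrightarrow> set (L J) = J"
      "\<And>J J'. finite J \<Longrightarrow> J' \<subseteq> J \<Longrightarrow> L J' = filter (\<lambda>i. i \<in> J') (L J)"
    and lf: "\<And>x. x \<in> topspace M \<Longrightarrow> \<exists>N. openin M N \<and> x \<in> N \<and> finite {i \<in> I. D i \<inter> N \<noteq> {}}"
    and b: "continuous_map Y M b"
    and D: "\<And>i. i \<in> I \<Longrightarrow> closedin M (D i)"
    and V: "\<And>i. i \<in> I \<Longrightarrow> openin M (V i)" "\<And>i. i \<in> I \<Longrightarrow> D i \<subseteq> V i"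
    and T: "\<And>i. i \<in> I \<Longrightarrow> continuous_map (subtopology Y {y \<in> topspace Y. b y \<in> V i}) Y (T i)"
    and bT: "\<And>i y. i \<in> I \<Longrightarrow> y \<in> topspace Y \<Longrightarrow> b (T i y) = b y"
    and id: "\<And>i y. i \<in> I \<Longrightarrow> y \<in> topspace Y \<Longrightarrow> b y \<notin> D i \<Longrightarrow> T i y = y"
  shows "continuous_map Y Y (locally_finite_fold L I D b T)"
proof (rule continuous_map_locally)
  have cont: "continuous_map Y Y (T i)" if i: "i \<in> I" for i
  proof (rule continuous_map_locally)
    fix y assume y: "y \<in> topspace Y"
    show "\<exists>U f'. openin Y U \<and> y \<in> U \<and> continuous_map (subtopology Y U) Y f' \<and> (\<forall>u\<in>U. f' u = T i u)"
    proof (cases "b y \<in> D i")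
      case True
      have "openin Y {y \<in> topspace Y. b y \<in> V i}"
        using V(1)[OF i] b by (rule openin_continuous_map_preimage[rotated])
      then show ?thesis using True V(2)[OF i] T[OF i] y by blast
    next
      case False
      have "openin M (topspace M - D i)" using D[OF i] by blast
      then have "openin Y {y \<in> topspace Y. b y \<in> topspace M - D i}"
        using b by (rule openin_continuous_map_preimage[rotated])
      moreover have "b y \<in> topspace M" using b y continuous_map_funspace by fastforce
      ultimately show ?thesis using False id[OF i] y
        by (intro exI[of _ "{y \<in> topspace Y. b y \<in> topspace M - D i}"] exI[of _ "\<lambda>y. y"])
          (auto intro: continuous_map_from_subtopology)
    qed
  qed
  fix y assume y: "y \<in> topspace Y"
  then have "b y \<in> topspace M" using b continuous_map_funspace by fastforce
  then obtain N where N: "openin M N" "b y \<in> N" and fin: "finite {i \<in> I. D i \<inter> N \<noteq> {}}"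
    using lf by blast
  define J where "J = {i \<in> I. D i \<inter> N \<noteq> {}}"
  define U where "U = {y \<in> topspace Y. b y \<in> N}"
  have J: "finite J" "J \<subseteq> I" "set (L J) = J" using fin L(1) by (auto simp: J_def)
  \<comment> \<open>The surplus indices of \<open>J\<close> act as the identity on the fibre of
    \<open>u\<close>, which every operator preserves; as both lists follow the same order, they may
    be inserted without effect.\<close>
  have "fold T (L J) u = locally_finite_fold L I D b T u" if u: "u \<in> U" for u
  proof -
    have "{i \<in> I. b u \<in> D i} \<subseteq> J" using u by (auto simp: J_def U_def)
    then have "L {i \<in> I. b u \<in> D i} = filter (\<lambda>i. i \<in> {i \<in> I. b u \<in> D i}) (L J)"
      using L(2) J by blast
    moreover have "fold T (filter (\<lambda>i. i \<in> {i \<in> I. b u \<in> D i}) (L J)) u = fold T (L J) u"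
    proof (rule fold_filter_neutral[where A = "{y \<in> topspace Y. b y = b u}"])
      show "T i y \<in> {y \<in> topspace Y. b y = b u}"
        if "i \<in> set (L J)" "y \<in> {y \<in> topspace Y. b y = b u}" for i y
        using that J bT continuous_map_funspace[OF cont] by (auto simp: Pi_iff)
      show "T i y = y"
        if "i \<in> set (L J)" "i \<notin> {i \<in> I. b u \<in> D i}" "y \<in> {y \<in> topspace Y. b y = b u}" for i y
        using that J id by auto
    qed (use u in \<open>auto simp: U_def\<close>)
    ultimately show ?thesis by (simp add: locally_finite_fold_def)
  qed
  moreover have "openin Y U" "y \<in> U"
    using openin_continuous_map_preimage[OF b N(1)] N(2) y by (auto simp: U_def)
  moreover have "continuous_map (subtopology Y U) Y (fold T (L J))"
    using J cont by (intro continuous_map_from_subtopology continuous_map_fold) auto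
  ultimately show "\<exists>U f'. openin Y U \<and> y \<in> U \<and> continuous_map (subtopology Y U) Y f' \<and>
      (\<forall>u\<in>U. f' u = locally_finite_fold L I D b T u)"
    by (intro exI[of _ U] exI[of _ "fold T (L J)"] conjI ballI)
qed

section \<open>Principal bundles\<close>

lemma continuous_map_image: "continuous_map X Y f \<Longrightarrow> x \<in> topspace X \<Longrightarrow> f x \<in> topspace Y"
  by (simp add: continuous_map_def Pi_iff)

lemma continuous_map_compose':
  "continuous_map Y Z g \<Longrightarrow> continuous_map X Y f \<Longrightarrow> continuous_map X Z (\<lambda>x. g (f x))"
  using continuous_map_compose[of X Y f Z g] by (simp add: comp_def)

lemma continuous_map_ident: "continuous_map X X (\<lambda>x. x)"
  by simp

context topological_group
begin

lemma continuous_map_mult: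
  assumes "continuous_map X T f" "continuous_map X T g"
  shows "continuous_map X T (\<lambda>x. f x \<otimes> g x)"
  using continuous_map_compose'[OF continuous_mult continuous_map_pairedI[OF assms]] by simp

lemma continuous_map_inv: "continuous_map X T f \<Longrightarrow> continuous_map X T (\<lambda>x. inv (f x))"
  by (rule continuous_map_compose'[OF continuous_inv])

lemma continuous_map_carrier: "continuous_map X T f \<Longrightarrow> x \<in> topspace X \<Longrightarrow> f x \<in> carrier G"
  using continuous_map_image topspace_eq_carrier by metis

end

locale crossed_mod =
  fixes C :: "('g, 'h) crossed_data"
  assumes crossed_module: "crossed_module C"
begin

abbreviation "G \<equiv> grpG C"
abbreviation "H \<equiv> grpH C"
abbreviation "t \<equiv> bdry C"

sublocale G: topological_group G "topG C"
  using crossed_module unfolding crossed_module_def by (elim conjE)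

sublocale H: topological_group H "topH C"
  using crossed_module unfolding crossed_module_def by (elim conjE)

lemma bdry_hom: "t \<in> hom G H"
  using crossed_module unfolding crossed_module_def by (elim conjE)

sublocale t: group_hom G H t
  by (intro group_hom.intro group_hom_axioms.intro G.group_axioms H.group_axioms bdry_hom)

end

text \<open>The translation function of a principal bundle, meaningful only for two points of the
  same fibre.\<close>

definition bundle_div :: "('g, 'h) crossed_data \<Rightarrow> ('p, 'm, 'g, 'h) bibundle_data \<Rightarrow> 'p \<Rightarrow> 'p \<Rightarrow> 'g" where
  "bundle_div C P p q = (THE g. g \<in> carrier (grpG C) \<and> ract P p g = q)"

text \<open>A section \<open>s\<close> and a continuous division rebuild a trivialization:
  \<open>(x, g)\<close> goes to the translate of \<open>s x\<close> by \<open>g\<close>, and the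
  inverse divides a point by the value of the section below it. Bundles can thus be checked without
  handling trivializations.\<close>

lemma (in crossed_mod) principal_bundleI:
  assumes prj: "continuous_map (tot P) M (prj P)"
    and act: "continuous_map (prod_topology (tot P) (topG C)) (tot P) (\<lambda>(p, g). ract P p g)"
    and act_one: "\<And>p. p \<in> topspace (tot P) \<Longrightarrow> ract P p \<one>\<^bsub>G\<^esub> = p"
    and act_mult: "\<And>p g g'. p \<in> topspace (tot P) \<Longrightarrow> g \<in> carrier G \<Longrightarrow> g' \<in> carrier G \<Longrightarrow>
        ract P p (g \<otimes>\<^bsub>G\<^esub> g') = ract P (ract P p g) g'"
    and prj_act: "\<And>p g. p \<in> topspace (tot P) \<Longrightarrow> g \<in> carrier G \<Longrightarrow> prj P (ract P p g) = prj P p"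
    and sec: "\<And>m. m \<in> topspace M \<Longrightarrow> \<exists>U s. openin M U \<and> m \<in> U \<and>
        continuous_map (subtopology M U) (tot P) s \<and> (\<forall>u\<in>U. prj P (s u) = u)"
    and d: "continuous_map (subtopology (prod_topology (tot P) (tot P)) {(p, q). prj P p = prj P q})
        (topG C) (\<lambda>(p, q). d p q)"
    and act_d: "\<And>p q. p \<in> topspace (tot P) \<Longrightarrow> q \<in> topspace (tot P) \<Longrightarrow> prj P p = prj P q \<Longrightarrow>
        ract P p (d p q) = q"
    and d_act: "\<And>p g. p \<in> topspace (tot P) \<Longrightarrow> g \<in> carrier G \<Longrightarrow> d p (ract P p g) = g"
  shows "principal_bundle C M P"
proof -
  have triv: "\<exists>U \<tau>. openin M U \<and> m \<in> U \<and>
        homeomorphic_map (prod_topology (subtopology M U) (topG C))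
          (subtopology (tot P) {p \<in> topspace (tot P). prj P p \<in> U}) \<tau> \<and>
        (\<forall>x \<in> U. \<forall>g \<in> carrier G. prj P (\<tau> (x, g)) = x) \<and>
        (\<forall>x \<in> U. \<forall>g \<in> carrier G. \<forall>g' \<in> carrier G. \<tau> (x, g \<otimes>\<^bsub>G\<^esub> g') = ract P (\<tau> (x, g)) g')"
    if m: "m \<in> topspace M" for m
  proof -
    obtain U s where U: "openin M U" "m \<in> U" and s: "continuous_map (subtopology M U) (tot P) s"
      and ps: "\<And>u. u \<in> U \<Longrightarrow> prj P (s u) = u"
      using sec[OF m] by blast
    have UM: "U \<subseteq> topspace M" using U openin_subset by auto
    have s_in: "s u \<in> topspace (tot P)" if "u \<in> U" for u
      using continuous_map_image[OF s] that UM by auto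
    let ?X = "prod_topology (subtopology M U) (topG C)"
    let ?Y = "subtopology (tot P) {p \<in> topspace (tot P). prj P p \<in> U}"
    define \<tau> where "\<tau> = (\<lambda>(x, g). ract P (s x) g)"
    define \<sigma> where "\<sigma> p = (prj P p, d (s (prj P p)) p)" for p
    have "continuous_map ?X (tot P) (\<lambda>x. (\<lambda>(p, g). ract P p g) (s (fst x), snd x))"
      by (intro continuous_map_compose'[OF act] continuous_map_pairedI continuous_map_snd
          continuous_map_compose'[OF s] continuous_map_fst)
    then have \<tau>: "continuous_map ?X (tot P) \<tau>" by (simp add: \<tau>_def case_prod_unfold)
    have \<tau>': "continuous_map ?X ?Y \<tau>"
      unfolding continuous_map_in_subtopology
      using \<tau> continuous_map_image[OF \<tau>] s_in ps prj_act UM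
      by (auto simp: \<tau>_def G.topspace_eq_carrier)
    have prjU: "continuous_map ?Y (subtopology M U) (prj P)"
      unfolding continuous_map_in_subtopology using prj by (auto intro: continuous_map_from_subtopology)
    have "continuous_map ?Y (topG C) (\<lambda>p. (\<lambda>(p, q). d p q) (s (prj P p), p))"
      by (intro continuous_map_compose'[OF d] continuous_map_into_subtopology continuous_map_pairedI
          continuous_map_compose'[OF s prjU] continuous_map_from_subtopology continuous_map_ident)
        (auto simp: ps)
    then have "continuous_map ?Y ?X \<sigma>"
      unfolding \<sigma>_def by (intro continuous_map_pairedI prjU) simp
    moreover have "\<sigma> (\<tau> x) = x" if "x \<in> topspace ?X" for x
      using that s_in ps prj_act d_act UM by (auto simp: \<sigma>_def \<tau>_def G.topspace_eq_carrier)
    moreover have "\<tau> (\<sigma> p) = p" if "p \<in> topspace ?Y" for p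
      using that s_in ps act_d UM by (auto simp: \<sigma>_def \<tau>_def)
    ultimately have "homeomorphic_maps ?X ?Y \<tau> \<sigma>"
      using \<tau>' by (simp add: homeomorphic_maps_def)
    then have "homeomorphic_map ?X ?Y \<tau>" using homeomorphic_maps_map by blast
    then show ?thesis
      using U s_in ps prj_act act_mult by (intro exI[of _ U] exI[of _ \<tau>]) (auto simp: \<tau>_def)
  qed
  show ?thesis unfolding principal_bundle_def
    using prj act act_one act_mult prj_act triv by (intro conjI ballI) simp_all
qed

section \<open>Local sections, freeness and division in a principal bundle\<close>

locale principal_bundle_over = crossed_mod C for C :: "('g, 'h) crossed_data" +
  fixes M :: "'m topology" and P :: "('p, 'm, 'g, 'h) bibundle_data"
  assumes principal_bundle: "principal_bundle C M P"
begin

lemma continuous_map_prj: "continuous_map (tot P) M (prj P)"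
  and act_one: "p \<in> topspace (tot P) \<Longrightarrow> ract P p \<one>\<^bsub>G\<^esub> = p"
  and act_mult: "p \<in> topspace (tot P) \<Longrightarrow> g \<in> carrier G \<Longrightarrow> g' \<in> carrier G \<Longrightarrow>
        ract P p (g \<otimes>\<^bsub>G\<^esub> g') = ract P (ract P p g) g'"
  and prj_act: "p \<in> topspace (tot P) \<Longrightarrow> g \<in> carrier G \<Longrightarrow> prj P (ract P p g) = prj P p"
  using principal_bundle by (simp_all add: principal_bundle_def)

lemma continuous_map_act:
  assumes "continuous_map X (tot P) f" "continuous_map X (topG C) g"
  shows "continuous_map X (tot P) (\<lambda>x. ract P (f x) (g x))"
proof -
  have "continuous_map (prod_topology (tot P) (topG C)) (tot P) (\<lambda>(p, g). ract P p g)"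
    using principal_bundle by (simp add: principal_bundle_def)
  from continuous_map_compose'[OF this continuous_map_pairedI[OF assms]] show ?thesis by simp
qed

lemma prj_in: "p \<in> topspace (tot P) \<Longrightarrow> prj P p \<in> topspace M"
  using continuous_map_image[OF continuous_map_prj] .

lemma act_closed: "p \<in> topspace (tot P) \<Longrightarrow> g \<in> carrier G \<Longrightarrow> ract P p g \<in> topspace (tot P)"
  using continuous_map_image[OF continuous_map_act[OF continuous_map_fst continuous_map_snd], of "(p, g)"]
  by (simp add: G.topspace_eq_carrier)

lemma act_inv:
  assumes "p \<in> topspace (tot P)" "g \<in> carrier G"
  shows "ract P (ract P p g) (inv\<^bsub>G\<^esub> g) = p" "ract P (ract P p (inv\<^bsub>G\<^esub> g)) g = p"
  using assms act_one by (simp_all flip: act_mult)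

lemma local_trivialization:
  assumes "m \<in> topspace M"
  obtains U \<tau> where "openin M U" "m \<in> U"
    "homeomorphic_map (prod_topology (subtopology M U) (topG C))
          (subtopology (tot P) {p \<in> topspace (tot P). prj P p \<in> U}) \<tau>"
    "\<forall>x \<in> U. \<forall>g \<in> carrier G. prj P (\<tau> (x, g)) = x"
    "\<forall>x \<in> U. \<forall>g \<in> carrier G. \<forall>g' \<in> carrier G. \<tau> (x, g \<otimes>\<^bsub>G\<^esub> g') = ract P (\<tau> (x, g)) g'"
proof -
  have "\<exists>U \<tau>. openin M U \<and> m \<in> U \<and>
        homeomorphic_map (prod_topology (subtopology M U) (topG C))
          (subtopology (tot P) {p \<in> topspace (tot P). prj P p \<in> U}) \<tau> \<and>
        (\<forall>x \<in> U. \<forall>g \<in> carrier G. prj P (\<tau> (x, g)) = x) \<and>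
        (\<forall>x \<in> U. \<forall>g \<in> carrier G. \<forall>g' \<in> carrier G. \<tau> (x, g \<otimes>\<^bsub>G\<^esub> g') = ract P (\<tau> (x, g)) g')"
    using principal_bundle assms unfolding principal_bundle_def by (elim conjE) (erule (1) bspec)
  then show thesis using that by (elim exE conjE)
qed

lemma local_section:
  assumes m: "m \<in> topspace M"
  obtains U s where "openin M U" "m \<in> U" "continuous_map (subtopology M U) (tot P) s"
    "\<forall>u\<in>U. prj P (s u) = u"
proof -
  obtain U \<tau> where U: "openin M U" "m \<in> U"
    and \<tau>: "homeomorphic_map (prod_topology (subtopology M U) (topG C))
          (subtopology (tot P) {p \<in> topspace (tot P). prj P p \<in> U}) \<tau>"
    and p\<tau>: "\<forall>x \<in> U. \<forall>g \<in> carrier G. prj P (\<tau> (x, g)) = x"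
    by (rule local_trivialization[OF m])
  have "continuous_map (prod_topology (subtopology M U) (topG C)) (tot P) \<tau>"
    using homeomorphic_imp_continuous_map[OF \<tau>] by (simp add: continuous_map_in_subtopology)
  then have "continuous_map (subtopology M U) (tot P) (\<lambda>x. \<tau> (x, \<one>\<^bsub>G\<^esub>))"
    by (rule continuous_map_compose')
      (auto intro!: continuous_map_pairedI simp: G.topspace_eq_carrier)
  then show thesis using U p\<tau> by (intro that[of U "\<lambda>x. \<tau> (x, \<one>\<^bsub>G\<^esub>)"]) auto
qed

text \<open>In a local trivialization, division becomes \<open>((x, a), (x, b)) \<mapsto> a\<inverse> b\<close>.\<close>

lemma local_division:
  assumes m: "m \<in> topspace M"
  obtains U c where "openin M U" "m \<in> U"
    "continuous_map (subtopology (tot P) {p \<in> topspace (tot P). prj P p \<in> U}) (topG C) c"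
    "\<forall>p g. p \<in> topspace (tot P) \<longrightarrow> prj P p \<in> U \<longrightarrow> g \<in> carrier G \<longrightarrow> c (ract P p g) = c p \<otimes>\<^bsub>G\<^esub> g"
    "\<forall>p q. p \<in> topspace (tot P) \<longrightarrow> q \<in> topspace (tot P) \<longrightarrow> prj P p = prj P q \<longrightarrow> prj P p \<in> U \<longrightarrow>
      c p = c q \<longrightarrow> p = q"
proof -
  obtain U \<tau> where U: "openin M U" "m \<in> U"
    and \<tau>: "homeomorphic_map (prod_topology (subtopology M U) (topG C))
          (subtopology (tot P) {p \<in> topspace (tot P). prj P p \<in> U}) \<tau>"
    and p\<tau>: "\<forall>x \<in> U. \<forall>g \<in> carrier G. prj P (\<tau> (x, g)) = x"
    and a\<tau>: "\<forall>x \<in> U. \<forall>g \<in> carrier G. \<forall>g' \<in> carrier G. \<tau> (x, g \<otimes>\<^bsub>G\<^esub> g') = ract P (\<tau> (x, g)) g'"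
    by (rule local_trivialization[OF m])
  have UM: "U \<subseteq> topspace M" using U openin_subset by auto
  let ?X = "prod_topology (subtopology M U) (topG C)"
  let ?Y = "subtopology (tot P) {p \<in> topspace (tot P). prj P p \<in> U}"
  obtain \<sigma> where "homeomorphic_maps ?X ?Y \<tau> \<sigma>"
    using \<tau> homeomorphic_map_maps by blast
  then have \<sigma>: "continuous_map ?Y ?X \<sigma>" and \<sigma>\<tau>: "\<And>z. z \<in> topspace ?X \<Longrightarrow> \<sigma> (\<tau> z) = z"
    and \<tau>\<sigma>: "\<And>p. p \<in> topspace ?Y \<Longrightarrow> \<tau> (\<sigma> p) = p"
    by (auto simp: homeomorphic_maps_def)
  define c where "c p = snd (\<sigma> p)" for p
  have c: "continuous_map ?Y (topG C) c"
    unfolding c_def by (rule continuous_map_compose'[OF continuous_map_snd \<sigma>])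
  have rep: "c p \<in> carrier G \<and> p = \<tau> (prj P p, c p)" if "p \<in> topspace (tot P)" "prj P p \<in> U" for p
  proof -
    have p: "p \<in> topspace ?Y" using that by simp
    have "\<sigma> p \<in> topspace ?X" by (rule continuous_map_image[OF \<sigma> p])
    then obtain x g where xg: "\<sigma> p = (x, g)" "x \<in> U" "g \<in> carrier G"
      by (auto simp: G.topspace_eq_carrier)
    then have "p = \<tau> (x, g)" using \<tau>\<sigma>[OF p] by simp
    then show ?thesis using xg p\<tau> by (auto simp: c_def)
  qed
  have cact: "c (ract P p g) = c p \<otimes>\<^bsub>G\<^esub> g"
    if "p \<in> topspace (tot P)" "prj P p \<in> U" "g \<in> carrier G" for p g
  proof -
    note r = rep[OF that(1,2)]
    then have "ract P p g = \<tau> (prj P p, c p \<otimes>\<^bsub>G\<^esub> g)" using a\<tau> that by metis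
    moreover have "\<sigma> (\<tau> (prj P p, c p \<otimes>\<^bsub>G\<^esub> g)) = (prj P p, c p \<otimes>\<^bsub>G\<^esub> g)"
      using r that UM by (intro \<sigma>\<tau>) (auto simp: G.topspace_eq_carrier)
    ultimately show ?thesis by (simp add: c_def)
  qed
  have cinj: "p = q"
    if "p \<in> topspace (tot P)" "q \<in> topspace (tot P)" "prj P p = prj P q" "prj P p \<in> U" "c p = c q"
    for p q
    using rep[of p] rep[of q] that by metis
  show thesis by (rule that[OF U c]) (use cact cinj in auto)
qed

lemma act_cancel:
  assumes p: "p \<in> topspace (tot P)" and g: "g \<in> carrier G" "g' \<in> carrier G"
    and eq: "ract P p g = ract P p g'"
  shows "g = g'"
proof -
  obtain U c where U: "openin M U" "prj P p \<in> U"
    and c: "continuous_map (subtopology (tot P) {p \<in> topspace (tot P). prj P p \<in> U}) (topG C) c"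
    and ca: "\<forall>p g. p \<in> topspace (tot P) \<longrightarrow> prj P p \<in> U \<longrightarrow> g \<in> carrier G \<longrightarrow>
      c (ract P p g) = c p \<otimes>\<^bsub>G\<^esub> g"
    by (rule local_division[OF prj_in[OF p]])
  have "c p \<in> carrier G" using G.continuous_map_carrier[OF c] p U by simp
  moreover have "c p \<otimes>\<^bsub>G\<^esub> g = c p \<otimes>\<^bsub>G\<^esub> g'" using ca p U g eq by metis
  ultimately show ?thesis using g by simp
qed

lemma bundle_div_act:
  assumes "p \<in> topspace (tot P)" "g \<in> carrier G"
  shows "bundle_div C P p (ract P p g) = g"
  unfolding bundle_div_def using assms act_cancel by (intro the_equality) auto

text \<open>The coordinate \<open>c\<close> trades the description of \<open>bundle_div\<close> by
  uniqueness for a formula in the group operations, from which both existence and continuity of the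
  quotient are read off.\<close>

lemma local_bundle_div:
  assumes m: "m \<in> topspace M"
  obtains U c where "openin M U" "m \<in> U"
    "continuous_map (subtopology (tot P) {p \<in> topspace (tot P). prj P p \<in> U}) (topG C) c"
    "\<forall>p q. p \<in> topspace (tot P) \<longrightarrow> q \<in> topspace (tot P) \<longrightarrow> prj P p = prj P q \<longrightarrow> prj P p \<in> U \<longrightarrow>
      bundle_div C P p q = inv\<^bsub>G\<^esub> c p \<otimes>\<^bsub>G\<^esub> c q \<and> ract P p (inv\<^bsub>G\<^esub> c p \<otimes>\<^bsub>G\<^esub> c q) = q"
proof -
  obtain U c where U: "openin M U" "m \<in> U"
    and c: "continuous_map (subtopology (tot P) {p \<in> topspace (tot P). prj P p \<in> U}) (topG C) c"
    and ca: "\<forall>p g. p \<in> topspace (tot P) \<longrightarrow> prj P p \<in> U \<longrightarrow> g \<in> carrier G \<longrightarrow>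
      c (ract P p g) = c p \<otimes>\<^bsub>G\<^esub> g"
    and ci: "\<forall>p q. p \<in> topspace (tot P) \<longrightarrow> q \<in> topspace (tot P) \<longrightarrow> prj P p = prj P q \<longrightarrow>
      prj P p \<in> U \<longrightarrow> c p = c q \<longrightarrow> p = q"
    by (rule local_division[OF m])
  have "bundle_div C P p q = inv\<^bsub>G\<^esub> c p \<otimes>\<^bsub>G\<^esub> c q \<and> ract P p (inv\<^bsub>G\<^esub> c p \<otimes>\<^bsub>G\<^esub> c q) = q"
    if pq: "p \<in> topspace (tot P)" "q \<in> topspace (tot P)" "prj P p = prj P q" "prj P p \<in> U" for p q
  proof -
    have cc: "c p \<in> carrier G" "c q \<in> carrier G"
      using G.continuous_map_carrier[OF c] pq by simp_all
    let ?g = "inv\<^bsub>G\<^esub> c p \<otimes>\<^bsub>G\<^esub> c q"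
    have g: "?g \<in> carrier G" using cc by simp
    have "c (ract P p ?g) = c p \<otimes>\<^bsub>G\<^esub> ?g" using ca pq g by blast
    also have "\<dots> = c q" using cc by (simp add: G.m_assoc[symmetric])
    finally have "ract P p ?g = q"
      using ci act_closed[OF pq(1) g] prj_act[OF pq(1) g] pq by metis
    then show ?thesis using bundle_div_act[OF pq(1) g] by simp
  qed
  then show thesis by (intro that[OF U c]) simp
qed

lemma bundle_div:
  assumes "p \<in> topspace (tot P)" "q \<in> topspace (tot P)" "prj P p = prj P q"
  shows bundle_div_closed: "bundle_div C P p q \<in> carrier G"
    and act_bundle_div: "ract P p (bundle_div C P p q) = q"
proof -
  obtain U c where "prj P p \<in> U"
    and c: "continuous_map (subtopology (tot P) {p \<in> topspace (tot P). prj P p \<in> U}) (topG C) c"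
    and *: "\<forall>p q. p \<in> topspace (tot P) \<longrightarrow> q \<in> topspace (tot P) \<longrightarrow> prj P p = prj P q \<longrightarrow> prj P p \<in> U \<longrightarrow>
      bundle_div C P p q = inv\<^bsub>G\<^esub> c p \<otimes>\<^bsub>G\<^esub> c q \<and> ract P p (inv\<^bsub>G\<^esub> c p \<otimes>\<^bsub>G\<^esub> c q) = q"
    by (rule local_bundle_div[OF prj_in[OF assms(1)]])
  moreover have "c p \<in> carrier G" "c q \<in> carrier G"
    using G.continuous_map_carrier[OF c] assms \<open>prj P p \<in> U\<close> by simp_all
  ultimately show "bundle_div C P p q \<in> carrier G" "ract P p (bundle_div C P p q) = q"
    using assms by auto
qed

lemma continuous_map_bundle_div:
  assumes f: "continuous_map X (tot P) f" and g: "continuous_map X (tot P) g"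
    and fg: "\<And>x. x \<in> topspace X \<Longrightarrow> prj P (f x) = prj P (g x)"
  shows "continuous_map X (topG C) (\<lambda>x. bundle_div C P (f x) (g x))"
proof (rule continuous_map_locally)
  fix x assume x: "x \<in> topspace X"
  note f_in = continuous_map_image[OF f] and g_in = continuous_map_image[OF g]
  obtain U c where U: "openin M U" "prj P (f x) \<in> U"
    and c: "continuous_map (subtopology (tot P) {p \<in> topspace (tot P). prj P p \<in> U}) (topG C) c"
    and *: "\<forall>p q. p \<in> topspace (tot P) \<longrightarrow> q \<in> topspace (tot P) \<longrightarrow> prj P p = prj P q \<longrightarrow> prj P p \<in> U \<longrightarrow>
      bundle_div C P p q = inv\<^bsub>G\<^esub> c p \<otimes>\<^bsub>G\<^esub> c q \<and> ract P p (inv\<^bsub>G\<^esub> c p \<otimes>\<^bsub>G\<^esub> c q) = q"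
    by (rule local_bundle_div[OF prj_in[OF f_in[OF x]]])
  define W where "W = {y \<in> topspace X. prj P (f y) \<in> U}"
  have "openin X W" unfolding W_def
    using openin_continuous_map_preimage[OF continuous_map_compose'[OF continuous_map_prj f] U(1)] .
  moreover have "continuous_map (subtopology X W) (topG C) (\<lambda>y. inv\<^bsub>G\<^esub> c (f y) \<otimes>\<^bsub>G\<^esub> c (g y))"
    by (intro G.continuous_map_mult G.continuous_map_inv continuous_map_compose'[OF c]
        continuous_map_into_subtopology continuous_map_from_subtopology f g)
      (use f_in g_in fg in \<open>auto simp: W_def\<close>)
  moreover have "inv\<^bsub>G\<^esub> c (f y) \<otimes>\<^bsub>G\<^esub> c (g y) = bundle_div C P (f y) (g y)" if "y \<in> W" for y
    using that *[rule_format, of "f y" "g y"] f_in g_in fg by (auto simp: W_def)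
  moreover have "x \<in> W" using x U(2) by (simp add: W_def)
  ultimately show "\<exists>W h. openin X W \<and> x \<in> W \<and> continuous_map (subtopology X W) (topG C) h \<and>
      (\<forall>y\<in>W. h y = bundle_div C P (f y) (g y))"
    by (intro exI[of _ W] exI[of _ "\<lambda>y. inv\<^bsub>G\<^esub> c (f y) \<otimes>\<^bsub>G\<^esub> c (g y)"] conjI ballI)
qed

lemma bundle_div_act_act:
  assumes "p \<in> topspace (tot P)" "q \<in> topspace (tot P)" "prj P p = prj P q" "g \<in> carrier G"
  shows "bundle_div C P p (ract P q g) = bundle_div C P p q \<otimes>\<^bsub>G\<^esub> g"
proof -
  have "ract P p (bundle_div C P p q \<otimes>\<^bsub>G\<^esub> g) = ract P q g"
    using assms by (simp add: act_mult bundle_div_closed act_bundle_div)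
  then show ?thesis
    using bundle_div_act[OF assms(1), of "bundle_div C P p q \<otimes>\<^bsub>G\<^esub> g"] assms bundle_div_closed by simp
qed

end

section \<open>Bibundles and pullbacks\<close>

locale bibundle_over = crossed_mod C for C :: "('g, 'h) crossed_data" +
  fixes M :: "'m topology" and P :: "('p, 'm, 'g, 'h) bibundle_data"
  assumes bibundle: "bibundle C M P"
begin

sublocale principal_bundle_over C M P
  using bibundle by unfold_locales (simp add: bibundle_def)

lemma str_act: "p \<in> topspace (tot P) \<Longrightarrow> g \<in> carrier G \<Longrightarrow>
    str P (ract P p g) = str P p \<otimes>\<^bsub>H\<^esub> t g"
  using bibundle by (simp add: bibundle_def)

lemma continuous_map_str: "continuous_map (tot P) (topH C) (str P)"
  using bibundle by (simp add: bibundle_def)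

lemma str_closed: "p \<in> topspace (tot P) \<Longrightarrow> str P p \<in> carrier H"
  by (rule H.continuous_map_carrier[OF continuous_map_str])

end

text \<open>Bundle maps over the identity are automatically invertible: freeness of the action gives
  injectivity, transitivity on fibres gives surjectivity, and local sections of \<open>P\<close>
  give continuity of the inverse.\<close>

lemma equivariant_map_imp_isomorphic:
  assumes C: "crossed_module C" and P: "bibundle C M P" and Q: "bibundle C M Q"
    and F: "continuous_map (tot P) (tot Q) F"
    and prj: "\<And>p. p \<in> topspace (tot P) \<Longrightarrow> prj Q (F p) = prj P p"
    and act: "\<And>p g. p \<in> topspace (tot P) \<Longrightarrow> g \<in> carrier (grpG C) \<Longrightarrow> F (ract P p g) = ract Q (F p) g"
    and str: "\<And>p. p \<in> topspace (tot P) \<Longrightarrow> str Q (F p) = str P p"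
  shows "isomorphic_bibundles C P Q"
proof -
  interpret P: bibundle_over C M P using C P by unfold_locales
  interpret Q: bibundle_over C M Q using Q by unfold_locales
  note F_in = continuous_map_image[OF F]
  have inj: "p = p'" if pp: "p \<in> topspace (tot P)" "p' \<in> topspace (tot P)" "F p = F p'" for p p'
  proof -
    have "prj P p = prj P p'" using prj that by metis
    then obtain g where g: "g \<in> carrier P.G" "p' = ract P p g"
      using P.bundle_div_closed P.act_bundle_div pp(1,2) by metis
    then have "ract Q (F p) g = ract Q (F p) \<one>\<^bsub>P.G\<^esub>"
      using act that Q.act_one F_in by simp
    then have "g = \<one>\<^bsub>P.G\<^esub>" using Q.act_cancel[OF F_in[OF that(1)] g(1)] by simp
    then show ?thesis using g that P.act_one by simp
  qed
  \<comment> \<open>The preimage of \<open>q\<close>, computed from a reference point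
    \<open>p\<close> over the same base point. Injectivity of \<open>F\<close> makes it independent
    of \<open>p\<close>, so the arbitrary choice in \<open>K\<close> may locally be replaced by a
    continuous section.\<close>
  define K0 where "K0 p q = ract P p (bundle_div C Q (F p) q)" for p q
  have K0: "K0 p q \<in> topspace (tot P) \<and> F (K0 p q) = q"
    if "p \<in> topspace (tot P)" "q \<in> topspace (tot Q)" "prj P p = prj Q q" for p q
    using that act F_in prj Q.bundle_div_closed Q.act_bundle_div P.act_closed by (auto simp: K0_def)
  define K where "K q = K0 (SOME p. p \<in> topspace (tot P) \<and> prj P p = prj Q q) q" for q
  have sec: "\<exists>U s. openin M U \<and> prj Q q \<in> U \<and> continuous_map (subtopology M U) (tot P) s \<and>
      (\<forall>u\<in>U. s u \<in> topspace (tot P) \<and> prj P (s u) = u)" if q: "q \<in> topspace (tot Q)" for q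
  proof -
    obtain U s where U: "openin M U" "prj Q q \<in> U" "continuous_map (subtopology M U) (tot P) s"
      "\<forall>u\<in>U. prj P (s u) = u"
      by (rule P.local_section[OF Q.prj_in[OF q]])
    moreover have "s u \<in> topspace (tot P)" if "u \<in> U" for u
      using continuous_map_image[OF U(3), of u] openin_subset[OF U(1)] that by auto
    ultimately show ?thesis by blast
  qed
  have K: "K q \<in> topspace (tot P) \<and> F (K q) = q" if q: "q \<in> topspace (tot Q)" for q
  proof -
    have "\<exists>p. p \<in> topspace (tot P) \<and> prj P p = prj Q q" using sec[OF q] by blast
    from someI_ex[OF this] show ?thesis unfolding K_def using K0 q by blast
  qed
  have K_eq: "K q = K0 p q"
    if "p \<in> topspace (tot P)" "q \<in> topspace (tot Q)" "prj P p = prj Q q" for p q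
    using K[OF that(2)] K0[OF that] inj by metis
  have "continuous_map (tot Q) (tot P) K"
  proof (rule continuous_map_locally)
    fix q assume q: "q \<in> topspace (tot Q)"
    obtain U s where U: "openin M U" "prj Q q \<in> U" and s: "continuous_map (subtopology M U) (tot P) s"
      and s': "\<forall>u\<in>U. s u \<in> topspace (tot P) \<and> prj P (s u) = u"
      using sec[OF q] by blast
    define W where "W = {q \<in> topspace (tot Q). prj Q q \<in> U}"
    have W: "openin (tot Q) W"
      unfolding W_def by (rule openin_continuous_map_preimage[OF Q.continuous_map_prj U(1)])
    have id: "continuous_map (subtopology (tot Q) W) (tot Q) (\<lambda>q. q)"
      by (intro continuous_map_from_subtopology continuous_map_ident)
    have "continuous_map (subtopology (tot Q) W) (subtopology M U) (prj Q)"
      by (intro continuous_map_into_subtopology continuous_map_from_subtopology Q.continuous_map_prj)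
        (auto simp: W_def)
    then have s1: "continuous_map (subtopology (tot Q) W) (tot P) (\<lambda>q. s (prj Q q))"
      by (rule continuous_map_compose'[OF s])
    have "continuous_map (subtopology (tot Q) W) (tot P) (\<lambda>q. K0 (s (prj Q q)) q)"
      unfolding K0_def
      by (intro P.continuous_map_act Q.continuous_map_bundle_div continuous_map_compose'[OF F] s1 id)
        (use prj s' in \<open>auto simp: W_def\<close>)
    moreover have "K0 (s (prj Q q)) q = K q" if "q \<in> W" for q
      using K_eq[of "s (prj Q q)" q] s' that by (simp add: W_def)
    moreover have "q \<in> W" using q U by (simp add: W_def)
    ultimately show "\<exists>W h. openin (tot Q) W \<and> q \<in> W \<and> continuous_map (subtopology (tot Q) W) (tot P) h \<and>
      (\<forall>q\<in>W. h q = K q)"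
      using W by (intro exI[of _ W] exI[of _ "\<lambda>q. K0 (s (prj Q q)) q"] conjI ballI)
  qed
  then have "homeomorphic_maps (tot P) (tot Q) F K"
    unfolding homeomorphic_maps_def using F K F_in inj by metis
  then have "homeomorphic_map (tot P) (tot Q) F" using homeomorphic_maps_map by blast
  then show ?thesis unfolding isomorphic_bibundles_def
    using prj act str by (intro exI[of _ F] conjI ballI)
qed

section \<open>Pullbacks of bibundles and their universal property\<close>

context bibundle_over
begin

lemma tot_pullback: "tot (pullback_bibundle N f P) =
    subtopology (prod_topology N (tot P)) {(n, p). f n = prj P p}"
  by (simp add: pullback_bibundle_def)

lemma topspace_pullback: "topspace (tot (pullback_bibundle N f P)) =
    {(n, p). n \<in> topspace N \<and> p \<in> topspace (tot P) \<and> f n = prj P p}"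
  by (auto simp: tot_pullback)

lemma pullback_simps:
  "prj (pullback_bibundle N f P) = fst"
  "ract (pullback_bibundle N f P) x g = (fst x, ract P (snd x) g)"
  "str (pullback_bibundle N f P) x = str P (snd x)"
  by (simp_all add: pullback_bibundle_def case_prod_unfold)

lemma continuous_map_into_pullback:
  assumes "continuous_map X N a" "continuous_map X (tot P) b"
    and "\<And>x. x \<in> topspace X \<Longrightarrow> f (a x) = prj P (b x)"
  shows "continuous_map X (tot (pullback_bibundle N f P)) (\<lambda>x. (a x, b x))"
  unfolding tot_pullback
  using assms by (intro continuous_map_into_subtopology continuous_map_pairedI) auto

lemma continuous_map_pullback_fst: "continuous_map (tot (pullback_bibundle N f P)) N fst"
  and continuous_map_pullback_snd: "continuous_map (tot (pullback_bibundle N f P)) (tot P) snd"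
  unfolding tot_pullback
  by (intro continuous_map_from_subtopology continuous_map_fst continuous_map_snd)+

lemma bibundle_pullback:
  assumes f: "continuous_map N M f"
  shows "bibundle C N (pullback_bibundle N f P)"
proof -
  let ?Q = "pullback_bibundle N f P"
  note f1 = continuous_map_pullback_fst[of N f] and f2 = continuous_map_pullback_snd[of N f]
  have "principal_bundle C N ?Q"
  proof (rule principal_bundleI[where d = "\<lambda>x y. bundle_div C P (snd x) (snd y)"])
    show "continuous_map (tot ?Q) N (prj ?Q)"
      by (simp add: pullback_simps(1) f1)
    let ?X = "prod_topology (tot ?Q) (topG C)"
    have "continuous_map ?X (tot ?Q) (\<lambda>x. (fst (fst x), ract P (snd (fst x)) (snd x)))"
      by (intro continuous_map_into_pullback continuous_map_act continuous_map_compose'[OF f1]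
          continuous_map_compose'[OF f2] continuous_map_fst continuous_map_snd)
        (auto simp: topspace_pullback G.topspace_eq_carrier prj_act)
    then show "continuous_map ?X (tot ?Q) (\<lambda>(x, g). ract ?Q x g)"
      by (simp add: pullback_simps case_prod_unfold)
    show "\<exists>U s. openin N U \<and> n \<in> U \<and> continuous_map (subtopology N U) (tot ?Q) s \<and>
        (\<forall>u\<in>U. prj ?Q (s u) = u)" if n: "n \<in> topspace N" for n
    proof -
      obtain U s where U: "openin M U" "f n \<in> U" and s: "continuous_map (subtopology M U) (tot P) s"
        and ps: "\<forall>u\<in>U. prj P (s u) = u"
        by (rule local_section[OF continuous_map_image[OF f n]])
      define W where "W = {n \<in> topspace N. f n \<in> U}"
      have W: "openin N W" unfolding W_def by (rule openin_continuous_map_preimage[OF f U(1)])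
      have "continuous_map (subtopology N W) (subtopology M U) f"
        by (intro continuous_map_into_subtopology continuous_map_from_subtopology f) (auto simp: W_def)
      from continuous_map_compose'[OF s this]
      have "continuous_map (subtopology N W) (tot ?Q) (\<lambda>n. (n, s (f n)))"
        by (rule continuous_map_into_pullback[OF
              continuous_map_from_subtopology[OF continuous_map_ident]])
          (use ps in \<open>auto simp: W_def\<close>)
      moreover have "n \<in> W" using n U by (simp add: W_def)
      ultimately show ?thesis using W
        by (intro exI[of _ W] exI[of _ "\<lambda>n. (n, s (f n))"]) (simp add: pullback_simps)
    qed
    let ?Z = "subtopology (prod_topology (tot ?Q) (tot ?Q)) {(x, y). prj ?Q x = prj ?Q y}"
    have "continuous_map ?Z (topG C) (\<lambda>z. bundle_div C P (snd (fst z)) (snd (snd z)))"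
      by (intro continuous_map_bundle_div continuous_map_compose'[OF f2] continuous_map_from_subtopology
          continuous_map_fst continuous_map_snd) (auto simp: topspace_pullback pullback_simps)
    then show "continuous_map ?Z (topG C) (\<lambda>(x, y). bundle_div C P (snd x) (snd y))"
      by (simp add: case_prod_unfold)
  qed (auto simp: topspace_pullback pullback_simps prj_act act_mult act_one act_closed
      act_bundle_div bundle_div_act)
  moreover have "continuous_map (tot ?Q) (topH C) (str ?Q)"
    using continuous_map_compose'[OF continuous_map_str f2] by (simp add: pullback_simps(3)[abs_def])
  ultimately show ?thesis
    by (auto simp: bibundle_def topspace_pullback pullback_simps str_act)
qed

text \<open>The universal property in the form used for existence and for transport: an equivariant
  map into \<open>P\<close> covering \<open>f\<close> and compatible with the structure maps, paired
  with the projection of \<open>Q\<close>, is a bundle map over the identity and hence an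
  isomorphism.\<close>

lemma isomorphic_pullback:
  assumes Q: "bibundle C N Q" and f: "continuous_map N M f"
    and F: "continuous_map (tot Q) (tot P) F"
    and prj: "\<And>q. q \<in> topspace (tot Q) \<Longrightarrow> prj P (F q) = f (prj Q q)"
    and act: "\<And>q g. q \<in> topspace (tot Q) \<Longrightarrow> g \<in> carrier G \<Longrightarrow> F (ract Q q g) = ract P (F q) g"
    and str: "\<And>q. q \<in> topspace (tot Q) \<Longrightarrow> str P (F q) = str Q q"
  shows "isomorphic_bibundles C Q (pullback_bibundle N f P)"
proof -
  interpret Q: bibundle_over C N Q using Q by unfold_locales
  show ?thesis
  proof (rule equivariant_map_imp_isomorphic[OF crossed_module Q bibundle_pullback[OF f],
        where F = "\<lambda>q. (prj Q q, F q)"])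
    show "continuous_map (tot Q) (tot (pullback_bibundle N f P)) (\<lambda>q. (prj Q q, F q))"
      by (intro continuous_map_into_pullback Q.continuous_map_prj F) (simp add: prj)
  qed (simp_all add: pullback_simps Q.prj_act act str)
qed

end

section \<open>Gluing local operators\<close>

text \<open>Each local operator \<open>T V \<mu>\<close> acts over \<open>V\<close> with strength \<open>\<mu>\<close>, and not at all where \<open>\<mu> = 0\<close>.
  Composing those of a locally finite family of bump functions gives a global operator which, over
  each point, involves one operator at full strength.\<close>

lemma glue_local_operators:
  fixes T :: "'m set \<Rightarrow> ('m \<Rightarrow> real) \<Rightarrow> 'y \<Rightarrow> 'y"
  assumes M: "paracompact_space M"
    and cov: "\<And>x. x \<in> topspace M \<Longrightarrow> \<exists>U. openin M U \<and> x \<in> U \<and> good U"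
    and mono: "\<And>U V. good U \<Longrightarrow> V \<subseteq> U \<Longrightarrow> good V"
    and b: "continuous_map Y M b"
    and T: "\<And>V \<mu>. openin M V \<Longrightarrow> good V \<Longrightarrow> continuous_map M (top_of_set {0..1}) \<mu> \<Longrightarrow>
      continuous_map (subtopology Y {y \<in> topspace Y. b y \<in> V}) Y (T V \<mu>)"
    and bT: "\<And>V \<mu> y. openin M V \<Longrightarrow> good V \<Longrightarrow> continuous_map M (top_of_set {0..1}) \<mu> \<Longrightarrow>
      y \<in> topspace Y \<Longrightarrow> b y \<in> V \<Longrightarrow> b (T V \<mu> y) = b y"
    and id: "\<And>V \<mu> y. openin M V \<Longrightarrow> good V \<Longrightarrow> continuous_map M (top_of_set {0..1}) \<mu> \<Longrightarrow>
      y \<in> topspace Y \<Longrightarrow> b y \<in> V \<Longrightarrow> \<mu> (b y) = 0 \<Longrightarrow> T V \<mu> y = y"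
  shows "\<exists>\<Phi>. continuous_map Y Y \<Phi> \<and>
    (\<forall>x\<in>topspace M. \<exists>zs. (\<forall>(V, \<mu>)\<in>set zs. openin M V \<and> good V \<and> x \<in> V \<and>
        continuous_map M (top_of_set {0..1}) \<mu>) \<and> (\<exists>(V, \<mu>)\<in>set zs. \<mu> x = 1) \<and>
      (\<forall>y\<in>topspace Y. b y = x \<longrightarrow> \<Phi> y = fold (\<lambda>(V, \<mu>). T V \<mu>) zs y))"
proof -
  obtain \<V> D and \<mu> :: "'m set \<Rightarrow> 'm \<Rightarrow> real" where
    lf: "locally_finite_in M \<V>"
    and V: "\<forall>V\<in>\<V>. openin M V \<and> good V"
    and D: "\<forall>V\<in>\<V>. closedin M (D V) \<and> D V \<subseteq> V"
    and \<mu>: "\<forall>V\<in>\<V>. continuous_map M (top_of_set {0..1}) (\<mu> V)"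
    and \<mu>0: "\<forall>V\<in>\<V>. \<forall>x\<in>topspace M. x \<notin> D V \<longrightarrow> \<mu> V x = 0"
    and \<mu>1: "\<forall>x\<in>topspace M. \<exists>V\<in>\<V>. \<mu> V x = 1"
    by (rule paracompact_space_bump_functions[OF M cov mono])
  obtain L :: "'m set set \<Rightarrow> 'm set list" where
    L: "\<And>J. finite J \<Longrightarrow> set (L J) = J"
      "\<And>J J'. finite J \<Longrightarrow> J' \<subseteq> J \<Longrightarrow> L J' = filter (\<lambda>i. i \<in> J') (L J)"
    using ex_linear_order_lists by blast
  \<comment> \<open>Nothing is known of the operator outside \<open>V\<close>. Extending it by the
    identity preserves continuity because it already is the identity over the part of
    \<open>V\<close> outside the closed set \<open>D V\<close>.\<close>
  define T' where "T' V y = (if b y \<in> V then T V (\<mu> V) y else y)" for V y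
  note b_in = continuous_map_image[OF b]
  have T'_in: "T' V y \<in> topspace Y" and bT': "b (T' V y) = b y"
    if "V \<in> \<V>" "y \<in> topspace Y" for V y
    using continuous_map_image[OF T, of V "\<mu> V" y] bT[of V "\<mu> V" y] V \<mu> that by (auto simp: T'_def)
  have fin: "\<exists>N. openin M N \<and> x \<in> N \<and> finite {V \<in> \<V>. D V \<inter> N \<noteq> {}}" if "x \<in> topspace M" for x
  proof -
    obtain N where N: "openin M N" "x \<in> N" "finite {V \<in> \<V>. V \<inter> N \<noteq> {}}"
      using lf \<open>x \<in> topspace M\<close> unfolding locally_finite_in_def by blast
    have "{V \<in> \<V>. D V \<inter> N \<noteq> {}} \<subseteq> {V \<in> \<V>. V \<inter> N \<noteq> {}}" using D by blast
    then show ?thesis using N finite_subset by blast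
  qed
  define \<Phi> where "\<Phi> = locally_finite_fold L \<V> D b T'"
  have \<Phi>_cont: "continuous_map Y Y \<Phi>"
    unfolding \<Phi>_def
  proof (rule continuous_map_locally_finite_fold[where V = "\<lambda>V. V", OF L fin b])
    show "continuous_map (subtopology Y {y \<in> topspace Y. b y \<in> V}) Y (T' V)" if "V \<in> \<V>" for V
      using T[of V "\<mu> V"] V \<mu> that by (auto intro: continuous_map_eq simp: T'_def)
    show "T' V y = y" if "V \<in> \<V>" "y \<in> topspace Y" "b y \<notin> D V" for V y
      using id[of V "\<mu> V" y] V \<mu> \<mu>0 b_in that by (auto simp: T'_def)
  qed (use V D bT' in auto)
  \<comment> \<open>The list depends on \<open>x\<close> alone, so all points over \<open>x\<close>
    undergo the same operators. This uniformity lets equivariance and independence of the starting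
    point be checked factor by factor.\<close>
  have "\<exists>zs. (\<forall>(V, \<mu>)\<in>set zs. openin M V \<and> good V \<and> x \<in> V \<and>
        continuous_map M (top_of_set {0..1}) \<mu>) \<and> (\<exists>(V, \<mu>)\<in>set zs. \<mu> x = 1) \<and>
      (\<forall>y\<in>topspace Y. b y = x \<longrightarrow> \<Phi> y = fold (\<lambda>(V, \<mu>). T V \<mu>) zs y)"
    if x: "x \<in> topspace M" for x
  proof -
    define J where "J = {V \<in> \<V>. x \<in> D V}"
    obtain N where N: "x \<in> N" "finite {V \<in> \<V>. D V \<inter> N \<noteq> {}}" using fin[OF x] by blast
    have "J \<subseteq> {V \<in> \<V>. D V \<inter> N \<noteq> {}}" using N by (auto simp: J_def)
    then have LJ: "set (L J) = J" using N finite_subset L(1) by blast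
    have fold_eq: "fold T' xs y = fold (\<lambda>(V, \<mu>). T V \<mu>) (map (\<lambda>V. (V, \<mu> V)) xs) y"
      if "set xs \<subseteq> J" "y \<in> topspace Y" "b y = x" for xs y
      using that
    proof (induction xs arbitrary: y)
      case (Cons V xs)
      then have "V \<in> \<V>" "b y \<in> V" using D by (auto simp: J_def)
      then have "T' V y = T V (\<mu> V) y" by (simp add: T'_def)
      moreover have "T' V y \<in> topspace Y" "b (T' V y) = x"
        using Cons.prems \<open>V \<in> \<V>\<close> T'_in bT' by auto
      ultimately show ?case using Cons.IH[of "T' V y"] Cons.prems by simp
    qed simp
    obtain V where V1: "V \<in> \<V>" "\<mu> V x = 1" using \<mu>1 x by auto
    then have "V \<in> J" using \<mu>0 x by (force simp: J_def)
    have "\<Phi> y = fold (\<lambda>(V, \<mu>). T V \<mu>) (map (\<lambda>V. (V, \<mu> V)) (L J)) y"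
      if "y \<in> topspace Y" "b y = x" for y
      using fold_eq[of "L J" y] LJ that by (simp add: \<Phi>_def locally_finite_fold_def J_def)
    moreover have "\<exists>(V, \<mu>)\<in>set (map (\<lambda>V. (V, \<mu> V)) (L J)). \<mu> x = 1"
      using \<open>V \<in> J\<close> V1 LJ by force
    moreover have "\<forall>(V, \<mu>)\<in>set (map (\<lambda>V. (V, \<mu> V)) (L J)). openin M V \<and> good V \<and> x \<in> V \<and>
        continuous_map M (top_of_set {0..1}) \<mu>"
      using LJ V \<mu> D by (auto simp: J_def)
    ultimately show ?thesis by blast
  qed
  with \<Phi>_cont show ?thesis by blast
qed

text \<open>Over the base itself a homotopy inverse of \<open>p\<close> is a section
  \<open>\<sigma>\<close>, and the homotopy between \<open>\<sigma> \<circ> p\<close> and the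
  identity contracts each fibre of \<open>p\<close> to its point on the section.\<close>

lemma homotopy_equivalence_over_base:
  assumes "homotopy_equivalence_over X p Y id p"
  obtains \<sigma> k where "continuous_map Y X \<sigma>" "\<forall>y\<in>topspace Y. p (\<sigma> y) = y"
    "continuous_map (prod_topology X (top_of_set {0..1::real})) X (\<lambda>(x, s). k x s)"
    "\<forall>x\<in>topspace X. k x 0 = x" "\<forall>x\<in>topspace X. k x 1 = \<sigma> (p x)"
    "\<forall>x\<in>topspace X. \<forall>s\<in>{0..1}. p (k x s) = p x"
proof -
  obtain \<sigma> where \<sigma>: "continuous_map Y X \<sigma>" "map_over Y id p \<sigma>"
    and hom: "homotopic_with (map_over X p p) X X (\<sigma> \<circ> p) id"
    using assms unfolding homotopy_equivalence_over_def by blast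
  obtain h where h: "continuous_map (prod_topology (top_of_set {0..1::real}) X) X h"
    "\<And>x. h (0, x) = (\<sigma> \<circ> p) x" "\<And>x. h (1, x) = id x"
    "\<And>s. s \<in> {0..1} \<Longrightarrow> map_over X p p (\<lambda>x. h (s, x))"
    using hom unfolding homotopic_with_def by blast
  \<comment> \<open>The given homotopy ends at the identity; \<open>1 - s\<close> reverses it, so
    that strength 0 will mean no change.\<close>
  have "continuous_map (prod_topology X (top_of_set {0..1::real})) (top_of_set {0..1}) (\<lambda>z. 1 - snd z)"
    by (intro continuous_map_into_subtopology continuous_intros)
      (auto intro!: continuous_map_into_fulltopology[OF continuous_map_snd])
  then have "continuous_map (prod_topology X (top_of_set {0..1::real})) X (\<lambda>z. h (1 - snd z, fst z))"
    by (intro continuous_map_compose'[OF h(1)] continuous_map_pairedI continuous_map_fst)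
  then show thesis
    using \<sigma> h by (intro that[of \<sigma> "\<lambda>x s. h (1 - s, x)"]) (auto simp: map_over_def case_prod_unfold)
qed

section \<open>Equivariant maps into a contractible bibundle\<close>

locale bibundle_contraction = P: bibundle_over C M P + E: bibundle_over C B E
  for C :: "('g, 'h) crossed_data" and M :: "'m topology" and P :: "('p, 'm, 'g, 'h) bibundle_data"
    and B :: "'b topology" and E :: "('e, 'b, 'g, 'h) bibundle_data" +
  fixes \<sigma> :: "'h \<Rightarrow> 'e" and k :: "'e \<Rightarrow> real \<Rightarrow> 'e"
  assumes M: "paracompact_space M"
    and \<sigma>: "continuous_map (topH C) (tot E) \<sigma>"
    and str_\<sigma>: "\<And>h. h \<in> carrier (grpH C) \<Longrightarrow> str E (\<sigma> h) = h"
    and k: "continuous_map (prod_topology (tot E) (top_of_set {0..1})) (tot E) (\<lambda>(e, s). k e s)"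
    and k_0: "\<And>e. e \<in> topspace (tot E) \<Longrightarrow> k e 0 = e"
    and k_1: "\<And>e. e \<in> topspace (tot E) \<Longrightarrow> k e 1 = \<sigma> (str E e)"
    and str_k: "\<And>e s. e \<in> topspace (tot E) \<Longrightarrow> s \<in> {0..1} \<Longrightarrow> str E (k e s) = str E e"
begin

text \<open>The fibre product of \<open>P\<close> and \<open>E\<close> over \<open>H\<close>, times
  the interval of strengths. Keeping \<open>e\<close> as a free variable treats all candidate values
  of a map at \<open>p\<close> simultaneously, and keeping \<open>s\<close> as a coordinate makes
  the glued operator jointly continuous in the strength.\<close>

definition Y :: "('p \<times> 'e \<times> real) topology" where
  "Y = subtopology (prod_topology (tot P) (prod_topology (tot E) (top_of_set {0..1})))
     {(p, e, s). str P p = str E e}"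

lemma topspace_Y: "(p, e, s) \<in> topspace Y \<longleftrightarrow>
    p \<in> topspace (tot P) \<and> e \<in> topspace (tot E) \<and> 0 \<le> s \<and> s \<le> 1 \<and> str P p = str E e"
  by (auto simp: Y_def)

lemma continuous_map_Y:
  "continuous_map Y (tot P) fst"
  "continuous_map Y (tot E) (\<lambda>y. fst (snd y))"
  "continuous_map Y (top_of_set {0..1}) (\<lambda>y. snd (snd y))"
  unfolding Y_def
  by (intro continuous_map_from_subtopology continuous_map_fst,
      intro continuous_map_from_subtopology continuous_map_compose'[OF continuous_map_fst continuous_map_snd],
      intro continuous_map_from_subtopology continuous_map_compose'[OF continuous_map_snd continuous_map_snd])

lemma continuous_map_k:
  assumes "continuous_map X (tot E) f" "continuous_map X (top_of_set {0..1}) s"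
  shows "continuous_map X (tot E) (\<lambda>x. k (f x) (s x))"
  using continuous_map_compose'[OF k continuous_map_pairedI[OF assms]] by simp

lemma k_closed: "e \<in> topspace (tot E) \<Longrightarrow> s \<in> {0..1} \<Longrightarrow> k e s \<in> topspace (tot E)"
  using continuous_map_image[OF k, of "(e, s)"] by simp

definition is_section :: "'m set \<Rightarrow> ('m \<Rightarrow> 'p) \<Rightarrow> bool" where
  "is_section V r \<longleftrightarrow> continuous_map (subtopology M V) (tot P) r \<and> (\<forall>u\<in>V. prj P (r u) = u)"

text \<open>A section fixed by choice, so that the operator over \<open>V\<close> is determined by
  \<open>V\<close> and the bump function, as the gluing requires.\<close>

definition sec :: "'m set \<Rightarrow> 'm \<Rightarrow> 'p" where
  "sec V = (SOME r. is_section V r)"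

definition coord :: "'m set \<Rightarrow> 'p \<Rightarrow> 'g" where
  "coord V p = bundle_div C P (sec V (prj P p)) p"

text \<open>The contraction of \<open>E\<close> over \<open>H\<close> is not equivariant; conjugating it by the coordinate of
  \<open>p\<close> makes it so.\<close>

definition contract :: "'m set \<Rightarrow> 'p \<Rightarrow> 'e \<Rightarrow> real \<Rightarrow> 'e" where
  "contract V p e s = ract E (k (ract E e (inv\<^bsub>P.G\<^esub> coord V p)) s) (coord V p)"

text \<open>The coordinate \<open>s\<close> scales every bump function by the same factor: all steps
  are trivial at \<open>s = 0\<close> and act with their own strength at
  \<open>s = 1\<close>.\<close>

definition step :: "'m set \<Rightarrow> ('m \<Rightarrow> real) \<Rightarrow> 'p \<times> 'e \<times> real \<Rightarrow> 'p \<times> 'e \<times> real" where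
  "step V \<mu> = (\<lambda>(p, e, s). (p, contract V p e (s * \<mu> (prj P p)), s))"

context
  fixes V assumes V: "openin M V" "\<exists>r. is_section V r"
begin

lemma is_section_sec: "is_section V (sec V)"
  unfolding sec_def using V(2) by (rule someI_ex)

lemma sec_in: "u \<in> V \<Longrightarrow> sec V u \<in> topspace (tot P)" and prj_sec: "u \<in> V \<Longrightarrow> prj P (sec V u) = u"
  using is_section_sec V(1) openin_subset continuous_map_image[of "subtopology M V" "tot P" "sec V" u]
  by (auto simp: is_section_def)

lemma coord_closed: "p \<in> topspace (tot P) \<Longrightarrow> prj P p \<in> V \<Longrightarrow> coord V p \<in> carrier P.G"
  unfolding coord_def by (intro P.bundle_div_closed sec_in) (simp_all add: prj_sec)

lemma coord_act: "p \<in> topspace (tot P) \<Longrightarrow> prj P p \<in> V \<Longrightarrow> g \<in> carrier P.G \<Longrightarrow>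
    coord V (ract P p g) = coord V p \<otimes>\<^bsub>P.G\<^esub> g"
  unfolding coord_def by (simp add: P.prj_act P.bundle_div_act_act sec_in prj_sec)

lemma contract_closed:
  assumes "p \<in> topspace (tot P)" "prj P p \<in> V" "e \<in> topspace (tot E)" "s \<in> {0..1}"
  shows "contract V p e s \<in> topspace (tot E)" and "str E (contract V p e s) = str E e"
proof -
  note c = coord_closed[OF assms(1,2)]
  have 1: "ract E e (inv\<^bsub>P.G\<^esub> coord V p) \<in> topspace (tot E)"
    using assms c by (simp add: E.act_closed)
  then show "contract V p e s \<in> topspace (tot E)"
    using assms(4) c unfolding contract_def by (intro E.act_closed[OF k_closed])
  have "str E (contract V p e s) = str E e \<otimes>\<^bsub>P.H\<^esub> bdry C (inv\<^bsub>P.G\<^esub> coord V p) \<otimes>\<^bsub>P.H\<^esub> bdry C (coord V p)"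
    unfolding contract_def using 1 assms c by (simp add: E.str_act str_k k_closed)
  also have "\<dots> = str E e"
    using E.str_closed[OF assms(3)] c by (simp add: P.H.m_assoc)
  finally show "str E (contract V p e s) = str E e" .
qed

lemma contract_0:
  assumes "p \<in> topspace (tot P)" "prj P p \<in> V" "e \<in> topspace (tot E)"
  shows "contract V p e 0 = e"
  using assms coord_closed[OF assms(1,2)] by (simp add: contract_def k_0 E.act_closed E.act_inv)

text \<open>At time 1 the map \<open>k\<close> factors through the structure map, and translating
  \<open>e\<close> and \<open>e'\<close> by the same group element keeps their structure values
  equal.\<close>

lemma contract_1:
  assumes "p \<in> topspace (tot P)" "prj P p \<in> V" "e \<in> topspace (tot E)" "e' \<in> topspace (tot E)"
    "str E e = str E e'"
  shows "contract V p e 1 = contract V p e' 1"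
  using assms coord_closed[OF assms(1,2)] by (simp add: contract_def k_1 E.act_closed E.str_act)

text \<open>The coordinate of the translate of \<open>p\<close> by \<open>g\<close> is that of
  \<open>p\<close> times \<open>g\<close>. Dividing the translate of \<open>e\<close> by it
  therefore leads to the same point as before, to which \<open>k\<close> is applied; only the final
  multiplication by the coordinate produces the extra \<open>g\<close>.\<close>

lemma contract_act:
  assumes "p \<in> topspace (tot P)" "prj P p \<in> V" "e \<in> topspace (tot E)" "s \<in> {0..1}"
    "g \<in> carrier P.G"
  shows "contract V (ract P p g) (ract E e g) s = ract E (contract V p e s) g"
proof -
  note c = coord_closed[OF assms(1,2)]
  have "ract E (ract E e g) (inv\<^bsub>P.G\<^esub> (coord V p \<otimes>\<^bsub>P.G\<^esub> g)) = ract E e (inv\<^bsub>P.G\<^esub> coord V p)"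
    using c assms by (simp add: P.G.inv_mult_group E.act_mult E.act_closed E.act_inv)
  then show ?thesis
    using c assms by (simp add: contract_def coord_act E.act_mult k_closed E.act_closed)
qed

lemma continuous_map_step:
  assumes \<mu>: "continuous_map M (top_of_set {0..1}) \<mu>"
  shows "continuous_map (subtopology Y {y \<in> topspace Y. prj P (fst y) \<in> V}) Y (step V \<mu>)"
    (is "continuous_map ?Z Y _")
proof -
  note Z = continuous_map_Y[THEN continuous_map_from_subtopology]
  have prj: "continuous_map ?Z M (\<lambda>y. prj P (fst y))"
    by (rule continuous_map_compose'[OF P.continuous_map_prj Z(1)])
  then have prj': "continuous_map ?Z (subtopology M V) (\<lambda>y. prj P (fst y))"
    by (rule continuous_map_into_subtopology) auto
  have "continuous_map (subtopology M V) (tot P) (sec V)"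
    using is_section_sec by (simp add: is_section_def)
  then have sec: "continuous_map ?Z (tot P) (\<lambda>y. sec V (prj P (fst y)))"
    using prj' by (rule continuous_map_compose')
  have coord: "continuous_map ?Z (topG C) (\<lambda>y. coord V (fst y))"
    unfolding coord_def by (intro P.continuous_map_bundle_div sec Z(1)) (auto simp: prj_sec)
  have s\<mu>: "continuous_map ?Z (top_of_set {0..1}) (\<lambda>y. snd (snd y) * \<mu> (prj P (fst y)))"
  proof (rule continuous_map_into_subtopology)
    have 1: "continuous_map ?Z (top_of_set {0..1}) (\<lambda>y. \<mu> (prj P (fst y)))"
      by (rule continuous_map_compose'[OF \<mu> prj])
    show "continuous_map ?Z euclidean (\<lambda>y. snd (snd y) * \<mu> (prj P (fst y)))"
      by (rule continuous_map_real_mult[OF continuous_map_into_fulltopology[OF Z(3)]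
            continuous_map_into_fulltopology[OF 1]])
    show "(\<lambda>y. snd (snd y) * \<mu> (prj P (fst y))) \<in> topspace ?Z \<rightarrow> {0..1}"
      using continuous_map_image[OF 1] continuous_map_image[OF Z(3)]
      by (auto simp: mult_le_one Pi_iff)
  qed
  have "continuous_map ?Z (tot E)
      (\<lambda>y. contract V (fst y) (fst (snd y)) (snd (snd y) * \<mu> (prj P (fst y))))"
    unfolding contract_def
    by (intro E.continuous_map_act continuous_map_k P.G.continuous_map_inv coord s\<mu> Z(2))
  then have "continuous_map ?Z (prod_topology (tot P) (prod_topology (tot E) (top_of_set {0..1}))) (step V \<mu>)"
    unfolding step_def case_prod_unfold by (intro continuous_map_pairedI Z)
  moreover have "step V \<mu> y \<in> {(p, e, s). str P p = str E e}" if "y \<in> topspace ?Z" for y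
  proof -
    obtain p e s where y: "y = (p, e, s)" by (cases y)
    have "s * \<mu> (prj P p) \<in> {0..1}" using continuous_map_image[OF s\<mu> that] y by simp
    then show ?thesis
      using that y contract_closed(2)[of p e "s * \<mu> (prj P p)"] by (simp add: step_def topspace_Y)
  qed
  ultimately show ?thesis
    unfolding Y_def by (intro continuous_map_into_subtopology) (auto simp: Y_def)
qed

end

section \<open>Composites of contraction steps over one base point\<close>

definition step_data :: "'m \<Rightarrow> ('m set \<times> ('m \<Rightarrow> real)) list \<Rightarrow> bool" where
  "step_data x zs \<longleftrightarrow> (\<forall>(V, \<mu>)\<in>set zs. openin M V \<and> (\<exists>r. is_section V r) \<and> x \<in> V \<and>
     continuous_map M (top_of_set {0..1}) \<mu>)"

abbreviation "steps \<equiv> fold (\<lambda>(V, \<mu>). step V \<mu>)"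

lemma step_data_simps:
  "step_data x (z # zs) \<longleftrightarrow> openin M (fst z) \<and> (\<exists>r. is_section (fst z) r) \<and> x \<in> fst z \<and>
     continuous_map M (top_of_set {0..1}) (snd z) \<and> step_data x zs"
  "step_data x (zs @ zs') \<longleftrightarrow> step_data x zs \<and> step_data x zs'"
  by (auto simp: step_data_def case_prod_unfold)

lemma step_in:
  assumes "openin M V" "\<exists>r. is_section V r" "x \<in> V" "continuous_map M (top_of_set {0..1}) \<mu>"
    and "(p, e, s) \<in> topspace Y" "prj P p = x"
  shows "\<exists>e'. step V \<mu> (p, e, s) = (p, e', s) \<and> (p, e', s) \<in> topspace Y"
proof -
  have "(p, e, s) \<in> topspace (subtopology Y {y \<in> topspace Y. prj P (fst y) \<in> V})" using assms by simp
  from continuous_map_image[OF continuous_map_step[OF assms(1,2,4)] this]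
  show ?thesis by (simp add: step_def)
qed

lemma steps_in:
  assumes "step_data x zs" "(p, e, s) \<in> topspace Y" "prj P p = x"
  shows "\<exists>e'. steps zs (p, e, s) = (p, e', s) \<and> (p, e', s) \<in> topspace Y"
  using assms
proof (induction zs arbitrary: e)
  case (Cons z zs)
  obtain V \<mu> where z: "z = (V, \<mu>)" by (cases z)
  obtain e' where "step V \<mu> (p, e, s) = (p, e', s)" "(p, e', s) \<in> topspace Y"
    using step_in[of V x \<mu> p e s] Cons.prems z by (auto simp: step_data_simps)
  then show ?case using Cons.IH[of e'] Cons.prems z by (simp add: step_data_simps)
qed simp

lemma strength:
  assumes "continuous_map M (top_of_set {0..1}) \<mu>" "(p, e, s) \<in> topspace Y"
  shows "s * \<mu> (prj P p) \<in> {0..1::real}"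
  using continuous_map_image[OF assms(1), of "prj P p"] assms(2) P.prj_in
  by (auto simp: topspace_Y mult_le_one)

lemma steps_act:
  assumes "step_data x zs" "(p, e, s) \<in> topspace Y" "prj P p = x" "g \<in> carrier P.G"
    and "steps zs (p, e, s) = (p, e', s)"
  shows "steps zs (ract P p g, ract E e g, s) = (ract P p g, ract E e' g, s)"
  using assms
proof (induction zs arbitrary: e)
  case (Cons z zs)
  obtain V \<mu> where z: "z = (V, \<mu>)" by (cases z)
  note V = Cons.prems(1)[unfolded z step_data_simps fst_conv snd_conv]
  obtain e1 where e1: "step V \<mu> (p, e, s) = (p, e1, s)" "(p, e1, s) \<in> topspace Y"
    using step_in[of V x \<mu> p e s] Cons.prems V by blast
  then have "e1 = contract V p e (s * \<mu> (prj P p))" by (simp add: step_def)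
  then have "step V \<mu> (ract P p g, ract E e g, s) = (ract P p g, ract E e1 g, s)"
    using V Cons.prems contract_act[of V p e "s * \<mu> (prj P p)" g] strength[of \<mu> p e s]
    by (simp add: step_def P.prj_act topspace_Y)
  then show ?case using Cons.IH[of e1] Cons.prems z e1 V by simp
qed simp

lemma steps_0:
  assumes "step_data x zs" "(p, e, 0) \<in> topspace Y" "prj P p = x"
  shows "steps zs (p, e, 0) = (p, e, 0)"
  using assms
proof (induction zs)
  case (Cons z zs)
  then have "step (fst z) (snd z) (p, e, 0) = (p, e, 0)"
    using contract_0[of "fst z" p e] by (auto simp: step_def step_data_simps topspace_Y)
  then show ?case using Cons by (simp add: step_data_simps case_prod_unfold)
qed simp

text \<open>The steps before the one of full strength may move \<open>e\<close> and
  \<open>e'\<close> differently, but both stay over the same element of \<open>H\<close>. The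
  full-strength step identifies them, and later steps keep equal points equal.\<close>

lemma steps_1:
  assumes zs: "step_data x zs" and z: "(V, \<mu>) \<in> set zs" "\<mu> x = 1"
    and y: "(p, e, 1) \<in> topspace Y" "(p, e', 1) \<in> topspace Y" "prj P p = x"
  shows "steps zs (p, e, 1) = steps zs (p, e', 1)"
proof -
  obtain as bs where ab: "zs = as @ (V, \<mu>) # bs" using z(1) by (meson split_list)
  note V = zs[unfolded ab step_data_simps fst_conv snd_conv]
  obtain a where a: "steps as (p, e, 1) = (p, a, 1)" "(p, a, 1) \<in> topspace Y"
    using steps_in[of x as p e 1] V y by blast
  obtain a' where a': "steps as (p, e', 1) = (p, a', 1)" "(p, a', 1) \<in> topspace Y"
    using steps_in[of x as p e' 1] V y by blast
  have "step V \<mu> (p, a, 1) = step V \<mu> (p, a', 1)"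
    using contract_1[of V p a a'] V a a' y z by (simp add: step_def topspace_Y)
  then show ?thesis by (simp add: ab a a')
qed

text \<open>Strength 1 forgets \<open>e\<close>, which yields a distinguished equivariant map;
  inserting \<open>F p\<close> for \<open>e\<close> and letting \<open>s\<close> run joins any
  equivariant \<open>F\<close> over \<open>H\<close> to it.\<close>

lemma equivariant_contraction:
  obtains R where "continuous_map Y (tot E) (\<lambda>(p, e, s). R p e s)"
    "\<forall>p e s. (p, e, s) \<in> topspace Y \<longrightarrow> str E (R p e s) = str P p"
    "\<forall>p e s. (p, e, s) \<in> topspace Y \<longrightarrow>
      (\<forall>g\<in>carrier P.G. R (ract P p g) (ract E e g) s = ract E (R p e s) g)"
    "\<forall>p e. (p, e, 0) \<in> topspace Y \<longrightarrow> R p e 0 = e"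
    "\<forall>p e e'. (p, e, 1) \<in> topspace Y \<longrightarrow> (p, e', 1) \<in> topspace Y \<longrightarrow> R p e 1 = R p e' 1"
proof -
  have cov: "\<exists>U. openin M U \<and> x \<in> U \<and> (\<exists>r. is_section U r)" if x: "x \<in> topspace M" for x
  proof -
    obtain U r where "openin M U" "x \<in> U" "continuous_map (subtopology M U) (tot P) r"
      "\<forall>u\<in>U. prj P (r u) = u" by (rule P.local_section[OF x])
    then show ?thesis by (intro exI[of _ U] conjI exI[of _ r]) (simp_all add: is_section_def)
  qed
  have mono: "\<exists>r. is_section V r" if U: "\<exists>r. is_section U r" and VU: "V \<subseteq> U" for U V
  proof -
    obtain r where "is_section U r" using U by blast
    then have "is_section V r"
      using VU continuous_map_from_subtopology_mono[OF _ VU, of M "tot P" r]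
      by (auto simp: is_section_def)
    then show ?thesis by blast
  qed
  have b: "continuous_map Y M (\<lambda>y. prj P (fst y))"
    by (rule continuous_map_compose'[OF P.continuous_map_prj continuous_map_Y(1)])
  have id: "step V \<mu> y = y"
    if "openin M V" "\<exists>r. is_section V r" "continuous_map M (top_of_set {0..1}) \<mu>"
      "y \<in> topspace Y" "prj P (fst y) \<in> V" "\<mu> (prj P (fst y)) = 0" for V \<mu> y
    using contract_0[OF that(1,2), of "fst y" "fst (snd y)"] that(4-)
    by (cases y) (auto simp: step_def topspace_Y)
  have bstep: "prj P (fst (step V \<mu> y)) = prj P (fst y)" for V \<mu> y
    by (simp add: step_def case_prod_unfold)
  have "\<exists>\<Phi>. continuous_map Y Y \<Phi> \<and>
    (\<forall>x\<in>topspace M. \<exists>zs. (\<forall>(V, \<mu>)\<in>set zs. openin M V \<and> (\<exists>r. is_section V r) \<and> x \<in> V \<and>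
        continuous_map M (top_of_set {0..1}) \<mu>) \<and> (\<exists>(V, \<mu>)\<in>set zs. \<mu> x = 1) \<and>
      (\<forall>y\<in>topspace Y. prj P (fst y) = x \<longrightarrow> \<Phi> y = steps zs y))"
    using M cov mono b continuous_map_step bstep id by (rule glue_local_operators)
  then obtain \<Phi> where \<Phi>: "continuous_map Y Y \<Phi>"
    and \<Phi>': "\<forall>x\<in>topspace M. \<exists>zs. (\<forall>(V, \<mu>)\<in>set zs. openin M V \<and> (\<exists>r. is_section V r) \<and>
        x \<in> V \<and> continuous_map M (top_of_set {0..1}) \<mu>) \<and> (\<exists>(V, \<mu>)\<in>set zs. \<mu> x = 1) \<and>
      (\<forall>y\<in>topspace Y. prj P (fst y) = x \<longrightarrow> \<Phi> y = steps zs y)"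
    by (elim exE conjE) (rule that)
  have *: "\<exists>zs. step_data x zs \<and> (\<exists>V \<mu>. (V, \<mu>) \<in> set zs \<and> \<mu> x = 1) \<and>
      (\<forall>y\<in>topspace Y. prj P (fst y) = x \<longrightarrow> \<Phi> y = steps zs y)" if x: "x \<in> topspace M" for x
  proof -
    from bspec[OF \<Phi>' x] obtain zs where zs: "\<forall>(V, \<mu>)\<in>set zs. openin M V \<and> (\<exists>r. is_section V r) \<and>
        x \<in> V \<and> continuous_map M (top_of_set {0..1}) \<mu>" and "\<exists>(V, \<mu>)\<in>set zs. \<mu> x = 1"
      and \<Phi>zs: "\<forall>y\<in>topspace Y. prj P (fst y) = x \<longrightarrow> \<Phi> y = steps zs y"
      by (elim exE conjE) (rule that)
    then have "\<exists>V \<mu>. (V, \<mu>) \<in> set zs \<and> \<mu> x = 1" by auto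
    moreover have "step_data x zs" unfolding step_data_def by (rule zs)
    ultimately show ?thesis using \<Phi>zs by (intro exI[of _ zs] conjI)
  qed
  have zs: "\<exists>zs V \<mu>. step_data (prj P p) zs \<and> (V, \<mu>) \<in> set zs \<and> \<mu> (prj P p) = 1 \<and>
      (\<forall>q e s. (q, e, s) \<in> topspace Y \<longrightarrow> prj P q = prj P p \<longrightarrow> \<Phi> (q, e, s) = steps zs (q, e, s))"
    if p: "p \<in> topspace (tot P)" for p
  proof -
    obtain zs V \<mu> where "step_data (prj P p) zs" "(V, \<mu>) \<in> set zs" "\<mu> (prj P p) = 1"
      "\<forall>y\<in>topspace Y. prj P (fst y) = prj P p \<longrightarrow> \<Phi> y = steps zs y"
      using *[OF P.prj_in[OF p]] by blast
    then show ?thesis by (intro exI[of _ zs] exI[of _ V] exI[of _ \<mu>]) auto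
  qed
  define R where "R p e s = fst (snd (\<Phi> (p, e, s)))" for p e s
  have \<Phi>R: "\<Phi> (p, e, s) = (p, R p e s, s)" and R_in: "(p, R p e s, s) \<in> topspace Y"
    if y: "(p, e, s) \<in> topspace Y" for p e s
  proof -
    have "p \<in> topspace (tot P)" using y by (simp add: topspace_Y)
    from zs[OF this] obtain zs where "step_data (prj P p) zs" "\<Phi> (p, e, s) = steps zs (p, e, s)"
      using y by blast
    then obtain e' where e': "\<Phi> (p, e, s) = (p, e', s)" "(p, e', s) \<in> topspace Y"
      using steps_in[of "prj P p" zs p e s] y by auto
    then show "\<Phi> (p, e, s) = (p, R p e s, s)" "(p, R p e s, s) \<in> topspace Y"
      by (simp_all add: R_def)
  qed
  show thesis
  proof (rule that[of R])
    show "continuous_map Y (tot E) (\<lambda>(p, e, s). R p e s)"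
      using continuous_map_compose'[OF continuous_map_Y(2) \<Phi>] by (simp add: R_def case_prod_unfold)
    show "\<forall>p e s. (p, e, s) \<in> topspace Y \<longrightarrow> str E (R p e s) = str P p"
      using R_in by (simp add: topspace_Y)
    show "\<forall>p e s. (p, e, s) \<in> topspace Y \<longrightarrow>
      (\<forall>g\<in>carrier P.G. R (ract P p g) (ract E e g) s = ract E (R p e s) g)"
    proof (intro allI impI ballI)
      fix p e s g assume y: "(p, e, s) \<in> topspace Y" and g: "g \<in> carrier P.G"
      then have p: "p \<in> topspace (tot P)" and y': "(ract P p g, ract E e g, s) \<in> topspace Y"
        by (simp_all add: topspace_Y P.act_closed E.act_closed P.str_act E.str_act)
      obtain zs where z: "step_data (prj P p) zs" "\<forall>q e s. (q, e, s) \<in> topspace Y \<longrightarrow>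
          prj P q = prj P p \<longrightarrow> \<Phi> (q, e, s) = steps zs (q, e, s)"
        using zs[OF p] by blast
      have "steps zs (p, e, s) = (p, R p e s, s)" using z(2) y \<Phi>R by simp
      from steps_act[OF z(1) y refl g this]
      show "R (ract P p g) (ract E e g) s = ract E (R p e s) g"
        using z(2) y' \<Phi>R[OF y'] P.prj_act[OF p g] by simp
    qed
    show "\<forall>p e. (p, e, 0) \<in> topspace Y \<longrightarrow> R p e 0 = e"
    proof (intro allI impI)
      fix p e assume y: "(p, e, 0) \<in> topspace Y"
      then have "p \<in> topspace (tot P)" by (simp add: topspace_Y)
      from zs[OF this] obtain zs where "step_data (prj P p) zs" "\<Phi> (p, e, 0) = steps zs (p, e, 0)"
        using y by blast
      then show "R p e 0 = e" using steps_0[of "prj P p" zs p e] y by (simp add: R_def)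
    qed
    show "\<forall>p e e'. (p, e, 1) \<in> topspace Y \<longrightarrow> (p, e', 1) \<in> topspace Y \<longrightarrow> R p e 1 = R p e' 1"
    proof (intro allI impI)
      fix p e e' assume y: "(p, e, 1) \<in> topspace Y" "(p, e', 1) \<in> topspace Y"
      then have "p \<in> topspace (tot P)" by (simp add: topspace_Y)
      from zs[OF this] obtain zs V \<mu> where "step_data (prj P p) zs" "(V, \<mu>) \<in> set zs" "\<mu> (prj P p) = 1"
        "\<Phi> (p, e, 1) = steps zs (p, e, 1)" "\<Phi> (p, e', 1) = steps zs (p, e', 1)"
        using y by blast
      then show "R p e 1 = R p e' 1" using steps_1[of "prj P p" zs V \<mu> p e e'] y by (simp add: R_def)
    qed
  qed
qed

end

section \<open>Transport along a homotopy of constant type\<close>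

context crossed_mod
begin

text \<open>\<open>\<omega>\<close> is the inverse of the homeomorphism from \<open>G\<close> modulo
  the kernel of \<open>t\<close> to \<open>t(G)\<close>, followed by a local section near the coset
  of the unit. A neighbourhood of the unit of \<open>H\<close> suffices, because only quotients of
  nearby structure values will be lifted.\<close>

lemma bdry_local_lift:
  assumes "standing_assumptions C"
  obtains W \<omega> where "openin (topH C) W" "\<one>\<^bsub>H\<^esub> \<in> W"
    "continuous_map (subtopology (topH C) (W \<inter> bdry_image C)) (topG C) \<omega>"
    "\<forall>w\<in>W \<inter> bdry_image C. t (\<omega> w) = w"
proof -
  let ?Q = "quotient_topology (topG C) (projG C)"
  let ?S = "subtopology (topH C) (bdry_image C)"
  define \<theta> where "\<theta> X = the_elem (t ` X)" for X
  have sec: "admits_local_sections (topG C) ?Q (projG C)" and \<theta>: "homeomorphic_map ?Q ?S \<theta>"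
    using assms unfolding standing_assumptions_def \<theta>_def by simp_all
  have Q1: "projG C \<one>\<^bsub>G\<^esub> \<in> topspace ?Q"
    by (auto simp: topspace_quotient_topology G.topspace_eq_carrier)
  obtain U s where U: "openin ?Q U" "projG C \<one>\<^bsub>G\<^esub> \<in> U"
    and s: "continuous_map (subtopology ?Q U) (topG C) s" and ps: "\<forall>u\<in>U. projG C (s u) = u"
    using bspec[OF sec[unfolded admits_local_sections_def] Q1] by (elim exE conjE) (rule that)
  \<comment> \<open>\<open>t\<close> is constant on cosets of its kernel, so \<open>the_elem\<close>
    returns its common value.\<close>
  have \<theta>proj: "\<theta> (projG C g) = t g" if g: "g \<in> carrier G" for g
  proof -
    have "t ` projG C g = {t g}"
      unfolding projG_def bdry_kernel_def r_coset_def kernel_def using g by auto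
    then show ?thesis by (simp add: \<theta>_def)
  qed
  obtain \<theta>' where \<theta>': "homeomorphic_maps ?Q ?S \<theta> \<theta>'" using \<theta> homeomorphic_map_maps by blast
  have UQ: "U \<subseteq> topspace ?Q" using U(1) by (rule openin_subset)
  have s_in: "s u \<in> carrier G" if "u \<in> U" for u
    using G.continuous_map_carrier[OF s, of u] that UQ by auto
  have "openin ?S (\<theta> ` U)" using \<theta> U(1) UQ homeomorphic_map_openness_eq by blast
  then obtain W where W: "openin (topH C) W" "\<theta> ` U = W \<inter> bdry_image C"
    by (auto simp: openin_subtopology)
  have inv: "\<theta>' w \<in> U \<and> \<theta> (\<theta>' w) = w" if "w \<in> W \<inter> bdry_image C" for w
    using that W(2) \<theta>' UQ unfolding homeomorphic_maps_def by (metis imageE subsetD)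
  show thesis
  proof (rule that[of W "\<lambda>w. s (\<theta>' w)"])
    have "t \<one>\<^bsub>G\<^esub> \<in> \<theta> ` U" using U(2) \<theta>proj[OF G.one_closed] by (metis imageI)
    then show "\<one>\<^bsub>H\<^esub> \<in> W" using W(2) by simp
    have "continuous_map (subtopology (topH C) (W \<inter> bdry_image C)) ?Q \<theta>'"
      using \<theta>' unfolding homeomorphic_maps_def
      by (elim conjE) (erule continuous_map_from_subtopology_mono, blast)
    then have "continuous_map (subtopology (topH C) (W \<inter> bdry_image C)) (subtopology ?Q U) \<theta>'"
      by (rule continuous_map_into_subtopology) (use inv in auto)
    then show "continuous_map (subtopology (topH C) (W \<inter> bdry_image C)) (topG C) (\<lambda>w. s (\<theta>' w))"
      by (rule continuous_map_compose'[OF s])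
    show "\<forall>w\<in>W \<inter> bdry_image C. t (s (\<theta>' w)) = w"
      using inv s_in ps \<theta>proj by metis
  qed (rule W(1))
qed

text \<open>\<open>projH\<close> is formed with right cosets, but the structure map changes by
  factors \<open>t g\<close> on the right; normality of \<open>t(G)\<close> moves the discrepancy to
  that side.\<close>

lemma projH_eq_imp:
  assumes "h \<in> carrier H" "h' \<in> carrier H" "projH C h = projH C h'"
  shows "inv\<^bsub>H\<^esub> h \<otimes>\<^bsub>H\<^esub> h' \<in> bdry_image C"
proof -
  interpret N: normal "bdry_image C" H by (rule bdry_image_normal[OF crossed_module])
  have "h' \<in> projH C h'" unfolding projH_def using assms(2) N.subgroup_axioms by (rule H.rcos_self)
  then have "h' \<in> bdry_image C #>\<^bsub>H\<^esub> h" using assms(3) by (simp add: projH_def)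
  then obtain n where n: "n \<in> bdry_image C" "h' = n \<otimes>\<^bsub>H\<^esub> h" by (auto simp: r_coset_def)
  then have "n \<in> carrier H" using N.mem_carrier by blast
  then have "inv\<^bsub>H\<^esub> h \<otimes>\<^bsub>H\<^esub> h' = inv\<^bsub>H\<^esub> h \<otimes>\<^bsub>H\<^esub> n \<otimes>\<^bsub>H\<^esub> h" using assms n by (simp add: H.m_assoc)
  then show ?thesis using N.inv_op_closed1[OF assms(1) n(1)] by simp
qed

end

text \<open>Time ranges over all reals, so that neighbourhoods of times are ordinary open sets of
  reals and the small intervals of a bisection may stick out of \<open>[0, 1]\<close>. A homotopy on
  \<open>[0, 1]\<close> enters by clamping the time.\<close>

locale bibundle_homotopy = E: bibundle_over C B E
  for C :: "('g, 'h) crossed_data" and B :: "'b topology" and E :: "('e, 'b, 'g, 'h) bibundle_data" +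
  fixes M :: "'m topology" and h :: "real \<times> 'm \<Rightarrow> 'b"
  assumes standing: "standing_assumptions C"
    and M: "paracompact_space M"
    and h: "continuous_map (prod_topology euclideanreal M) B h"
    and type_h: "\<And>s s' m. m \<in> topspace M \<Longrightarrow> type_map C E (h (s, m)) = type_map C E (h (s', m))"
begin

abbreviation "X \<equiv> prod_topology euclideanreal M"

definition is_lift :: "real set \<Rightarrow> 'm set \<Rightarrow> (real \<times> 'm \<Rightarrow> 'e) \<Rightarrow> bool" where
  "is_lift A N r \<longleftrightarrow> continuous_map (subtopology X (A \<times> N)) (tot E) r \<and>
     (\<forall>s\<in>A. \<forall>m\<in>N. prj E (r (s, m)) = h (s, m)) \<and>
     (\<forall>s\<in>A. \<forall>s'\<in>A. \<forall>m\<in>N. str E (r (s, m)) = str E (r (s', m)))"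

lemma is_liftD:
  assumes "is_lift A N r"
  shows "continuous_map (subtopology X (A \<times> N)) (tot E) r"
    and "\<And>s m. s \<in> A \<Longrightarrow> m \<in> N \<Longrightarrow> prj E (r (s, m)) = h (s, m)"
    and "\<And>s s' m. s \<in> A \<Longrightarrow> s' \<in> A \<Longrightarrow> m \<in> N \<Longrightarrow> str E (r (s, m)) = str E (r (s', m))"
  using assms unfolding is_lift_def by blast+

lemma is_lift_mono:
  assumes "is_lift A N r" "A' \<subseteq> A" "N' \<subseteq> N"
  shows "is_lift A' N' r"
proof -
  have "A' \<times> N' \<subseteq> A \<times> N" using assms by blast
  then show ?thesis
    using assms continuous_map_from_subtopology_mono[of X "A \<times> N" "tot E" r "A' \<times> N'"]
    unfolding is_lift_def by (simp add: subset_iff)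
qed

lemma is_lift_in:
  "is_lift A N r \<Longrightarrow> N \<subseteq> topspace M \<Longrightarrow> s \<in> A \<Longrightarrow> m \<in> N \<Longrightarrow> r (s, m) \<in> topspace (tot E)"
  using continuous_map_image[of "subtopology X (A \<times> N)" "tot E" r "(s, m)"]
  by (auto simp: is_lift_def)

text \<open>Following \<open>h\<close> by a local section \<open>r\<close> of \<open>E\<close> gives
  a lift whose structure value varies with time. Constancy of the type puts the change into
  \<open>t(G)\<close>; near \<open>(s0, x)\<close> it is close to the unit, lifts through
  \<open>\<omega>\<close>, and acting with that lift makes the structure value constant.\<close>

lemma local_lift:
  assumes x: "x \<in> topspace M"
  shows "\<exists>A N r. open A \<and> s0 \<in> A \<and> openin M N \<and> x \<in> N \<and> is_lift A N r"
proof -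
  obtain U r where U: "openin B U" "h (s0, x) \<in> U" and r: "continuous_map (subtopology B U) (tot E) r"
    and pr: "\<forall>u\<in>U. prj E (r u) = u"
    by (rule E.local_section[of "h (s0, x)"]) (use continuous_map_image[OF h] x in auto)
  obtain W \<omega> where W: "openin (topH C) W" "\<one>\<^bsub>E.H\<^esub> \<in> W"
    and \<omega>: "continuous_map (subtopology (topH C) (W \<inter> bdry_image C)) (topG C) \<omega>"
    and t\<omega>: "\<forall>w\<in>W \<inter> bdry_image C. bdry C (\<omega> w) = w"
    by (rule E.bdry_local_lift[OF standing])
  have r_in: "r u \<in> topspace (tot E)" if "u \<in> U" for u
    using continuous_map_image[OF r, of u] openin_subset[OF U(1)] that by auto
  define h0 where "h0 z = h (s0, snd z)" for z :: "real \<times> 'm"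
  have h0: "continuous_map X B h0"
    unfolding h0_def by (intro continuous_map_compose'[OF h] continuous_map_pairedI continuous_map_snd) auto
  define O2 where "O2 = {z \<in> topspace X. h z \<in> U} \<inter> {z \<in> topspace X. h0 z \<in> U}"
  have O2: "openin X O2" unfolding O2_def
    using openin_continuous_map_preimage[OF h U(1)] openin_continuous_map_preimage[OF h0 U(1)]
    by (rule openin_Int)
  have rh: "continuous_map (subtopology X O2) (tot E) (\<lambda>z. r (h z))"
    by (intro continuous_map_compose'[OF r] continuous_map_into_subtopology
        continuous_map_from_subtopology h) (auto simp: O2_def)
  have rh0: "continuous_map (subtopology X O2) (tot E) (\<lambda>z. r (h0 z))"
    by (intro continuous_map_compose'[OF r] continuous_map_into_subtopology
        continuous_map_from_subtopology h0) (auto simp: O2_def)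
  \<comment> \<open>The right factor still missing from the structure value at time
    \<open>fst z\<close> to reach the one at time \<open>s0\<close>.\<close>
  define q where "q z = inv\<^bsub>E.H\<^esub> str E (r (h z)) \<otimes>\<^bsub>E.H\<^esub> str E (r (h0 z))" for z
  have q: "continuous_map (subtopology X O2) (topH C) q"
    unfolding q_def by (intro E.H.continuous_map_mult E.H.continuous_map_inv
        continuous_map_compose'[OF E.continuous_map_str] rh rh0)
  have O2_U: "h z \<in> U" "h0 z \<in> U" "snd z \<in> topspace M" if "z \<in> O2" for z
    using that by (auto simp: O2_def)
  have q_im: "q z \<in> bdry_image C" if z: "z \<in> O2" for z
  proof -
    have "type_map C E (h z) = type_map C E (h0 z)"
      using type_h[OF O2_U(3)[OF z], of "fst z" s0] by (simp add: h0_def)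
    then have "projH C (str E (r (h z))) = projH C (str E (r (h0 z)))"
      using type_map_eq[OF E.crossed_module E.bibundle r_in] O2_U[OF z] pr by metis
    then show ?thesis
      unfolding q_def using E.str_closed r_in O2_U[OF z] by (intro E.projH_eq_imp) auto
  qed
  define O3 where "O3 = {z \<in> topspace (subtopology X O2). q z \<in> W}"
  have "openin (subtopology X O2) O3"
    unfolding O3_def by (rule openin_continuous_map_preimage[OF q W(1)])
  then have O3: "openin X O3" using O2 openin_trans_full by blast
  have O3_O2: "O3 \<subseteq> O2" by (auto simp: O3_def)
  have "q (s0, x) = \<one>\<^bsub>E.H\<^esub>"
    using E.str_closed[OF r_in[OF U(2)]] by (simp add: q_def h0_def)
  then have in_O3: "(s0, x) \<in> O3" using W(2) U(2) x by (simp add: O3_def O2_def h0_def)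
  obtain A N where AN: "openin euclideanreal A" "openin M N" "s0 \<in> A" "x \<in> N" "A \<times> N \<subseteq> O3"
    using O3[unfolded openin_prod_topology_alt, rule_format, OF in_O3] by (elim exE conjE) (rule that)
  define e where "e z = ract E (r (h z)) (\<omega> (q z))" for z
  have \<omega>_in: "\<omega> (q z) \<in> carrier E.G" and t\<omega>q: "bdry C (\<omega> (q z)) = q z" if "z \<in> O3" for z
  proof -
    have w: "q z \<in> W \<inter> bdry_image C" using that q_im O3_O2 by (auto simp: O3_def)
    then show "bdry C (\<omega> (q z)) = q z" using t\<omega> by blast
    have "q z \<in> topspace (subtopology (topH C) (W \<inter> bdry_image C))"
      using w openin_subset[OF W(1)] by auto
    then show "\<omega> (q z) \<in> carrier E.G" by (rule E.G.continuous_map_carrier[OF \<omega>])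
  qed
  have sub: "A \<times> N \<subseteq> O2" using AN(5) O3_O2 by blast
  have q': "continuous_map (subtopology X (A \<times> N)) (subtopology (topH C) (W \<inter> bdry_image C)) q"
    by (rule continuous_map_into_subtopology[OF continuous_map_from_subtopology_mono[OF q sub]])
      (use AN(5) q_im O3_O2 in \<open>auto simp: O3_def\<close>)
  have "continuous_map (subtopology X (A \<times> N)) (tot E) e"
    unfolding e_def by (intro E.continuous_map_act continuous_map_compose'[OF \<omega> q']
        continuous_map_from_subtopology_mono[OF rh sub])
  moreover have "prj E (e z) = h z" if z: "z \<in> A \<times> N" for z
    using E.prj_act[OF r_in \<omega>_in] pr O2_U(1) sub AN(5) z unfolding e_def by (metis subsetD)
  moreover have "str E (e z) = str E (r (h0 z))" if "z \<in> A \<times> N" for z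
  proof -
    have z: "z \<in> O3" "z \<in> O2" using that sub AN(5) by auto
    have "str E (e z) = str E (r (h z)) \<otimes>\<^bsub>E.H\<^esub> q z"
      using E.str_act[OF r_in[OF O2_U(1)[OF z(2)]] \<omega>_in[OF z(1)]] t\<omega>q[OF z(1)] by (simp add: e_def)
    also have "\<dots> = str E (r (h0 z))"
      using E.str_closed[OF r_in] O2_U[OF z(2)] by (simp add: q_def flip: E.H.m_assoc)
    finally show ?thesis .
  qed
  ultimately have "is_lift A N e" by (auto simp: is_lift_def h0_def)
  then show ?thesis using AN by (intro exI[of _ A] exI[of _ N] exI[of _ e]) simp
qed

text \<open>The two lifts need not agree at time \<open>b\<close>. Translating the second by their
  quotient at time \<open>b\<close> makes them agree, and as this quotient does not depend on time,
  the translated lift still has constant structure value.\<close>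

lemma is_lift_concat:
  assumes r1: "is_lift {a..b} N r1" and r2: "is_lift {b..c} N r2" and N: "N \<subseteq> topspace M"
    and ab: "a \<le> b" "b \<le> c"
  shows "\<exists>r. is_lift {a..c} N r"
proof -
  note r1_in = is_lift_in[OF r1 N] and r2_in = is_lift_in[OF r2 N]
  note p1 = is_liftD(2)[OF r1] and p2 = is_liftD(2)[OF r2]
  have s1: "str E (r1 (s, m)) = str E (r1 (b, m))" if "s \<in> {a..b}" "m \<in> N" for s m
    by (rule is_liftD(3)[OF r1]) (use that ab in auto)
  have s2: "str E (r2 (s, m)) = str E (r2 (b, m))" if "s \<in> {b..c}" "m \<in> N" for s m
    by (rule is_liftD(3)[OF r2]) (use that ab in auto)
  define d where "d m = bundle_div C E (r2 (b, m)) (r1 (b, m))" for m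
  have d: "d m \<in> carrier E.G" "ract E (r2 (b, m)) (d m) = r1 (b, m)" if "m \<in> N" for m
    unfolding d_def using r1_in r2_in p1 p2 that ab
    by (intro E.bundle_div_closed E.act_bundle_div; simp)+
  define r2' where "r2' z = ract E (r2 z) (d (snd z))" for z
  let ?Z2 = "subtopology X ({b..c} \<times> N)"
  have b2: "continuous_map ?Z2 X (\<lambda>z. (b, snd z))"
    by (intro continuous_map_pairedI continuous_map_from_subtopology continuous_map_snd) simp
  have cb: "continuous_map ?Z2 (tot E) (\<lambda>z. r (b, snd z))"
    if "continuous_map (subtopology X (S \<times> N)) (tot E) r" "b \<in> S" for r S
    by (rule continuous_map_compose'[OF that(1) continuous_map_into_subtopology[OF b2]])
      (use that(2) in auto)
  have "continuous_map ?Z2 (topG C) (\<lambda>z. d (snd z))"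
    unfolding d_def
    by (rule E.continuous_map_bundle_div[OF cb[of "{b..c}"] cb[of "{a..b}"]])
      (use is_liftD(1)[OF r1] is_liftD(1)[OF r2] ab p1 p2 in auto)
  then have r2'_cont: "continuous_map ?Z2 (tot E) r2'"
    unfolding r2'_def by (intro E.continuous_map_act is_liftD(1)[OF r2])
  have r2'_b: "r2' (b, m) = r1 (b, m)" if "m \<in> N" for m
    using d that by (simp add: r2'_def)
  have p2': "prj E (r2' (s, m)) = h (s, m)" if "s \<in> {b..c}" "m \<in> N" for s m
    using E.prj_act[OF r2_in d(1)] p2 that by (simp add: r2'_def)
  have s2': "str E (r2' (s, m)) = str E (r1 (b, m))" if "s \<in> {b..c}" "m \<in> N" for s m
  proof -
    have "str E (r2' (s, m)) = str E (r2' (b, m))"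
      using E.str_act[OF r2_in d(1)] s2[OF that] that ab by (simp add: r2'_def)
    then show ?thesis using r2'_b that by simp
  qed
  let ?Z = "subtopology X ({a..c} \<times> N)"
  define r where "r z = (if fst z \<le> b then r1 z else r2' z)" for z
  have "continuous_map ?Z (tot E) r"
    unfolding r_def
  proof (rule continuous_map_cases_le)
    show "continuous_map ?Z euclideanreal fst"
      by (intro continuous_map_from_subtopology continuous_map_fst)
    show "continuous_map (subtopology ?Z {z \<in> topspace ?Z. fst z \<le> b}) (tot E) r1"
      unfolding subtopology_subtopology
      by (rule continuous_map_from_subtopology_mono[OF is_liftD(1)[OF r1]]) auto
    show "continuous_map (subtopology ?Z {z \<in> topspace ?Z. b \<le> fst z}) (tot E) r2'"
      unfolding subtopology_subtopology
      by (rule continuous_map_from_subtopology_mono[OF r2'_cont]) auto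
    show "r1 z = r2' z" if "z \<in> topspace ?Z" "fst z = b" for z
      using r2'_b that by (cases z) auto
  qed simp
  moreover have "str E (r (s, m)) = str E (r1 (b, m))" if "s \<in> {a..c}" "m \<in> N" for s m
    using s1[of s m] s2'[of s m] that by (simp add: r_def)
  moreover have "prj E (r (s, m)) = h (s, m)" if "s \<in> {a..c}" "m \<in> N" for s m
    using p1[of s m] p2'[of s m] that by (simp add: r_def)
  ultimately have "is_lift {a..c} N r" by (simp add: is_lift_def)
  then show ?thesis by blast
qed

text \<open>Bisection plays the role of compactness of the interval: each concatenation intersects
  two neighbourhoods of \<open>x\<close>, so a neighbourhood survives.\<close>

lemma unit_interval_lift:
  assumes x: "x \<in> topspace M"
  shows "\<exists>N. openin M N \<and> x \<in> N \<and> (\<exists>r. is_lift {0..1} N r)"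
proof (rule Bolzano[of 0 1])
  show "(0::real) \<le> 1" by simp
next
  fix a b c :: real
  assume "\<exists>N. openin M N \<and> x \<in> N \<and> (\<exists>r. is_lift {a..b} N r)"
    "\<exists>N. openin M N \<and> x \<in> N \<and> (\<exists>r. is_lift {b..c} N r)" and ab: "a \<le> b" "b \<le> c"
  then obtain N1 r1 N2 r2 where N: "openin M N1" "x \<in> N1" "is_lift {a..b} N1 r1"
    "openin M N2" "x \<in> N2" "is_lift {b..c} N2 r2" by blast
  then have "openin M (N1 \<inter> N2)" by blast
  moreover have "\<exists>r. is_lift {a..c} (N1 \<inter> N2) r"
    using is_lift_mono[OF N(3), of "{a..b}" "N1 \<inter> N2"] is_lift_mono[OF N(6), of "{b..c}" "N1 \<inter> N2"]
      openin_subset[OF N(1)] ab by (intro is_lift_concat[of a b _ r1 c r2]) auto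
  ultimately show "\<exists>N. openin M N \<and> x \<in> N \<and> (\<exists>r. is_lift {a..c} N r)"
    using N by (intro exI[of _ "N1 \<inter> N2"]) auto
next
  fix s :: real
  obtain A N r where A: "open A" "s \<in> A" and N: "openin M N" "x \<in> N" "is_lift A N r"
    using local_lift[OF x] by blast
  obtain d where d: "d > 0" "\<And>y. \<bar>y - s\<bar> < d \<Longrightarrow> y \<in> A"
    using A unfolding open_real by blast
  have "\<exists>N. openin M N \<and> x \<in> N \<and> (\<exists>r. is_lift {a..b} N r)"
    if "a \<le> s" "s \<le> b" "b - a < d" for a b
  proof -
    have "{a..b} \<subseteq> A" using that d(2) by auto
    then have "is_lift {a..b} N r" by (rule is_lift_mono[OF N(3) _ order_refl])
    then show ?thesis using N by (intro exI[of _ N] conjI exI[of _ r])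
  qed
  then show "\<exists>d>0. \<forall>a b. a \<le> s \<and> s \<le> b \<and> b - a < d \<longrightarrow>
      (\<exists>N. openin M N \<and> x \<in> N \<and> (\<exists>r. is_lift {a..b} N r))"
    using d(1) by (intro exI[of _ d]) simp
qed

end

section \<open>Transport of fibres along lifts, and its gluing\<close>

context bibundle_homotopy
begin

text \<open>The total space of the pullback of \<open>E\<close> along \<open>h\<close>, restricted
  to \<open>[0, 1]\<close>. It will be viewed as a space over \<open>M\<close> only, so that
  operators over \<open>M\<close> may change the time.\<close>

definition Z :: "(real \<times> 'm \<times> 'e) topology" where
  "Z = subtopology (prod_topology (top_of_set {0..1}) (prod_topology M (tot E)))
     {(s, m, e). h (s, m) = prj E e}"

lemma topspace_Z: "(s, m, e) \<in> topspace Z \<longleftrightarrow>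
    0 \<le> s \<and> s \<le> 1 \<and> m \<in> topspace M \<and> e \<in> topspace (tot E) \<and> h (s, m) = prj E e"
  by (auto simp: Z_def)

lemma continuous_map_Z:
  "continuous_map Z (top_of_set {0..1}) fst"
  "continuous_map Z M (\<lambda>z. fst (snd z))"
  "continuous_map Z (tot E) (\<lambda>z. snd (snd z))"
  unfolding Z_def
  by (intro continuous_map_from_subtopology continuous_map_fst,
      intro continuous_map_from_subtopology continuous_map_compose'[OF continuous_map_fst continuous_map_snd],
      intro continuous_map_from_subtopology continuous_map_compose'[OF continuous_map_snd continuous_map_snd])

definition lift :: "'m set \<Rightarrow> real \<times> 'm \<Rightarrow> 'e" where
  "lift V = (SOME r. is_lift {0..1} V r)"

text \<open>Parallel transport with respect to the lift as a frame: the coordinate of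
  \<open>e\<close> relative to the lift is kept while the time changes. Since the structure value of
  the lift is constant, that of \<open>e\<close> is preserved.\<close>

definition transport :: "'m set \<Rightarrow> real \<Rightarrow> real \<Rightarrow> 'm \<Rightarrow> 'e \<Rightarrow> 'e" where
  "transport V s s' m e = ract E (lift V (s', m)) (bundle_div C E (lift V (s, m)) e)"

text \<open>With the maximum, time never decreases, stays in \<open>[0, 1]\<close>, is unchanged
  where \<open>\<mu>\<close> is 0, and stays at 1 once some bump function equal to 1 has
  acted.\<close>

definition advance :: "'m set \<Rightarrow> ('m \<Rightarrow> real) \<Rightarrow> real \<times> 'm \<times> 'e \<Rightarrow> real \<times> 'm \<times> 'e" where
  "advance V \<mu> = (\<lambda>(s, m, e). (max s (\<mu> m), m, transport V s (max s (\<mu> m)) m e))"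

context
  fixes V assumes V: "openin M V" "\<exists>r. is_lift {0..1} V r"
begin

lemma is_lift_lift: "is_lift {0..1} V (lift V)"
  unfolding lift_def using V(2) by (rule someI_ex)

lemma lift_in: "s \<in> {0..1} \<Longrightarrow> m \<in> V \<Longrightarrow> lift V (s, m) \<in> topspace (tot E)"
  by (rule is_lift_in[OF is_lift_lift openin_subset[OF V(1)]])

lemmas prj_lift = is_liftD(2)[OF is_lift_lift] and str_lift = is_liftD(3)[OF is_lift_lift]

lemma transport:
  assumes "s \<in> {0..1}" "s' \<in> {0..1}" "m \<in> V" "e \<in> topspace (tot E)" "prj E e = h (s, m)"
  shows transport_in: "transport V s s' m e \<in> topspace (tot E)"
    and prj_transport: "prj E (transport V s s' m e) = h (s', m)"
    and str_transport: "str E (transport V s s' m e) = str E e"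
    and transport_act: "g \<in> carrier E.G \<Longrightarrow>
      transport V s s' m (ract E e g) = ract E (transport V s s' m e) g"
    and transport_id: "transport V s s m e = e"
proof -
  let ?d = "bundle_div C E (lift V (s, m)) e"
  note l = lift_in[OF assms(1,3)] and l' = lift_in[OF assms(2,3)]
  have p: "prj E (lift V (s, m)) = prj E e" using prj_lift[OF assms(1,3)] assms(5) by simp
  have d: "?d \<in> carrier E.G" "ract E (lift V (s, m)) ?d = e"
    by (rule E.bundle_div_closed[OF l assms(4) p], rule E.act_bundle_div[OF l assms(4) p])
  show "transport V s s' m e \<in> topspace (tot E)" "prj E (transport V s s' m e) = h (s', m)"
    unfolding transport_def using E.act_closed[OF l' d(1)] E.prj_act[OF l' d(1)] prj_lift[OF assms(2,3)]
    by simp_all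
  have "str E (transport V s s' m e) = str E (lift V (s, m)) \<otimes>\<^bsub>E.H\<^esub> bdry C ?d"
    unfolding transport_def using E.str_act[OF l' d(1)] str_lift[OF assms(2,1,3)] by simp
  also have "\<dots> = str E e" using E.str_act[OF l d(1)] d(2) by simp
  finally show "str E (transport V s s' m e) = str E e" .
  show "transport V s s' m (ract E e g) = ract E (transport V s s' m e) g" if "g \<in> carrier E.G"
    unfolding transport_def using E.bundle_div_act_act[OF l assms(4) p that] E.act_mult[OF l' d(1) that]
    by simp
  show "transport V s s m e = e" unfolding transport_def by (rule d(2))
qed

lemma continuous_map_advance:
  assumes \<mu>: "continuous_map M (top_of_set {0..1}) \<mu>"
  shows "continuous_map (subtopology Z {z \<in> topspace Z. fst (snd z) \<in> V}) Z (advance V \<mu>)"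
    (is "continuous_map ?Z Z _")
proof -
  note Z = continuous_map_Z[THEN continuous_map_from_subtopology]
  have 1: "continuous_map ?Z (top_of_set {0..1}) (\<lambda>z. \<mu> (fst (snd z)))"
    by (rule continuous_map_compose'[OF \<mu> Z(2)])
  have s': "continuous_map ?Z (top_of_set {0..1}) (\<lambda>z. max (fst z) (\<mu> (fst (snd z))))"
  proof (rule continuous_map_into_subtopology)
    show "continuous_map ?Z euclidean (\<lambda>z. max (fst z) (\<mu> (fst (snd z))))"
      by (rule continuous_map_real_max[OF continuous_map_into_fulltopology[OF Z(1)]
            continuous_map_into_fulltopology[OF 1]])
    show "(\<lambda>z. max (fst z) (\<mu> (fst (snd z)))) \<in> topspace ?Z \<rightarrow> {0..1}"
      using continuous_map_image[OF 1] continuous_map_image[OF Z(1)] by (auto simp: Pi_iff max_def)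
  qed
  have lift: "continuous_map ?Z (tot E) (\<lambda>z. lift V (f z, fst (snd z)))"
    if f: "continuous_map ?Z (top_of_set {0..1}) f" for f
    by (rule continuous_map_compose'[OF is_liftD(1)[OF is_lift_lift]
          continuous_map_into_subtopology[OF continuous_map_pairedI[OF
            continuous_map_into_fulltopology[OF f] Z(2)]]])
      (use continuous_map_image[OF f] in auto)
  have prj: "prj E (lift V (fst z, fst (snd z))) = prj E (snd (snd z))" if "z \<in> topspace ?Z" for z
    using that by (cases z) (auto simp: topspace_Z prj_lift)
  have tr: "continuous_map ?Z (tot E)
      (\<lambda>z. transport V (fst z) (max (fst z) (\<mu> (fst (snd z)))) (fst (snd z)) (snd (snd z)))"
    unfolding transport_def
    by (intro E.continuous_map_act E.continuous_map_bundle_div lift[OF s'] lift[OF Z(1)] Z(3) prj)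
  then have "continuous_map ?Z (prod_topology (top_of_set {0..1}) (prod_topology M (tot E))) (advance V \<mu>)"
    unfolding advance_def case_prod_unfold by (intro continuous_map_pairedI s' Z(2))
  moreover have "advance V \<mu> z \<in> {(s, m, e). h (s, m) = prj E e}" if z: "z \<in> topspace ?Z" for z
    using continuous_map_image[OF s' z] z
    by (cases z) (simp add: advance_def topspace_Z prj_transport)
  ultimately show ?thesis
    unfolding Z_def by (intro continuous_map_into_subtopology) (auto simp: Z_def)
qed

end

definition advance_data :: "'m \<Rightarrow> ('m set \<times> ('m \<Rightarrow> real)) list \<Rightarrow> bool" where
  "advance_data x zs \<longleftrightarrow> (\<forall>(V, \<mu>)\<in>set zs. openin M V \<and> (\<exists>r. is_lift {0..1} V r) \<and> x \<in> V \<and>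
     continuous_map M (top_of_set {0..1}) \<mu>)"

abbreviation "advances \<equiv> fold (\<lambda>(V, \<mu>). advance V \<mu>)"

lemma advance_data_Cons:
  "advance_data x ((V, \<mu>) # zs) \<longleftrightarrow> openin M V \<and> (\<exists>r. is_lift {0..1} V r) \<and> x \<in> V \<and>
     continuous_map M (top_of_set {0..1}) \<mu> \<and> advance_data x zs"
  by (auto simp: advance_data_def)

lemma advance:
  assumes V: "openin M V" "\<exists>r. is_lift {0..1} V r" "m \<in> V" "continuous_map M (top_of_set {0..1}) \<mu>"
    and z: "(s, m, e) \<in> topspace Z"
  obtains s' e' where "advance V \<mu> (s, m, e) = (s', m, e')" "(s', m, e') \<in> topspace Z"
    "str E e' = str E e" "s \<le> s'" "\<mu> m \<le> s'"
    "\<forall>g\<in>carrier E.G. advance V \<mu> (s, m, ract E e g) = (s', m, ract E e' g)"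
proof -
  define s' where "s' = max s (\<mu> m)"
  have s': "s' \<in> {0..1}" and s: "s \<in> {0..1}"
    using continuous_map_image[OF V(4), of m] z by (auto simp: topspace_Z s'_def)
  have e: "e \<in> topspace (tot E)" "prj E e = h (s, m)" using z by (auto simp: topspace_Z)
  note tr = transport[OF V(1,2) s s' V(3) e]
  show thesis
  proof (rule that[of s' "transport V s s' m e"])
    show "advance V \<mu> (s, m, e) = (s', m, transport V s s' m e)" by (simp add: advance_def s'_def)
    show "(s', m, transport V s s' m e) \<in> topspace Z"
      using z s' tr(1,2) by (simp add: topspace_Z)
    show "\<forall>g\<in>carrier E.G. advance V \<mu> (s, m, ract E e g) = (s', m, ract E (transport V s s' m e) g)"
      using tr(4) by (simp add: advance_def flip: s'_def)
    show "str E (transport V s s' m e) = str E e" by (rule tr(3))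
  qed (simp_all add: s'_def)
qed

text \<open>The final time dominates all bump values involved. It does not depend on the point of
  the fibre, so \<open>e\<close> and its translates arrive in the same fibre and equivariance can be
  compared there.\<close>

lemma advances:
  assumes "advance_data m zs" "(s, m, e) \<in> topspace Z"
  shows "\<exists>s' e'. advances zs (s, m, e) = (s', m, e') \<and> (s', m, e') \<in> topspace Z \<and>
    str E e' = str E e \<and> s \<le> s' \<and> (\<forall>(V, \<mu>)\<in>set zs. \<mu> m \<le> s') \<and>
    (\<forall>g\<in>carrier E.G. advances zs (s, m, ract E e g) = (s', m, ract E e' g))"
  using assms
proof (induction zs arbitrary: s e)
  case Nil
  then show ?case by (intro exI[of _ s] exI[of _ e]) simp
next
  case (Cons z zs)
  obtain V \<mu> where z: "z = (V, \<mu>)" by (cases z)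
  note V = Cons.prems(1)[unfolded z advance_data_Cons]
  obtain s1 e1 where 1: "advance V \<mu> (s, m, e) = (s1, m, e1)" "(s1, m, e1) \<in> topspace Z"
    "str E e1 = str E e" "s \<le> s1" "\<mu> m \<le> s1"
    "\<forall>g\<in>carrier E.G. advance V \<mu> (s, m, ract E e g) = (s1, m, ract E e1 g)"
    by (rule advance[of V m \<mu> s e]) (use V Cons.prems(2) in auto)
  obtain s' e' where 2: "advances zs (s1, m, e1) = (s', m, e')" "(s', m, e') \<in> topspace Z"
    "str E e' = str E e1" "s1 \<le> s'" "\<forall>(V, \<mu>)\<in>set zs. \<mu> m \<le> s'"
    "\<forall>g\<in>carrier E.G. advances zs (s1, m, ract E e1 g) = (s', m, ract E e' g)"
    using Cons.IH[OF _ 1(2)] V by blast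
  show ?case
    using 1 2 by (intro exI[of _ s'] exI[of _ e']) (auto simp: z)
qed

text \<open>Over each \<open>m\<close> some bump function is 1, so every point starting at time 0
  arrives exactly at time 1. The glued operator thus carries the first pullback into
  \<open>E\<close> over the end of the homotopy.\<close>

lemma isomorphic_pullbacks:
  "isomorphic_bibundles C (pullback_bibundle M (\<lambda>m. h (0, m)) E) (pullback_bibundle M (\<lambda>m. h (1, m)) E)"
proof -
  have cov: "\<exists>U. openin M U \<and> x \<in> U \<and> (\<exists>r. is_lift {0..1} U r)" if "x \<in> topspace M" for x
    by (rule unit_interval_lift[OF that])
  have mono: "\<exists>r. is_lift {0..1} V r" if "\<exists>r. is_lift {0..1} U r" "V \<subseteq> U" for U V
    using that is_lift_mono[OF _ order_refl that(2)] by (elim exE) (rule exI)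
  have b: "continuous_map Z M (\<lambda>z. fst (snd z))" by (rule continuous_map_Z(2))
  have bstep: "fst (snd (advance V \<mu> z)) = fst (snd z)" for V \<mu> z
    by (simp add: advance_def case_prod_unfold)
  have id: "advance V \<mu> z = z"
    if "openin M V" "\<exists>r. is_lift {0..1} V r" "continuous_map M (top_of_set {0..1}) \<mu>"
      "z \<in> topspace Z" "fst (snd z) \<in> V" "\<mu> (fst (snd z)) = 0" for V \<mu> z
    using transport_id[OF that(1,2), of "fst z" 0 "fst (snd z)" "snd (snd z)"] that(4-)
    by (cases z) (auto simp: advance_def topspace_Z)
  have "\<exists>\<Phi>. continuous_map Z Z \<Phi> \<and>
    (\<forall>x\<in>topspace M. \<exists>zs. (\<forall>(V, \<mu>)\<in>set zs. openin M V \<and> (\<exists>r. is_lift {0..1} V r) \<and> x \<in> V \<and>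
        continuous_map M (top_of_set {0..1}) \<mu>) \<and> (\<exists>(V, \<mu>)\<in>set zs. \<mu> x = 1) \<and>
      (\<forall>y\<in>topspace Z. fst (snd y) = x \<longrightarrow> \<Phi> y = advances zs y))"
    using M cov mono b continuous_map_advance bstep id by (rule glue_local_operators)
  then obtain \<Phi> where \<Phi>: "continuous_map Z Z \<Phi>"
    and \<Phi>': "\<forall>x\<in>topspace M. \<exists>zs. (\<forall>(V, \<mu>)\<in>set zs. openin M V \<and> (\<exists>r. is_lift {0..1} V r) \<and>
        x \<in> V \<and> continuous_map M (top_of_set {0..1}) \<mu>) \<and> (\<exists>(V, \<mu>)\<in>set zs. \<mu> x = 1) \<and>
      (\<forall>y\<in>topspace Z. fst (snd y) = x \<longrightarrow> \<Phi> y = advances zs y)"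
    by (elim exE conjE) (rule that)
  let ?Q = "pullback_bibundle M (\<lambda>m. h (0, m)) E"
  have hs: "continuous_map M B (\<lambda>m. h (s, m))" for s
    by (rule continuous_map_compose'[OF h]) (intro continuous_map_pairedI continuous_map_ident, simp)
  define F where "F = (\<lambda>(m, e). snd (snd (\<Phi> (0, m, e))))"
  have F: "F (m, e) \<in> topspace (tot E) \<and> prj E (F (m, e)) = h (1, m) \<and> str E (F (m, e)) = str E e \<and>
      (\<forall>g\<in>carrier E.G. F (m, ract E e g) = ract E (F (m, e)) g)"
    if me: "(m, e) \<in> topspace (tot ?Q)" for m e
  proof -
    have z: "(0, m, e) \<in> topspace Z" and m: "m \<in> topspace M"
      using me by (auto simp: E.topspace_pullback topspace_Z)
    obtain zs where zs: "\<forall>(V, \<mu>)\<in>set zs. openin M V \<and> (\<exists>r. is_lift {0..1} V r) \<and>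
        m \<in> V \<and> continuous_map M (top_of_set {0..1}) \<mu>" and one: "\<exists>(V, \<mu>)\<in>set zs. \<mu> m = 1"
      and \<Phi>zs: "\<forall>y\<in>topspace Z. fst (snd y) = m \<longrightarrow> \<Phi> y = advances zs y"
      using bspec[OF \<Phi>' m] by (elim exE conjE) (rule that)
    have "advance_data m zs" unfolding advance_data_def by (rule zs)
    from advances[OF this z] obtain s' e' where a: "advances zs (0, m, e) = (s', m, e')"
      "(s', m, e') \<in> topspace Z" "str E e' = str E e" "\<forall>(V, \<mu>)\<in>set zs. \<mu> m \<le> s'"
      "\<forall>g\<in>carrier E.G. advances zs (0, m, ract E e g) = (s', m, ract E e' g)" by blast
    have "1 \<le> s'" using one a(4) by auto
    then have "s' = 1" using a(2) by (simp add: topspace_Z)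
    moreover have Fe: "F (m, e) = e'" using \<Phi>zs z a(1) by (simp add: F_def)
    moreover have "F (m, ract E e g) = ract E e' g" if g: "g \<in> carrier E.G" for g
    proof -
      have "(0, m, ract E e g) \<in> topspace Z"
        using z g by (simp add: topspace_Z E.act_closed E.prj_act)
      then show ?thesis using \<Phi>zs a(5) g by (simp add: F_def)
    qed
    ultimately show ?thesis using a(2,3) by (simp add: topspace_Z)
  qed
  have "continuous_map (tot ?Q) Z (\<lambda>q. (0, fst q, snd q))"
    unfolding Z_def
    by (intro continuous_map_into_subtopology continuous_map_pairedI E.continuous_map_pullback_fst
        E.continuous_map_pullback_snd) (auto simp: E.topspace_pullback)
  then have "continuous_map (tot ?Q) Z (\<lambda>q. \<Phi> (0, fst q, snd q))"
    by (rule continuous_map_compose'[OF \<Phi>])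
  from continuous_map_compose'[OF continuous_map_Z(3) this]
  have F_cont: "continuous_map (tot ?Q) (tot E) F" by (simp add: F_def case_prod_unfold)
  show ?thesis
    by (rule E.isomorphic_pullback[OF E.bibundle_pullback[OF hs] hs F_cont])
      (use F in \<open>auto simp: E.pullback_simps\<close>)
qed

end

section \<open>Classification\<close>

text \<open>On a fibre of \<open>P\<close> the values of \<open>F\<close> differ by the action only,
  which \<open>prj E\<close> forgets. Continuity is checked on local sections of \<open>P\<close>,
  so the parameter space \<open>X\<close> can be carried along without any question about products
  of quotient maps.\<close>

lemma descend_equivariant_map:
  assumes C: "crossed_module C" and P: "principal_bundle C M P" and E: "principal_bundle C B E"
    and F: "continuous_map (prod_topology X (tot P)) (tot E) F"
    and act: "\<And>x p g. x \<in> topspace X \<Longrightarrow> p \<in> topspace (tot P) \<Longrightarrow> g \<in> carrier (grpG C) \<Longrightarrow>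
      F (x, ract P p g) = ract E (F (x, p)) g"
  obtains f where "continuous_map (prod_topology X M) B f"
    "\<forall>x\<in>topspace X. \<forall>p\<in>topspace (tot P). f (x, prj P p) = prj E (F (x, p))"
proof -
  interpret P: principal_bundle_over C M P using C P by unfold_locales
  interpret E: principal_bundle_over C B E using E by unfold_locales
  define f where "f = (\<lambda>(x, m). prj E (F (x, SOME p. p \<in> topspace (tot P) \<and> prj P p = m)))"
  have f: "f (x, prj P p) = prj E (F (x, p))" if x: "x \<in> topspace X" and p: "p \<in> topspace (tot P)" for x p
  proof -
    define q where "q = (SOME q. q \<in> topspace (tot P) \<and> prj P q = prj P p)"
    have q: "q \<in> topspace (tot P)" "prj P p = prj P q"
      using someI[of "\<lambda>q. q \<in> topspace (tot P) \<and> prj P q = prj P p" p] p by (auto simp: q_def)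
    define g where "g = bundle_div C P p q"
    have g: "g \<in> carrier P.G" "ract P p g = q"
      unfolding g_def by (rule P.bundle_div_closed[OF p q], rule P.act_bundle_div[OF p q])
    have "F (x, p) \<in> topspace (tot E)"
      using continuous_map_image[OF F, of "(x, p)"] x p by simp
    then have "prj E (F (x, q)) = prj E (F (x, p))"
      using act[OF x p g(1)] g E.prj_act by simp
    then show ?thesis by (simp add: f_def q_def)
  qed
  have "continuous_map (prod_topology X M) B f"
  proof (rule continuous_map_locally)
    fix z assume z: "z \<in> topspace (prod_topology X M)"
    then have "snd z \<in> topspace M" by auto
    then obtain U r where U: "openin M U" "snd z \<in> U"
      and r: "continuous_map (subtopology M U) (tot P) r" and pr: "\<forall>u\<in>U. prj P (r u) = u"
      by (rule P.local_section)
    define W where "W = {z \<in> topspace (prod_topology X M). snd z \<in> U}"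
    have W: "openin (prod_topology X M) W"
      unfolding W_def by (rule openin_continuous_map_preimage[OF continuous_map_snd U(1)])
    have "continuous_map (subtopology (prod_topology X M) W) (tot P) (\<lambda>z. r (snd z))"
      by (rule continuous_map_compose'[OF r continuous_map_into_subtopology[OF
            continuous_map_from_subtopology[OF continuous_map_snd]]]) (simp add: W_def)
    from continuous_map_compose'[OF E.continuous_map_prj continuous_map_compose'[OF F
        continuous_map_pairedI[OF continuous_map_from_subtopology[OF continuous_map_fst] this]]]
    have "continuous_map (subtopology (prod_topology X M) W) B (\<lambda>z. prj E (F (fst z, r (snd z))))" .
    moreover have "prj E (F (fst u, r (snd u))) = f u" if u: "u \<in> W" for u
    proof -
      have "r (snd u) \<in> topspace (tot P)"
        using continuous_map_image[OF r, of "snd u"] u by (auto simp: W_def)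
      then show ?thesis using f[of "fst u" "r (snd u)"] pr u by (auto simp: W_def)
    qed
    moreover have "z \<in> W" using z U(2) by (simp add: W_def)
    ultimately show "\<exists>W f'. openin (prod_topology X M) W \<and> z \<in> W \<and>
        continuous_map (subtopology (prod_topology X M) W) B f' \<and> (\<forall>u\<in>W. f' u = f u)"
      using W by (intro exI[of _ W] exI[of _ "\<lambda>z. prj E (F (fst z, r (snd z)))"] conjI ballI)
  qed
  then show thesis using f by (intro that[of f]) auto
qed

lemma homotopic_with_map_over:
  "homotopic_with (map_over M p q) M B f f' \<longleftrightarrow>
    (\<exists>h. continuous_map (prod_topology (top_of_set {0..1::real}) M) B h \<and>
      (\<forall>m\<in>topspace M. h (0, m) = f m) \<and> (\<forall>m\<in>topspace M. h (1, m) = f' m) \<and>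
      (\<forall>s\<in>{0..1}. \<forall>m\<in>topspace M. q (h (s, m)) = p m))"
  by (subst homotopic_with) (simp_all add: map_over_def)

context bibundle_contraction
begin

text \<open>Existence and uniqueness are stated for the same \<open>f\<close>: two maps that both
  underlie equivariant maps from \<open>P\<close> are then homotopic over the type because each is
  homotopic to \<open>f\<close>.\<close>

lemma classifying_map:
  obtains f where "continuous_map M B f" "isomorphic_bibundles C P (pullback_bibundle M f E)"
    "\<forall>f' F. continuous_map M B f' \<longrightarrow> continuous_map (tot P) (tot E) F \<longrightarrow>
      (\<forall>p\<in>topspace (tot P). prj E (F p) = f' (prj P p)) \<longrightarrow>
      (\<forall>p\<in>topspace (tot P). \<forall>g\<in>carrier P.G. F (ract P p g) = ract E (F p) g) \<longrightarrow>
      (\<forall>p\<in>topspace (tot P). str E (F p) = str P p) \<longrightarrow>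
      homotopic_with (map_over M (type_map C P) (type_map C E)) M B f' f"
proof -
  let ?I = "top_of_set {0..1::real}"
  obtain R where R: "continuous_map Y (tot E) (\<lambda>(p, e, s). R p e s)"
    and str_R: "\<forall>p e s. (p, e, s) \<in> topspace Y \<longrightarrow> str E (R p e s) = str P p"
    and R_act: "\<forall>p e s. (p, e, s) \<in> topspace Y \<longrightarrow>
      (\<forall>g\<in>carrier P.G. R (ract P p g) (ract E e g) s = ract E (R p e s) g)"
    and R_0: "\<forall>p e. (p, e, 0) \<in> topspace Y \<longrightarrow> R p e 0 = e"
    and R_1: "\<forall>p e e'. (p, e, 1) \<in> topspace Y \<longrightarrow> (p, e', 1) \<in> topspace Y \<longrightarrow> R p e 1 = R p e' 1"
    by (rule equivariant_contraction)
  have fibre: "\<exists>p\<in>topspace (tot P). prj P p = m" if "m \<in> topspace M" for m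
  proof -
    obtain U r where "openin M U" "m \<in> U" "continuous_map (subtopology M U) (tot P) r"
      "\<forall>u\<in>U. prj P (r u) = u" by (rule P.local_section[OF \<open>m \<in> topspace M\<close>])
    then show ?thesis
      using continuous_map_image[of "subtopology M U" "tot P" r m] \<open>m \<in> topspace M\<close> by auto
  qed
  have cont: "continuous_map X (tot E) (\<lambda>x. R (a x) (b x) (s x))"
    if "continuous_map X (tot P) a" "continuous_map X (tot E) b" "continuous_map X ?I s"
      "\<And>x. x \<in> topspace X \<Longrightarrow> str P (a x) = str E (b x)"
    for X :: "'z topology" and a b s
  proof -
    have "continuous_map X Y (\<lambda>x. (a x, b x, s x))"
      unfolding Y_def
      by (rule continuous_map_into_subtopology[OF continuous_map_pairedI[OF that(1)
              continuous_map_pairedI[OF that(2,3)]]]) (use that(4) in auto)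
    from continuous_map_compose'[OF R this] show ?thesis by simp
  qed
  have cont_str: "continuous_map (prod_topology ?I (tot P)) (tot E) (\<lambda>z. R (snd z) (F (snd z)) (fst z))"
    if "continuous_map (tot P) (tot E) F" "\<And>p. p \<in> topspace (tot P) \<Longrightarrow> str E (F p) = str P p" for F
    by (rule cont[OF continuous_map_snd continuous_map_compose'[OF that(1) continuous_map_snd]
          continuous_map_fst]) (use that(2) in auto)
  \<comment> \<open>\<open>\<sigma>\<close> need not be equivariant, but it only has to supply some
    admissible point of \<open>E\<close>: at strength 1 the choice is forgotten, and
    \<open>F1\<close> inherits equivariance from \<open>R\<close>.\<close>
  define F1 where "F1 p = R p (\<sigma> (str P p)) 1" for p
  have \<sigma>P: "continuous_map (tot P) (tot E) (\<lambda>p. \<sigma> (str P p))"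
    by (rule continuous_map_compose'[OF \<sigma> P.continuous_map_str])
  have F1_Y: "(p, \<sigma> (str P p), 1) \<in> topspace Y" if "p \<in> topspace (tot P)" for p
    using that continuous_map_image[OF \<sigma>P] by (simp add: topspace_Y P.str_closed str_\<sigma>)
  have F1: "continuous_map (tot P) (tot E) F1"
    unfolding F1_def by (rule cont[OF continuous_map_ident \<sigma>P]) (auto simp: P.str_closed str_\<sigma>)
  have F1_eq: "F1 p = R p e 1" if "(p, e, 1) \<in> topspace Y" for p e
    unfolding F1_def
    by (rule R_1[rule_format, OF F1_Y that]) (use that in \<open>simp add: topspace_Y\<close>)
  have str_F1: "str E (F1 p) = str P p" if "p \<in> topspace (tot P)" for p
    unfolding F1_def using str_R F1_Y[OF that] by blast
  have F1_act: "F1 (ract P p g) = ract E (F1 p) g" if p: "p \<in> topspace (tot P)" and g: "g \<in> carrier P.G" for p g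
  proof -
    have "(ract P p g, ract E (\<sigma> (str P p)) g, 1) \<in> topspace Y"
      using F1_Y[OF p] g by (simp add: topspace_Y P.act_closed E.act_closed P.str_act E.str_act)
    then have "F1 (ract P p g) = R (ract P p g) (ract E (\<sigma> (str P p)) g) 1" by (rule F1_eq)
    then show ?thesis using R_act F1_Y[OF p] g by (simp add: F1_def)
  qed
  \<comment> \<open>Here the parametrised descent is applied to a map that ignores the parameter;
    \<open>f\<close> is the slice at 1.\<close>
  obtain h where h: "continuous_map (prod_topology ?I M) B h"
    and h_eq: "\<forall>s\<in>topspace ?I. \<forall>p\<in>topspace (tot P). h (s, prj P p) = prj E (F1 (snd (s, p)))"
    by (rule descend_equivariant_map[OF P.crossed_module P.principal_bundle E.principal_bundle
          continuous_map_compose'[OF F1 continuous_map_snd[of ?I "tot P"]]]) (use F1_act in auto)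
  define f where "f m = h (1, m)" for m
  have f: "continuous_map M B f"
    unfolding f_def by (rule continuous_map_compose'[OF h]) (intro continuous_map_pairedI continuous_map_ident, simp)
  have f_eq: "f (prj P p) = prj E (F1 p)" if "p \<in> topspace (tot P)" for p
    using h_eq that by (simp add: f_def)
  show thesis
  proof (rule that[OF f])
    show "isomorphic_bibundles C P (pullback_bibundle M f E)"
      by (rule E.isomorphic_pullback[OF P.bibundle f F1]) (simp_all add: f_eq F1_act str_F1)
    show "\<forall>f' F. continuous_map M B f' \<longrightarrow> continuous_map (tot P) (tot E) F \<longrightarrow>
      (\<forall>p\<in>topspace (tot P). prj E (F p) = f' (prj P p)) \<longrightarrow>
      (\<forall>p\<in>topspace (tot P). \<forall>g\<in>carrier P.G. F (ract P p g) = ract E (F p) g) \<longrightarrow>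
      (\<forall>p\<in>topspace (tot P). str E (F p) = str P p) \<longrightarrow>
      homotopic_with (map_over M (type_map C P) (type_map C E)) M B f' f"
    proof (intro allI impI)
      fix f' F
      assume F: "continuous_map (tot P) (tot E) F"
        and prj_F: "\<forall>p\<in>topspace (tot P). prj E (F p) = f' (prj P p)"
        and F_act: "\<forall>p\<in>topspace (tot P). \<forall>g\<in>carrier P.G. F (ract P p g) = ract E (F p) g"
        and str_F: "\<forall>p\<in>topspace (tot P). str E (F p) = str P p"
      have F_Y: "(p, F p, s) \<in> topspace Y" if "p \<in> topspace (tot P)" "s \<in> {0..1}" for p s
        using that continuous_map_image[OF F] str_F by (simp add: topspace_Y)
      have K: "continuous_map (prod_topology ?I (tot P)) (tot E) (\<lambda>z. R (snd z) (F (snd z)) (fst z))"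
        by (rule cont_str[OF F]) (use str_F in auto)
      obtain h where h: "continuous_map (prod_topology ?I M) B h"
        and h_eq: "\<forall>s\<in>topspace ?I. \<forall>p\<in>topspace (tot P). h (s, prj P p) =
          prj E (R (snd (s, p)) (F (snd (s, p))) (fst (s, p)))"
        by (rule descend_equivariant_map[OF P.crossed_module P.principal_bundle E.principal_bundle K])
          (use F_act R_act F_Y in auto)
      have h_eq': "h (s, prj P p) = prj E (R p (F p) s)" if "p \<in> topspace (tot P)" "s \<in> {0..1}" for p s
        using h_eq that by simp
      have "h (0, m) = f' m \<and> h (1, m) = f m \<and>
          (\<forall>s\<in>{0..1}. type_map C E (h (s, m)) = type_map C P m)" if m: "m \<in> topspace M" for m
      proof -
        obtain p where p: "p \<in> topspace (tot P)" "m = prj P p" using fibre[OF m] by auto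
        have "h (0, m) = f' m"
          using h_eq'[OF p(1), of 0] R_0 F_Y[OF p(1), of 0] prj_F p by simp
        moreover have "h (1, m) = f m"
          using h_eq'[OF p(1), of 1] F1_eq[OF F_Y[OF p(1), of 1]] f_eq p by simp
        moreover have "type_map C E (h (s, m)) = type_map C P m" if s: "s \<in> {0..1}" for s
        proof -
          have "R p (F p) s \<in> topspace (tot E)"
            using continuous_map_image[OF R F_Y[OF p(1) s]] by simp
          from type_map_eq[OF P.crossed_module E.bibundle this]
          have "type_map C E (h (s, m)) = projH C (str P p)"
            using h_eq'[OF p(1) s] str_R F_Y[OF p(1) s] p by simp
          then show ?thesis using type_map_eq[OF P.crossed_module P.bibundle p(1)] p by simp
        qed
        ultimately show ?thesis by blast
      qed
      then show "homotopic_with (map_over M (type_map C P) (type_map C E)) M B f' f"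
        unfolding homotopic_with_map_over using h by (intro exI[of _ h]) simp
    qed
  qed
qed

end

text \<open>Isomorphism classes are formed among bibundles with total space in
  \<open>'m \<times> 'e\<close>, the type in which pullbacks of \<open>E\<close> live. The last
  conjunct shows that this loses nothing: a bibundle with total space in any type is isomorphic to
  such a pullback.\<close>

theorem theorem3p11:
  fixes C :: "('g, 'h) crossed_data"
    and B :: "'b topology"
    and E :: "('e, 'b, 'g, 'h) bibundle_data"
    and M :: "'m topology"
  assumes "crossed_module C"
    and "standing_assumptions C"
    and "bibundle C B E"
    and "homotopy_equivalence_over (tot E) (str E) (topH C) id (str E)"
    and "paracompact_space M"
  shows "(\<lambda>f. bibundle_iso_rel C M `` {pullback_bibundle M f E})
            respects homotopy_rel_over M B (type_map C E) \<and>
         bij_betw (\<lambda>K. \<Union>f\<in>K. bibundle_iso_rel C M `` {pullback_bibundle M f E})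
           (homotopy_classes_over M B (type_map C E))
           (pi0_Bibun C M :: ('m \<times> 'e, 'm, 'g, 'h) bibundle_data set set) \<and>
         (\<forall>P :: ('p, 'm, 'g, 'h) bibundle_data. bibundle C M P \<longrightarrow>
           (\<exists>f. continuous_map M B f \<and> isomorphic_bibundles C P (pullback_bibundle M f E)))"
proof -
  interpret E: bibundle_over C B E using assms(1,3) by unfold_locales
  let ?\<Phi> = "type_map C E"
  let ?pb = "\<lambda>f. pullback_bibundle M f E"
  let ?iso = "bibundle_iso_rel C M :: (('m \<times> 'e, 'm, 'g, 'h) bibundle_data \<times> _) set"
  obtain \<sigma> k where "continuous_map (topH C) (tot E) \<sigma>" "\<forall>h\<in>topspace (topH C). str E (\<sigma> h) = h"
    "continuous_map (prod_topology (tot E) (top_of_set {0..1::real})) (tot E) (\<lambda>(e, s). k e s)"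
    "\<forall>e\<in>topspace (tot E). k e 0 = e" "\<forall>e\<in>topspace (tot E). k e 1 = \<sigma> (str E e)"
    "\<forall>e\<in>topspace (tot E). \<forall>s\<in>{0..1}. str E (k e s) = str E e"
    by (rule homotopy_equivalence_over_base[OF assms(4)])
  note \<sigma>k = this
  \<comment> \<open>The type of the total space stays general, because the construction is needed
    both for pullbacks of \<open>E\<close> and for bibundles with points in
    \<open>'p\<close>.\<close>
  have contraction: "bibundle_contraction C M P B E \<sigma> k" if "bibundle C M P"
    for P :: "('q, 'm, 'g, 'h) bibundle_data"
    using assms(1,3,5) \<sigma>k that by unfold_locales (auto simp: E.H.topspace_eq_carrier)
  have exist: "\<exists>f. continuous_map M B f \<and> isomorphic_bibundles C P (?pb f)"
    if P: "bibundle C M P" for P :: "('q, 'm, 'g, 'h) bibundle_data"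
  proof -
    interpret bibundle_contraction C M P B E \<sigma> k by (rule contraction[OF P])
    obtain f where "continuous_map M B f" "isomorphic_bibundles C P (?pb f)"
      by (rule classifying_map)
    then show ?thesis by blast
  qed
  have eqv: "equiv {P. bibundle C M P} ?iso" by (rule equiv_bibundle_iso_rel[OF assms(1)])
  have pb: "bibundle C M (?pb f)" if "continuous_map M B f" for f
    by (rule E.bibundle_pullback[OF that])
  have class_eq: "?iso `` {P} = ?iso `` {Q} \<longleftrightarrow> isomorphic_bibundles C P Q"
    if "bibundle C M P" "bibundle C M Q" for P Q :: "('m \<times> 'e, 'm, 'g, 'h) bibundle_data"
    using eq_equiv_class_iff[OF eqv, of P Q] that by (simp add: bibundle_iso_rel_def)

  have resp: "isomorphic_bibundles C (?pb f0) (?pb f1)"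
    if f01: "(f0, f1) \<in> homotopy_rel_over M B ?\<Phi>" for f0 f1
  proof -
    have "homotopic_with (map_over M (?\<Phi> \<circ> f0) ?\<Phi>) M B f0 f1"
      using f01 by (simp add: homotopy_rel_over_def)
    then obtain h where h: "continuous_map (prod_topology (top_of_set {0..1::real}) M) B h"
      and h01: "\<forall>m. h (0, m) = f0 m" "\<forall>m. h (1, m) = f1 m"
      and type_h: "\<forall>s\<in>{0..1}. map_over M (?\<Phi> \<circ> f0) ?\<Phi> (\<lambda>m. h (s, m))"
      unfolding homotopic_with_def by (elim exE conjE) (rule that)
    \<comment> \<open>Clamping extends the homotopy to all real times without leaving its values, so
      the type remains constant.\<close>
    define c where "c s = max 0 (min 1 s)" for s :: real
    have c: "continuous_map euclideanreal (top_of_set {0..1}) c"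
      unfolding c_def by (intro continuous_map_into_subtopology continuous_intros) auto
    interpret bibundle_homotopy C B E M "\<lambda>(s, m). h (c s, m)"
    proof unfold_locales
      have "continuous_map (prod_topology euclideanreal M) B (\<lambda>z. h (c (fst z), snd z))"
        by (intro continuous_map_compose'[OF h] continuous_map_pairedI continuous_map_snd
            continuous_map_compose'[OF c continuous_map_fst])
      then show "continuous_map (prod_topology euclideanreal M) B (\<lambda>(s, m). h (c s, m))"
        by (simp add: case_prod_unfold)
      have "?\<Phi> (h (c s, m)) = ?\<Phi> (f0 m)" if "m \<in> topspace M" for s m
        using type_h that by (simp add: map_over_def c_def)
      then show "?\<Phi> (case (s, m) of (s, m) \<Rightarrow> h (c s, m)) = ?\<Phi> (case (s', m) of (s, m) \<Rightarrow> h (c s, m))"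
        if "m \<in> topspace M" for s s' m using that by simp
    qed (rule assms)+
    show ?thesis using isomorphic_pullbacks by (simp add: c_def h01)
  qed
  have rel_cont: "continuous_map M B f0 \<and> continuous_map M B f1"
    if "(f0, f1) \<in> homotopy_rel_over M B ?\<Phi>" for f0 f1
    using that by (auto simp: homotopy_rel_over_def dest: homotopic_with_imp_continuous_maps)
  have respects: "(\<lambda>f. ?iso `` {?pb f}) respects homotopy_rel_over M B ?\<Phi>"
  proof (rule congruentI)
    fix f0 f1 assume "(f0, f1) \<in> homotopy_rel_over M B ?\<Phi>"
    then show "?iso `` {?pb f0} = ?iso `` {?pb f1}"
      using resp rel_cont class_eq pb by blast
  qed

  \<comment> \<open>An isomorphism \<open>K\<close> provides two equivariant maps from the same
    bundle, the pullback along \<open>f0\<close>, into \<open>E\<close>: the second projection,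
    covering \<open>f0\<close>, and the second projection after \<open>K\<close>, covering
    \<open>f1\<close>. Both are compared with one classifying map.\<close>
  have inj: "(f0, f1) \<in> homotopy_rel_over M B ?\<Phi>"
    if f0: "continuous_map M B f0" and f1: "continuous_map M B f1"
      and iso: "isomorphic_bibundles C (?pb f0) (?pb f1)" for f0 f1
  proof -
    interpret bibundle_contraction C M "?pb f0" B E \<sigma> k by (rule contraction[OF pb[OF f0]])
    obtain K where K: "homeomorphic_map (tot (?pb f0)) (tot (?pb f1)) K"
      and prj_K: "\<forall>x \<in> topspace (tot (?pb f0)). prj (?pb f1) (K x) = prj (?pb f0) x"
      and K_act: "\<forall>x \<in> topspace (tot (?pb f0)). \<forall>g \<in> carrier (grpG C).
        K (ract (?pb f0) x g) = ract (?pb f1) (K x) g"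
      and str_K: "\<forall>x \<in> topspace (tot (?pb f0)). str (?pb f1) (K x) = str (?pb f0) x"
      using iso unfolding isomorphic_bibundles_def by blast
    have K_cont: "continuous_map (tot (?pb f0)) (tot (?pb f1)) K"
      by (rule homeomorphic_imp_continuous_map[OF K])
    have prj_snd: "f (fst x) = prj E (snd x)" if "x \<in> topspace (tot (?pb f))" for f x
      using that by (cases x) (simp add: E.topspace_pullback)
    obtain f where uniq: "\<forall>f' F. continuous_map M B f' \<longrightarrow> continuous_map (tot (?pb f0)) (tot E) F \<longrightarrow>
      (\<forall>p\<in>topspace (tot (?pb f0)). prj E (F p) = f' (prj (?pb f0) p)) \<longrightarrow>
      (\<forall>p\<in>topspace (tot (?pb f0)). \<forall>g\<in>carrier (grpG C). F (ract (?pb f0) p g) = ract E (F p) g) \<longrightarrow>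
      (\<forall>p\<in>topspace (tot (?pb f0)). str E (F p) = str (?pb f0) p) \<longrightarrow>
      homotopic_with (map_over M (type_map C (?pb f0)) ?\<Phi>) M B f' f"
      by (rule classifying_map)
    have h0: "homotopic_with (map_over M (type_map C (?pb f0)) ?\<Phi>) M B f0 f"
      by (rule uniq[rule_format, OF f0 E.continuous_map_pullback_snd])
        (simp_all add: E.pullback_simps prj_snd)
    have h1: "homotopic_with (map_over M (type_map C (?pb f0)) ?\<Phi>) M B f1 f"
    proof (rule uniq[rule_format, OF f1 continuous_map_compose'[OF E.continuous_map_pullback_snd K_cont]])
      fix x assume x: "x \<in> topspace (tot (?pb f0))"
      show "prj E (snd (K x)) = f1 (prj (?pb f0) x)"
        using prj_snd[OF continuous_map_image[OF K_cont x]] prj_K x by (simp add: E.pullback_simps)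
      show "str E (snd (K x)) = str (?pb f0) x"
        using str_K x by (simp add: E.pullback_simps)
      show "snd (K (ract (?pb f0) x g)) = ract E (snd (K x)) g" if "g \<in> carrier (grpG C)" for g
        using K_act x that by (simp add: E.pullback_simps)
    qed
    have h: "homotopic_with (map_over M (type_map C (?pb f0)) ?\<Phi>) M B f0 f1"
      using homotopic_with_trans[OF h0 homotopic_with_symD[OF h1]] .
    \<comment> \<open>That the pullback along \<open>f0\<close> has type
      \<open>?\<Phi> \<circ> f0\<close> is read off from the start of the homotopy.\<close>
    have "map_over M (type_map C (?pb f0)) ?\<Phi> = map_over M (?\<Phi> \<circ> f0) ?\<Phi>"
      using homotopic_with_imp_property[OF h] by (auto simp: map_over_def fun_eq_iff)
    then show ?thesis using h by (simp add: homotopy_rel_over_def)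
  qed

  let ?G = "\<lambda>K. \<Union>f\<in>K. ?iso `` {?pb f}"
  have G_class: "?G (homotopy_rel_over M B ?\<Phi> `` {f}) = ?iso `` {?pb f}" if "continuous_map M B f" for f
    using UN_equiv_class[OF equiv_homotopy_rel_over respects] that by simp
  have "bij_betw ?G (homotopy_classes_over M B ?\<Phi>) (pi0_Bibun C M)"
    unfolding bij_betw_def
  proof
    show "inj_on ?G (homotopy_classes_over M B ?\<Phi>)"
    proof (rule inj_onI)
      fix K0 K1 assume "K0 \<in> homotopy_classes_over M B ?\<Phi>" "K1 \<in> homotopy_classes_over M B ?\<Phi>"
        and eq: "?G K0 = ?G K1"
      then obtain f0 f1 where f: "continuous_map M B f0" "continuous_map M B f1"
        and K: "K0 = homotopy_rel_over M B ?\<Phi> `` {f0}" "K1 = homotopy_rel_over M B ?\<Phi> `` {f1}"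
        unfolding homotopy_classes_over_def by (auto elim!: quotientE)
      have "isomorphic_bibundles C (?pb f0) (?pb f1)"
        using eq class_eq[OF pb[OF f(1)] pb[OF f(2)]] unfolding K G_class[OF f(1)] G_class[OF f(2)] by simp
      then show "K0 = K1"
        unfolding K using inj[OF f] equiv_class_eq[OF equiv_homotopy_rel_over] by blast
    qed
    have "?G ` homotopy_classes_over M B ?\<Phi> = (\<lambda>f. ?iso `` {?pb f}) ` {f. continuous_map M B f}"
      unfolding homotopy_classes_over_def quotient_def using G_class by (auto simp: image_iff)
    also have "\<dots> = pi0_Bibun C M"
    proof
      show "(\<lambda>f. ?iso `` {?pb f}) ` {f. continuous_map M B f} \<subseteq> pi0_Bibun C M"
        unfolding pi0_Bibun_def using pb by (auto intro: quotientI)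
      show "pi0_Bibun C M \<subseteq> (\<lambda>f. ?iso `` {?pb f}) ` {f. continuous_map M B f}"
      proof
        fix c assume "c \<in> (pi0_Bibun C M :: ('m \<times> 'e, 'm, 'g, 'h) bibundle_data set set)"
        then obtain P where P: "bibundle C M P" "c = ?iso `` {P}"
          unfolding pi0_Bibun_def by (auto elim!: quotientE)
        obtain f where f: "continuous_map M B f" "isomorphic_bibundles C P (?pb f)"
          using exist[OF P(1)] by blast
        then have "c = ?iso `` {?pb f}" using class_eq[OF P(1) pb[OF f(1)]] P(2) by simp
        then show "c \<in> (\<lambda>f. ?iso `` {?pb f}) ` {f. continuous_map M B f}" using f(1) by blast
      qed
    qed
    finally show "?G ` homotopy_classes_over M B ?\<Phi> = pi0_Bibun C M" .
  qed
  then show ?thesis using respects exist by blast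
qed

end
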